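(* Suppose that $p=p(d)$ satisfies $p \ge \frac23 + \omega(\frac1d)$ (i.e., $d(p-\frac23)\to\infty$). Then as $d\to\infty$, \[ \mathbb{E}\, i(Q_{d,p}) = (1+o(1)) \cdot 2e^{\frac12 (2-p)^d} \cdot 2^{2^{d-1}}, \] and also $i(Q_{d,p}) = (1+o(1)) \cdot 2e^{\frac12 (2-p)^d} \cdot 2^{2^{d-1}}$ with high probability, i.e., $i(Q_{d,p})/\big(2e^{\frac12 (2-p)^d} 2^{2^{d-1}}\big)\to 1$ in probability.
   Context: $Q_d$ is the $d$-dimensional hypercube on $\{0,1\}^d$ (vertices adjacent iff they differ in exactly one coordinate). $Q_{d,p}$ is the random subgraph of $Q_d$ obtained by keeping each edge independently with probability $p$. $i(G)$ is the number of independent sets of a graph $G$ (including the empty set). *)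

theory Defs
  imports Complex_Main
begin

definition hc_verts :: "nat \<Rightarrow> bool list set" where
  "hc_verts d = {xs. length xs = d}"

definition hc_adj :: "bool list \<Rightarrow> bool list \<Rightarrow> bool" where
  "hc_adj x y \<longleftrightarrow> length x = length y \<and> card {i. i < length x \<and> x ! i \<noteq> y ! i} = 1"

definition hc_edges :: "nat \<Rightarrow> bool list set set" where
  "hc_edges d = {{x, y} | x y. x \<in> hc_verts d \<and> y \<in> hc_verts d \<and> hc_adj x y}"

definition indep_sets :: "nat \<Rightarrow> bool list set set \<Rightarrow> bool list set set" where
  "indep_sets d F = {I. I \<subseteq> hc_verts d \<and> (\<forall>e\<in>F. \<not> e \<subseteq> I)}"

definition num_indep :: "nat \<Rightarrow> bool list set set \<Rightarrow> nat" where
  "num_indep d F = card (indep_sets d F)"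

text \<open>Probability that Q_{d,p} has edge set exactly F (each edge kept independently with prob. p).\<close>
definition subgraph_prob :: "nat \<Rightarrow> real \<Rightarrow> bool list set set \<Rightarrow> real" where
  "subgraph_prob d p F = p ^ card F * (1 - p) ^ (card (hc_edges d) - card F)"

definition expected_indep :: "nat \<Rightarrow> real \<Rightarrow> real" where
  "expected_indep d p = (\<Sum>F\<in>Pow (hc_edges d). subgraph_prob d p F * real (num_indep d F))"

definition qdp_prob :: "nat \<Rightarrow> real \<Rightarrow> (bool list set set \<Rightarrow> bool) \<Rightarrow> real" where
  "qdp_prob d p P = (\<Sum>F\<in>{F\<in>Pow (hc_edges d). P F}. subgraph_prob d p F)"

end

theory Submission
  imports Defs "HOL-Analysis.Analysis" "HOL-Real_Asymp.Real_Asymp"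
begin

text \<open>
  Write \<open>q = 1 - p\<close>. Averaging over the random subgraph, an independent set with even part \<open>A\<close>
  and odd part \<open>B\<close> has weight \<open>q\<close> to the number of cube edges between \<open>A\<close> and \<open>B\<close>; summing over
  \<open>B\<close> gives each even set \<open>A\<close> the weight \<open>\<Prod>\<^bsub>v\<^esub> (1 + q\<^bsup>deg\<^esup>) / 2\<close>, where \<open>deg\<close> is the number of
  neighbours of \<open>v\<close> in \<open>A\<close>. The dominant sets have few, far apart vertices on one side, and
  contribute \<open>exp (2\<^bsup>d-1\<^esup> ((1 + q) / 2)\<^bsup>d\<^esup>)\<close>.

  Upper bound for the first moment: decompose \<open>A\<close> into components with respect to having a common
  neighbour. Small components are counted directly. For large ones, replacing \<open>q \<le> 1/3\<close> by a
  number close to \<open>1\<close> multiplies the weight by a constant for every vertex of low degree into \<open>A\<close>,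
  while Finner's inequality still controls the total; hence low-degree vertices are rare, the
  neighbourhood of \<open>A\<close> is determined by few of its vertices, and vertex isoperimetry makes the number
  of \<open>A\<close> with a given neighbourhood small. The same argument without connectivity excludes
  independent sets that are large on both sides.

  Concentration: the second moment is only taken over the dominant configurations, for
  which it is an explicit product. The overlap of two copies contributes
  \<open>((1 + 3 q) / 2)\<^bsup>d\<^esup>\<close>, which vanishes precisely because \<open>d (p - 2/3) \<rightarrow> \<infinity>\<close>.
\<close>

section \<open>Generalised Hoelder inequality and counting connected sets\<close>

text \<open>At q = 1/3 two nearby vertices contribute about 2^d (2/3)^(2d) = (8/9)^d up to powers of
  d. This vanishes, so only single vertices survive, and forgetting the compatibility of components
  costs nothing in the upper bound. Beyond about d vertices the codegree bound no longer forces
  expansion by a factor of order d, and the weight argument has to take over. Its parameters form a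
  chain of exponents: degree threshold d^(3/4), proportion of low vertices d^(-7/10), deficit of the
  closure d^(-6/10). Describing an approximating set costs d^(-3/4) up to logarithms per vertex of
  the neighbourhood, and isoperimetry supplies a deficit of order d^(-1/2); each exponent leaves
  room for the logarithms lost at the previous one. The way back from dominant configurations to all
  independent sets is one-sided: pointwise, the dominant count is at most the full count plus a
  negligible overlap. Since the means agree asymptotically, the difference is small in L1, and
  Chebyshev is applied to the dominant count alone.\<close>

lemma sum_Pow_insert:
  assumes "finite S" "u \<notin> S"
  shows "(\<Sum>A\<in>Pow (insert u S). f A) = (\<Sum>A\<in>Pow S. f A) + (\<Sum>A\<in>Pow S. f (insert u A))"
proof -
  have "inj_on (insert u) (Pow S)"
    using assms(2) by (intro inj_onI) (metis PowD insert_absorb insert_ident insert_subset subsetD)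
  moreover have "Pow S \<inter> insert u ` Pow S = {}"
    using assms(2) by auto
  ultimately show ?thesis
    using assms(1) by (simp add: Pow_insert sum.union_disjoint sum.reindex)
qed

text \<open>After division by the factors \<open>(a i + b i) powr (1/d)\<close> this is the
  arithmetic-geometric mean inequality for \<open>d\<close> numbers. The \<open>d - card I\<close>
  missing numbers are filled in by 1/2 in both products, so that the two arithmetic means add up to
  exactly 1.\<close>

lemma two_term_hoelder:
  fixes a b :: "'i \<Rightarrow> real"
  assumes fin: "finite I" and k: "card I \<le> d" and d: "d \<ge> 1"
    and a: "\<And>i. i \<in> I \<Longrightarrow> a i \<ge> 0" and b: "\<And>i. i \<in> I \<Longrightarrow> b i \<ge> 0"
  shows "(\<Prod>i\<in>I. a i powr (1/d)) + (\<Prod>i\<in>I. b i powr (1/d))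
           \<le> 2 powr (real (d - card I) / d) * (\<Prod>i\<in>I. (a i + b i) powr (1/d))"
proof (cases "\<exists>i\<in>I. a i + b i = 0")
  case True
  then obtain i where i: "i \<in> I" "a i = 0" "b i = 0"
    using a b by (metis add_nonneg_eq_0_iff)
  have "(\<Prod>i\<in>I. a i powr (1/d)) = 0" "(\<Prod>i\<in>I. b i powr (1/d)) = 0"
    using fin i by (auto intro!: bexI[of _ i])
  then show ?thesis
    by (simp add: prod_nonneg)
next
  case False
  then have c: "a i + b i > 0" if "i \<in> I" for i
    using that a b by (metis add_nonneg_nonneg order_le_imp_less_or_eq)
  define S where "S = I <+> {..<d - card I}"
  have S: "finite S" "card S = d"
    using fin k by (auto simp: S_def card_Plus)
  have *: "(\<Prod>i\<in>I. (g i / (a i + b i)) powr (1/d)) * (1/2) powr (real (d - card I) / d)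
      \<le> (\<Sum>i\<in>I. g i / (a i + b i)) / d + real (d - card I) / (2 * d)"
    if g: "\<forall>i\<in>I. g i \<ge> 0" for g
  proof -
    define x where "x = case_sum (\<lambda>i. g i / (a i + b i)) (\<lambda>_::nat. 1/2)"
    have nn: "x i \<ge> 0" if "i \<in> S" for i
      using that g c by (auto simp: S_def x_def split: sum.splits intro!: divide_nonneg_pos)
    have "(\<Prod>i\<in>S. x i) powr (1 / card S) \<le> (\<Sum>i\<in>S. x i / card S)"
      using S d nn by (intro arith_geom_mean) auto
    also have "(\<Sum>i\<in>S. x i / card S) = (\<Sum>i\<in>I. g i / (a i + b i)) / d + real (d - card I) / (2 * d)"
      using S fin by (simp add: S_def x_def sum.Plus sum_divide_distrib[symmetric] add_divide_distrib)
    also have "(\<Prod>i\<in>S. x i) = (\<Prod>i\<in>I. g i / (a i + b i)) * (1/2) ^ (d - card I)"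
      using fin by (simp add: S_def x_def prod.Plus)
    also have "((\<Prod>i\<in>I. g i / (a i + b i)) * (1/2) ^ (d - card I)) powr (1 / card S) =
        (\<Prod>i\<in>I. (g i / (a i + b i)) powr (1/d)) * (1/2) powr (real (d - card I) / d)"
      using g c S by (subst powr_mult) (auto intro!: prod_nonneg divide_nonneg_pos
          simp: prod_powr_distrib powr_powr simp flip: powr_realpow)
    finally show ?thesis .
  qed
  let ?C = "\<Prod>i\<in>I. (a i + b i) powr (1/d)"
  let ?h = "(1/2::real) powr (real (d - card I) / d)"
  have Cpos: "?C > 0"
    using c by (intro prod_pos) (metis less_irrefl powr_gt_zero)
  have split: "(\<Prod>i\<in>I. (g i / (a i + b i)) powr (1/d)) = (\<Prod>i\<in>I. g i powr (1/d)) / ?C"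
    if "\<forall>i\<in>I. g i \<ge> 0" for g
    using that c by (simp add: powr_divide prod_dividef less_imp_le)
  have "(\<Prod>i\<in>I. a i powr (1/d)) / ?C * ?h + (\<Prod>i\<in>I. b i powr (1/d)) / ?C * ?h
     \<le> (\<Sum>i\<in>I. a i / (a i + b i)) / d + real (d - card I) / (2 * d)
      + ((\<Sum>i\<in>I. b i / (a i + b i)) / d + real (d - card I) / (2 * d))"
    using *[of a] *[of b] split[of a] split[of b] a b by (intro add_mono) auto
  also have "\<dots> = (\<Sum>i\<in>I. a i / (a i + b i) + b i / (a i + b i)) / d + real (d - card I) / d"
    by (simp add: sum.distrib add_divide_distrib)
  also have "(\<Sum>i\<in>I. a i / (a i + b i) + b i / (a i + b i)) = (\<Sum>i\<in>I. 1)"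
  proof (intro sum.cong refl)
    fix i assume "i \<in> I"
    then show "a i / (a i + b i) + b i / (a i + b i) = 1"
      using c[of i] by (simp add: add_divide_distrib[symmetric])
  qed
  also have "(\<Sum>i\<in>I. 1) / d + real (d - card I) / d = (1::real)"
    using k d by (simp add: add_divide_distrib[symmetric] of_nat_diff)
  finally have "((\<Prod>i\<in>I. a i powr (1/d)) + (\<Prod>i\<in>I. b i powr (1/d))) * ?h / ?C \<le> 1"
    by (simp add: add_divide_distrib distrib_right)
  then have "((\<Prod>i\<in>I. a i powr (1/d)) + (\<Prod>i\<in>I. b i powr (1/d))) * ?h \<le> ?C"
    using Cpos by (simp only: pos_divide_le_eq mult_1)
  then have "2 powr (real (d - card I) / d) * (((\<Prod>i\<in>I. a i powr (1/d)) + (\<Prod>i\<in>I. b i powr (1/d))) * ?h)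
      \<le> 2 powr (real (d - card I) / d) * ?C"
    by (intro mult_left_mono) auto
  moreover have "2 powr (real (d - card I) / d) * (z * ?h) = z" for z :: real
    by (simp add: powr_divide)
  ultimately show ?thesis
    by (simp only:)
qed

text \<open>Induction on \<open>S\<close>: deciding whether \<open>u\<close> belongs to
  \<open>A\<close> splits only the functions with \<open>u \<in> T v\<close>, and the halves are
  recombined by \<open>two_term_hoelder\<close>. A point in fewer than \<open>d\<close> of the sets
  \<open>T v\<close> is charged the power of 2 that constant functions on the missing sets would
  contribute.\<close>

lemma finner_inequality:
  fixes \<phi> :: "'v \<Rightarrow> 'u set \<Rightarrow> real" and T :: "'v \<Rightarrow> 'u set"
  assumes "finite S" and F: "finite F" and d: "d \<ge> 1"
    and "\<And>v B. v \<in> F \<Longrightarrow> \<phi> v B \<ge> 0"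
    and "\<And>u. u \<in> S \<Longrightarrow> card {v\<in>F. u \<in> T v} \<le> d"
  shows "(\<Sum>A\<in>Pow S. \<Prod>v\<in>F. \<phi> v (A \<inter> T v))
     \<le> 2 powr (\<Sum>u\<in>S. real (d - card {v\<in>F. u \<in> T v}) / d)
        * (\<Prod>v\<in>F. (\<Sum>B\<in>Pow (S \<inter> T v). \<phi> v B ^ d) powr (1/d))"
  using assms(1,4,5)
proof (induction S arbitrary: \<phi> rule: finite_induct)
  case empty
  have "(\<phi> v {} ^ d) powr (1/d) = \<phi> v {}" if "v \<in> F" for v
    using empty(1)[OF that, of "{}"] d by (cases "\<phi> v {} = 0") (auto simp: powr_powr simp flip: powr_realpow)
  then show ?case by simp
next
  case (insert u S)
  \<comment> \<open>\<open>\<phi>'\<close> is \<open>\<phi>\<close> conditioned on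
    \<open>u \<in> A\<close>; the induction hypothesis is applied to both.\<close>
  define \<phi>' where "\<phi>' v B = (if u \<in> T v then \<phi> v (insert u B) else \<phi> v B)" for v B
  define f where "f \<psi> v = (\<Sum>B\<in>Pow (S \<inter> T v). \<psi> v B ^ d)" for \<psi> :: "'v \<Rightarrow> 'u set \<Rightarrow> real" and v
  define P where "P = 2 powr (\<Sum>u\<in>S. real (d - card {v\<in>F. u \<in> T v}) / d)"
  define F1 where "F1 = {v\<in>F. u \<in> T v}"
  define F2 where "F2 = {v\<in>F. u \<notin> T v}"
  have FF: "F = F1 \<union> F2" "F1 \<inter> F2 = {}" "finite F1" "finite F2"
    using F by (auto simp: F1_def F2_def)
  have nn: "\<phi>' v B \<ge> 0" if "v \<in> F" for v B
    using insert.prems(1) that by (simp add: \<phi>'_def)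
  have fnn: "f \<phi> v \<ge> 0" "f \<phi>' v \<ge> 0" if "v \<in> F" for v
    using insert.prems(1) nn that by (auto simp: f_def intro!: sum_nonneg)
  have "(\<Sum>A\<in>Pow (insert u S). \<Prod>v\<in>F. \<phi> v (A \<inter> T v))
      = (\<Sum>A\<in>Pow S. \<Prod>v\<in>F. \<phi> v (A \<inter> T v)) + (\<Sum>A\<in>Pow S. \<Prod>v\<in>F. \<phi>' v (A \<inter> T v))"
    unfolding sum_Pow_insert[OF insert(1,2)] \<phi>'_def Int_insert_left
    by (intro arg_cong2[where f = plus] refl sum.cong prod.cong) auto
  also have "\<dots> \<le> P * (\<Prod>v\<in>F. f \<phi> v powr (1/d)) + P * (\<Prod>v\<in>F. f \<phi>' v powr (1/d))"
    unfolding f_def P_def using insert.prems nn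
    by (intro add_mono insert.IH) auto
  also have "\<dots> = P * (\<Prod>v\<in>F2. f \<phi> v powr (1/d)) *
        ((\<Prod>v\<in>F1. f \<phi> v powr (1/d)) + (\<Prod>v\<in>F1. f \<phi>' v powr (1/d)))"
  proof -
    have "(\<Prod>v\<in>F2. f \<phi>' v powr (1/d)) = (\<Prod>v\<in>F2. f \<phi> v powr (1/d))"
      by (intro prod.cong) (auto simp: F2_def f_def \<phi>'_def)
    then show ?thesis
      unfolding FF(1) using FF(2-4) by (simp add: prod.union_disjoint algebra_simps)
  qed
  also have "\<dots> \<le> P * (\<Prod>v\<in>F2. f \<phi> v powr (1/d)) *
       (2 powr (real (d - card F1) / d) * (\<Prod>v\<in>F1. (f \<phi> v + f \<phi>' v) powr (1/d)))"
  proof (intro mult_left_mono two_term_hoelder)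
    show "card F1 \<le> d"
      using insert.prems(2)[of u] by (simp add: F1_def)
    show "f \<phi> v \<ge> 0" "f \<phi>' v \<ge> 0" if "v \<in> F1" for v
      using that fnn by (auto simp: F1_def)
    show "P * (\<Prod>v\<in>F2. f \<phi> v powr (1/d)) \<ge> 0"
      by (auto simp: P_def intro!: prod_nonneg mult_nonneg_nonneg)
  qed (use FF d in auto)
  also have "(\<Prod>v\<in>F2. f \<phi> v powr (1/d)) = (\<Prod>v\<in>F2. (\<Sum>B\<in>Pow (insert u S \<inter> T v). \<phi> v B ^ d) powr (1/d))"
    by (intro prod.cong) (auto simp: F2_def f_def)
  also have "(\<Prod>v\<in>F1. (f \<phi> v + f \<phi>' v) powr (1/d)) = (\<Prod>v\<in>F1. (\<Sum>B\<in>Pow (insert u S \<inter> T v). \<phi> v B ^ d) powr (1/d))"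
    using insert(1,2) by (intro prod.cong) (auto simp: F1_def f_def \<phi>'_def sum_Pow_insert Int_insert_left)
  also have "P * (\<Prod>v\<in>F2. (\<Sum>B\<in>Pow (insert u S \<inter> T v). \<phi> v B ^ d) powr (1/d)) *
      (2 powr (real (d - card F1) / d) * (\<Prod>v\<in>F1. (\<Sum>B\<in>Pow (insert u S \<inter> T v). \<phi> v B ^ d) powr (1/d)))
     = (2 powr (real (d - card F1) / d) * P) * (\<Prod>v\<in>F1 \<union> F2. (\<Sum>B\<in>Pow (insert u S \<inter> T v). \<phi> v B ^ d) powr (1/d))"
    using FF(2-4) by (simp add: prod.union_disjoint)
  also have "2 powr (real (d - card F1) / d) * P = 2 powr (\<Sum>u\<in>insert u S. real (d - card {v\<in>F. u \<in> T v}) / d)"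
    using insert(1,2) by (simp add: P_def F1_def powr_add)
  finally show ?case
    unfolding FF(1)[symmetric] .
qed

section \<open>Sums over subsets, and connected sets counted by walks\<close>

lemma sum_Pow_prod: 
  fixes x :: "'a \<Rightarrow> 'b :: comm_semiring_1"
  assumes "finite S"
  shows "(\<Sum>A\<in>Pow S. \<Prod>u\<in>A. x u) = (\<Prod>u\<in>S. 1 + x u)"
  using assms
proof (induction S rule: finite_induct)
  case (insert u S)
  have "(\<Sum>A\<in>Pow S. \<Prod>v\<in>insert u A. x v) = (\<Sum>A\<in>Pow S. x u * (\<Prod>v\<in>A. x v))"
    using insert(1,2) by (intro sum.cong prod.insert refl) (auto intro: finite_subset)
  then show ?case
    using insert by (simp add: sum_Pow_insert sum_distrib_left[symmetric] distrib_right)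
qed simp

lemma sum_Pow_power_card:
  fixes x :: "'b :: comm_semiring_1"
  assumes "finite S"
  shows "(\<Sum>A\<in>Pow S. x ^ card A) = (1 + x) ^ card S"
  using sum_Pow_prod[OF assms, of "\<lambda>_. x"] by simp

lemma sum_Pow_card:
  fixes f :: "nat \<Rightarrow> real"
  assumes "finite S"
  shows "(\<Sum>A\<in>Pow S. f (card A)) = (\<Sum>k\<le>card S. real (card S choose k) * f k)"
proof -
  have "(\<Sum>A\<in>Pow S. f (card A)) = (\<Sum>k\<le>card S. \<Sum>A\<in>{A\<in>Pow S. card A = k}. f (card A))"
    using assms by (intro sum.group[symmetric]) (auto simp: card_mono)
  also have "\<dots> = (\<Sum>k\<le>card S. real (card S choose k) * f k)"
    using n_subsets[OF assms] by (intro sum.cong) auto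
  finally show ?thesis .
qed

text \<open>Exponential tilting: each counted set has \<open>y powr (card A - r)\<close> at least 1,
  and the sum of \<open>y ^ card A\<close> over all subsets factorises. Most later uses take for
  \<open>y\<close> a negative power of \<open>d\<close>, so that \<open>1 + y\<close> is nearly
  1.\<close>

lemma card_small_subsets:
  fixes y r :: real
  assumes "finite S" "0 < y" "y \<le> 1"
  shows "real (card {A. A \<subseteq> S \<and> real (card A) \<le> r}) \<le> (1 + y) ^ card S * y powr (- r)"
proof -
  have "real (card {A. A \<subseteq> S \<and> real (card A) \<le> r}) = (\<Sum>A\<in>{A. A \<subseteq> S \<and> real (card A) \<le> r}. 1)"
    by simp
  also have "\<dots> \<le> (\<Sum>A\<in>{A. A \<subseteq> S \<and> real (card A) \<le> r}. y ^ card A * y powr (- r))"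
  proof (intro sum_mono)
    fix A assume "A \<in> {A. A \<subseteq> S \<and> real (card A) \<le> r}"
    then have "y powr 0 \<le> y powr (real (card A) - r)"
      using assms by (intro powr_mono') auto
    then show "1 \<le> y ^ card A * y powr (- r)"
      using assms by (simp add: powr_diff powr_minus powr_realpow divide_simps)
  qed
  also have "\<dots> \<le> (\<Sum>A\<in>Pow S. y ^ card A * y powr (- r))"
    using assms by (intro sum_mono2) auto
  also have "\<dots> = (1 + y) ^ card S * y powr (- r)"
    using assms by (simp add: sum_Pow_power_card sum_distrib_right[symmetric])
  finally show ?thesis .
qed

text \<open>Connectedness by cuts rather than paths: in this form a partial walk is extended by one
  vertex, and connectivity passes easily to dominating subsets. The empty set and singletons
  qualify.\<close>

definition linked :: "('a \<Rightarrow> 'a \<Rightarrow> bool) \<Rightarrow> 'a set \<Rightarrow> bool" where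
  "linked R C \<longleftrightarrow> (\<forall>D. D \<subset> C \<and> D \<noteq> {} \<longrightarrow> (\<exists>x\<in>D. \<exists>y\<in>C - D. R x y))"

text \<open>A connected set is covered by a closed walk that traverses each edge of a spanning tree twice.\<close>
lemma linked_walk:
  assumes "linked R C" "finite C" "r \<in> C" and sym: "\<And>x y. R x y \<Longrightarrow> R y x"
  shows "\<exists>l. set l = C \<and> length l = 2 * card C - 1 \<and> hd l = r \<and> successively R l"
proof -
  have "\<exists>D l. D \<subseteq> C \<and> set l = D \<and> card D = k \<and> length l = 2 * card D - 1 \<and> hd l = r \<and> successively R l"
    if "1 \<le> k" "k \<le> card C" for k
    using that
  proof (induction k rule: dec_induct)
    case base
    show ?case
      using assms(3) by (intro exI[of _ "{r}"] exI[of _ "[r]"]) auto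
  next
    case (step k)
    then obtain D l where D: "D \<subseteq> C" "set l = D" "card D = k" "length l = 2 * card D - 1"
      "hd l = r" "successively R l"
      by auto
    have "D \<noteq> {}" "D \<subset> C"
      using D step by auto
    then obtain x y where xy: "x \<in> D" "y \<in> C - D" "R x y"
      using assms(1) unfolding linked_def by blast
    then obtain xs ys where l: "l = xs @ x # ys"
      using D(2) by (metis split_list)
    \<comment> \<open>The detour x, y, x replaces one occurrence of x, so each new vertex lengthens
      the walk by two.\<close>
    let ?l = "xs @ [x, y, x] @ ys"
    have "successively R ?l"
      using D(6) xy(3) sym[OF xy(3)] unfolding l by (cases xs rule: rev_cases; cases ys) (auto simp: successively_append_iff successively_Cons)
    moreover have "set ?l = insert y D"
      using D(2) l by auto
    moreover have "card (insert y D) = Suc k"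
      using D xy assms(2) by (metis DiffE card_insert_disjoint finite_subset)
    moreover have "length ?l = 2 * Suc k - 1"
      using D l step by auto
    moreover have "hd ?l = r"
      using D(5) l by (cases xs) auto
    moreover have "insert y D \<subseteq> C"
      using D xy by auto
    ultimately show ?case
      by (intro exI[of _ "insert y D"] exI[of _ ?l]) simp
  qed
  moreover have "1 \<le> card C"
    using assms(2,3) by (metis One_nat_def Suc_leI card_gt_0_iff empty_iff)
  ultimately obtain D l where D: "D \<subseteq> C" "set l = D" "card D = card C"
    "length l = 2 * card D - 1" "hd l = r" "successively R l"
    by blast
  moreover have "D = C"
    using D(1,3) assms(2) by (simp add: card_subset_eq)
  ultimately show ?thesis
    by auto
qed

lemma card_walks_le:
  fixes R :: "'a \<Rightarrow> 'a \<Rightarrow> bool"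
  assumes "finite V" and nb: "\<And>x. x \<in> V \<Longrightarrow> card {y\<in>V. R x y} \<le> k" and r: "r \<in> V"
  shows "finite {l. set l \<subseteq> V \<and> length l = Suc n \<and> hd l = r \<and> successively R l}
    \<and> card {l. set l \<subseteq> V \<and> length l = Suc n \<and> hd l = r \<and> successively R l} \<le> k ^ n"
  using r
proof (induction n arbitrary: r)
  case 0
  have "{l. set l \<subseteq> V \<and> length l = Suc 0 \<and> hd l = r \<and> successively R l} = {[r]}"
    using 0 by (auto simp: length_Suc_conv)
  then show ?case by (simp only:) simp
next
  case (Suc n)
  let ?W = "\<lambda>n r. {l. set l \<subseteq> V \<and> length l = Suc n \<and> hd l = r \<and> successively R l}"
  have sub: "?W (Suc n) r \<subseteq> (\<Union>y\<in>{y\<in>V. R r y}. (#) r ` ?W n y)"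
  proof
    fix l assume l: "l \<in> ?W (Suc n) r"
    then obtain y zs where [simp]: "l = r # y # zs"
      by (auto simp: length_Suc_conv)
    show "l \<in> (\<Union>y\<in>{y\<in>V. R r y}. (#) r ` ?W n y)"
      using l by (auto simp: image_iff intro!: bexI[of _ y])
  qed
  have fin: "finite (\<Union>y\<in>{y\<in>V. R r y}. (#) r ` ?W n y)"
    using Suc.IH assms(1) by auto
  have "card (?W (Suc n) r) \<le> card (\<Union>y\<in>{y\<in>V. R r y}. (#) r ` ?W n y)"
    using fin sub by (rule card_mono)
  also have "\<dots> \<le> (\<Sum>y\<in>{y\<in>V. R r y}. card ((#) r ` ?W n y))"
    using assms(1) by (intro card_UN_le) auto
  also have "\<dots> \<le> (\<Sum>y\<in>{y\<in>V. R r y}. k ^ n)"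
    using Suc.IH by (intro sum_mono order_trans[OF card_image_le]) auto
  also have "\<dots> \<le> k * k ^ n"
    using nb[OF Suc.prems] by simp
  finally show ?case
    using finite_subset[OF sub fin] by simp
qed

text \<open>The set is recovered as the range of a walk from \<open>r\<close> with
  \<open>2 * (m - 1)\<close> steps, each with at most \<open>k\<close> choices.\<close>

lemma card_linked_sets_le:
  assumes "finite V" and nb: "\<And>x. x \<in> V \<Longrightarrow> card {y\<in>V. R x y} \<le> k" and r: "r \<in> V"
    and sym: "\<And>x y. R x y \<Longrightarrow> R y x" and m: "m \<ge> 1"
  shows "card {C. C \<subseteq> V \<and> r \<in> C \<and> card C = m \<and> linked R C} \<le> k ^ (2 * (m - 1))"
proof -
  let ?W = "{l. set l \<subseteq> V \<and> length l = Suc (2 * (m - 1)) \<and> hd l = r \<and> successively R l}"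
  have W: "finite ?W" "card ?W \<le> k ^ (2 * (m - 1))"
    using card_walks_le[OF assms(1) nb r] by auto
  have "{C. C \<subseteq> V \<and> r \<in> C \<and> card C = m \<and> linked R C} \<subseteq> set ` ?W"
  proof
    fix C assume C: "C \<in> {C. C \<subseteq> V \<and> r \<in> C \<and> card C = m \<and> linked R C}"
    then have "finite C" using assms(1) finite_subset by auto
    then obtain l where "set l = C" "length l = 2 * card C - 1" "hd l = r" "successively R l"
      using linked_walk[of R C r, OF _ _ _ sym] C by blast
    then show "C \<in> set ` ?W"
      using C m by (intro image_eqI[of _ _ l]) auto
  qed
  then show ?thesis
    using W by (meson card_image_le card_mono finite_imageI le_trans)
qed

section \<open>Bipartite graphs resembling the hypercube\<close>

text \<open>The properties of the cube on which the argument rests: bipartite and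
  \<open>d\<close>-regular, at most two common neighbours, and vertex expansion with gain of order 1
  / sqrt d away from full density. All of them are required for both sides, so \<open>dual\<close>
  transfers every result to the odd side.\<close>

locale cube_like =
  fixes d :: nat and E Od :: "'a set" and N :: "'a \<Rightarrow> 'a set"
  assumes d1: "d \<ge> 1"
    and finite_E: "finite E" and finite_Od: "finite Od"
    and card_E: "card E = 2 ^ (d - 1)" and card_Od: "card Od = 2 ^ (d - 1)"
    and N_E: "\<And>u. u \<in> E \<Longrightarrow> N u \<subseteq> Od" and N_Od: "\<And>v. v \<in> Od \<Longrightarrow> N v \<subseteq> E"
    and card_N_E: "\<And>u. u \<in> E \<Longrightarrow> card (N u) = d" and card_N_Od: "\<And>v. v \<in> Od \<Longrightarrow> card (N v) = d"
    and N_sym: "\<And>u v. u \<in> E \<Longrightarrow> v \<in> Od \<Longrightarrow> v \<in> N u \<longleftrightarrow> u \<in> N v"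
    and codegree_E: "\<And>u u'. u \<in> E \<Longrightarrow> u' \<in> E \<Longrightarrow> u \<noteq> u' \<Longrightarrow> card (N u \<inter> N u') \<le> 2"
    and codegree_Od: "\<And>u u'. u \<in> Od \<Longrightarrow> u' \<in> Od \<Longrightarrow> u \<noteq> u' \<Longrightarrow> card (N u \<inter> N u') \<le> 2"
    and iso_E: "\<And>A. A \<subseteq> E \<Longrightarrow>
      real (card (\<Union>(N ` A))) \<ge> card A + card A * (1 - card A / 2 ^ (d - 1)) / sqrt d"
    and iso_Od: "\<And>A. A \<subseteq> Od \<Longrightarrow>
      real (card (\<Union>(N ` A))) \<ge> card A + card A * (1 - card A / 2 ^ (d - 1)) / sqrt d"
begin

lemma dual: "cube_like d Od E N"
  by (rule cube_like.intro)
    (rule d1 finite_E finite_Od card_E card_Od N_E N_Od card_N_E card_N_Od codegree_E codegree_Od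
      iso_E iso_Od N_sym[symmetric]; assumption)+

section \<open>Neighbourhoods, degrees, weights and containers\<close>

definition nbh :: "'a set \<Rightarrow> 'a set" where "nbh A = \<Union>(N ` A)"

text \<open>Division by 2 gives a vertex without neighbours in \<open>A\<close> the factor 1. Hence
  the weight lives on \<open>nbh A\<close>, is 1 at the empty set, and is multiplicative over sets
  with disjoint neighbourhoods.\<close>

definition w :: "real \<Rightarrow> 'a set \<Rightarrow> real" where
  "w q A = (\<Prod>v\<in>Od. (1 + q ^ card (N v \<inter> A)) / 2)"

text \<open>For these vertices, raising \<open>q\<close> from 1/3 to \<open>2 powr (- 1 / h)\<close>
  multiplies the factor in \<open>w\<close> by a constant; for the remaining vertices of the
  neighbourhood the factor at 1/3 is already nearly 1/2.\<close>

definition low :: "real \<Rightarrow> 'a set \<Rightarrow> 'a set" where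
  "low h A = {v \<in> nbh A. real (card (N v \<inter> A)) < h}"

lemma nbh_subset: "A \<subseteq> E \<Longrightarrow> nbh A \<subseteq> Od"
  using N_E by (auto simp: nbh_def)

lemma finite_nbh: "A \<subseteq> E \<Longrightarrow> finite (nbh A)"
  using nbh_subset finite_Od finite_subset by blast

lemma nbh_mono: "A \<subseteq> B \<Longrightarrow> nbh A \<subseteq> nbh B"
  by (auto simp: nbh_def)

lemma nbh_Un: "nbh (A \<union> B) = nbh A \<union> nbh B"
  by (auto simp: nbh_def)

lemma finite_N: "v \<in> Od \<Longrightarrow> finite (N v)" "u \<in> E \<Longrightarrow> finite (N u)"
  by (rule finite_subset[OF N_Od finite_E], assumption) (rule finite_subset[OF N_E finite_Od], assumption)

lemma in_nbh_iff:
  assumes "A \<subseteq> E" "v \<in> Od"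
  shows "v \<in> nbh A \<longleftrightarrow> N v \<inter> A \<noteq> {}"
proof -
  have "v \<in> N u \<longleftrightarrow> u \<in> N v" if "u \<in> A" for u
    using that assms N_sym by blast
  then show ?thesis
    by (auto simp: nbh_def)
qed

lemma degree_zero_iff: "A \<subseteq> E \<Longrightarrow> v \<in> Od \<Longrightarrow> card (N v \<inter> A) = 0 \<longleftrightarrow> v \<notin> nbh A"
  using finite_N by (simp add: in_nbh_iff)

lemma sum_degree_swap:
  assumes "A \<subseteq> E" "B \<subseteq> Od"
  shows "(\<Sum>v\<in>B. card (N v \<inter> A)) = (\<Sum>u\<in>A. card (N u \<inter> B))"
proof -
  have fin: "finite A" "finite B"
    using assms finite_E finite_Od finite_subset by blast+
  have "(\<Sum>v\<in>B. card (N v \<inter> A)) = (\<Sum>v\<in>B. \<Sum>u\<in>A. if u \<in> N v then 1 else 0)"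
    using fin by (intro sum.cong) (auto simp: sum.If_cases Int_def conj_commute)
  also have "\<dots> = (\<Sum>u\<in>A. \<Sum>v\<in>B. if v \<in> N u then 1 else 0)"
    using assms N_sym by (subst sum.swap) (intro sum.cong refl if_cong, auto)
  also have "\<dots> = (\<Sum>u\<in>A. card (N u \<inter> B))"
    using fin by (intro sum.cong) (auto simp: sum.If_cases Int_def conj_commute)
  finally show ?thesis .
qed

lemma sum_degree:
  assumes "A \<subseteq> E"
  shows "(\<Sum>v\<in>Od. card (N v \<inter> A)) = d * card A"
proof -
  have "(\<Sum>u\<in>A. card (N u \<inter> Od)) = (\<Sum>u\<in>A. d)"
    using assms N_E card_N_E by (intro sum.cong) (auto simp: Int_absorb2 subset_iff)
  then show ?thesis
    using sum_degree_swap[OF assms order_refl] by simp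
qed

lemma sum_degree_nbh:
  assumes "A \<subseteq> E"
  shows "(\<Sum>v\<in>nbh A. card (N v \<inter> A)) = d * card A"
  unfolding sum_degree[OF assms, symmetric]
  using assms finite_Od nbh_subset degree_zero_iff by (intro sum.mono_neutral_left) auto

lemma card_le_nbh:
  assumes "A \<subseteq> E"
  shows "card A \<le> card (nbh A)"
proof -
  have "d * card A \<le> (\<Sum>v\<in>nbh A. d)"
    unfolding sum_degree_nbh[OF assms, symmetric]
    using assms nbh_subset card_N_Od finite_N by (intro sum_mono) (metis Int_lower1 card_mono subsetD)
  then show ?thesis
    using d1 by simp
qed

lemma card_nbh_le:
  assumes "A \<subseteq> E"
  shows "card (nbh A) \<le> d * card A"
proof -
  have "card (nbh A) \<le> (\<Sum>u\<in>A. card (N u))"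
    unfolding nbh_def using assms finite_E finite_subset by (intro card_UN_le) auto
  also have "\<dots> = d * card A"
    using assms card_N_E by (simp add: subset_iff)
  finally show ?thesis .
qed

lemma w_eq:
  assumes "A \<subseteq> E"
  shows "w q A = (\<Prod>v\<in>nbh A. (1 + q ^ card (N v \<inter> A)) / 2)"
  unfolding w_def
proof (intro prod.mono_neutral_right ballI)
  fix v assume "v \<in> Od - nbh A"
  then have "card (N v \<inter> A) = 0"
    using assms degree_zero_iff by blast
  then show "(1 + q ^ card (N v \<inter> A)) / 2 = 1"
    by simp
qed (use assms finite_Od nbh_subset in auto)

lemma w_nonneg: "q \<ge> 0 \<Longrightarrow> w q A \<ge> 0"
  unfolding w_def by (intro prod_nonneg) auto

lemma w_mono: "0 \<le> q \<Longrightarrow> q \<le> q' \<Longrightarrow> w q A \<le> w q' A"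
  unfolding w_def by (intro prod_mono) (auto intro!: power_mono divide_right_mono)

text \<open>\<open>finner_inequality\<close> with \<open>T v = N v\<close>. A vertex
  \<open>u\<close> misses \<open>card (N u - F)\<close> of its \<open>d\<close> possible sets, which
  costs at most \<open>2 powr (\<psi> / d)\<close>. The local sums are at most
  \<open>2 ^ (d + 2)\<close>, so each \<open>v\<close> costs 2 up to a factor
  \<open>2 powr (2 / d)\<close>; the 2 is the one divided out in \<open>w\<close>.\<close>

lemma hoelder_container:
  fixes q \<psi> :: real
  assumes S: "S \<subseteq> E" and F: "F \<subseteq> Od" and q: "q \<ge> 0"
    and Y: "(\<Sum>k\<le>d. real (d choose k) * (1 + q ^ k) ^ d) \<le> 2 ^ (d + 2)"
    and \<psi>: "\<And>u. u \<in> S \<Longrightarrow> real (card (N u - F)) \<le> \<psi>"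
  shows "(\<Sum>A\<in>Pow S. \<Prod>v\<in>F. 1 + q ^ card (N v \<inter> A))
    \<le> 2 powr (\<psi> * card S / d) * 2 powr (real (d + 2) * card F / d)"
proof -
  have fin: "finite S" "finite F"
    using assms finite_E finite_Od finite_subset by blast+
  have deg: "card {v \<in> F. u \<in> N v} = d - card (N u - F)" "card (N u - F) \<le> d" if "u \<in> S" for u
  proof -
    have "{v \<in> F. u \<in> N v} = N u - (N u - F)"
      using that S F N_sym by auto
    then show "card {v \<in> F. u \<in> N v} = d - card (N u - F)"
      using that S finite_N card_N_E by (simp add: card_Diff_subset subset_iff)
    show "card (N u - F) \<le> d"
      using that S finite_N card_N_E card_mono[of "N u" "N u - F"] by auto
  qed
  have "(\<Sum>A\<in>Pow S. \<Prod>v\<in>F. 1 + q ^ card (N v \<inter> A)) = (\<Sum>A\<in>Pow S. \<Prod>v\<in>F. (\<lambda>v B. 1 + q ^ card B) v (A \<inter> N v))"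
    by (simp add: Int_commute)
  also have "\<dots> \<le> 2 powr (\<Sum>u\<in>S. real (d - card {v\<in>F. u \<in> N v}) / d)
        * (\<Prod>v\<in>F. (\<Sum>B\<in>Pow (S \<inter> N v). (\<lambda>v B. 1 + q ^ card B) v B ^ d) powr (1/d))"
    using fin d1 q deg by (intro finner_inequality) auto
  also have "\<dots> \<le> 2 powr (\<psi> * card S / d) * (\<Prod>v\<in>F. (2 ^ (d + 2)) powr (1/d))"
  proof (intro mult_mono prod_mono conjI powr_mono2 powr_mono)
    have "(\<Sum>u\<in>S. real (d - card {v\<in>F. u \<in> N v}) / d) \<le> (\<Sum>u\<in>S. \<psi> / d)"
      using deg \<psi> by (intro sum_mono divide_right_mono) auto
    then show "(\<Sum>u\<in>S. real (d - card {v\<in>F. u \<in> N v}) / d) \<le> \<psi> * card S / d"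
      by (simp add: mult.commute)
    fix v assume v: "v \<in> F"
    have "(\<Sum>B\<in>Pow (S \<inter> N v). (1 + q ^ card B) ^ d) \<le> (\<Sum>B\<in>Pow (N v). (1 + q ^ card B) ^ d)"
      using v F finite_N q by (intro sum_mono2) auto
    also have "\<dots> = (\<Sum>k\<le>d. real (d choose k) * (1 + q ^ k) ^ d)"
      using v F finite_N card_N_Od sum_Pow_card[of "N v" "\<lambda>k. (1 + q ^ k) ^ d"] by auto
    finally show "(\<Sum>B\<in>Pow (S \<inter> N v). (1 + q ^ card B) ^ d) \<le> 2 ^ (d + 2)"
      using Y by simp
  qed (use q in \<open>auto intro!: sum_nonneg prod_nonneg\<close>)
  also have "(\<Prod>v\<in>F. (2 ^ (d + 2)) powr (1/d)) = (2::real) powr (real (d + 2) * card F / d)"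
  proof -
    have eq: "(2::real) ^ (d + 2) = 2 powr real (d + 2)"
      by (rule powr_realpow[symmetric]) simp
    have "((2::real) ^ (d + 2)) powr (1/d) = 2 powr (real (d + 2) * (1 / d))"
      unfolding eq powr_powr ..
    also have "\<dots> ^ card F = 2 powr (card F * (real (d + 2) * (1 / d)))"
      by (rule powr_power) simp
    finally show ?thesis
      unfolding prod_constant by (simp add: mult.commute)
  qed
  finally show ?thesis .
qed

lemma w_le_container:
  assumes "A \<subseteq> E" "F \<subseteq> Od" "0 \<le> q" "q \<le> 1"
  shows "w q A \<le> (\<Prod>v\<in>F. 1 + q ^ card (N v \<inter> A)) / 2 ^ card F"
proof -
  have fin: "finite F" "finite (Od - F)"
    using assms finite_Od finite_subset by blast+
  have "w q A = (\<Prod>v\<in>F. (1 + q ^ card (N v \<inter> A)) / 2) * (\<Prod>v\<in>Od - F. (1 + q ^ card (N v \<inter> A)) / 2)"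
    unfolding w_def using assms finite_Od by (metis mult.commute prod.subset_diff)
  also have "\<dots> \<le> (\<Prod>v\<in>F. (1 + q ^ card (N v \<inter> A)) / 2) * 1"
    using assms by (intro mult_left_mono prod_le_1 prod_nonneg) (auto simp: power_le_one)
  finally show ?thesis
    by (simp add: prod_dividef)
qed

text \<open>The part of the neighbourhood outside \<open>F\<close> need not be known, since its factors are at most \<open>1\<close>.\<close>
lemma container_weight:
  fixes q \<psi> :: real
  assumes F: "F \<subseteq> Od" "card F \<le> g" and q: "0 \<le> q" "q \<le> 1"
    and Y: "(\<Sum>k\<le>d. real (d choose k) * (1 + q ^ k) ^ d) \<le> 2 ^ (d + 2)"
    and \<psi>: "0 \<le> \<psi>" "\<psi> \<le> d / 2"
    and AA: "\<And>A. A \<in> \<A> \<Longrightarrow> A \<subseteq> E \<and> (\<forall>u\<in>A. real (card (N u - F)) \<le> \<psi>)"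
  shows "(\<Sum>A\<in>\<A>. w q A) \<le> 2 powr (g * (2 + 2 * \<psi>) / d)"
proof -
  define S where "S = {u \<in> E. real (card (N u - F)) \<le> \<psi>}"
  have S: "S \<subseteq> E" "finite S"
    using finite_E by (auto simp: S_def)
  have sub: "\<A> \<subseteq> Pow S"
    using AA by (auto simp: S_def)
  \<comment> \<open>Every vertex of \<open>S\<close> sends at least half of its \<open>d\<close>
    edges into \<open>F\<close>, and a vertex of \<open>F\<close> receives at most \<open>d\<close>
    of them.\<close>
  have cardS: "real (card S) \<le> 2 * card F"
  proof -
    have "(\<Sum>u\<in>S. real d / 2) \<le> (\<Sum>u\<in>S. real (card (N u \<inter> F)))"
    proof (intro sum_mono)
      fix u assume u: "u \<in> S"
      then have "card (N u \<inter> F) + card (N u - F) = d"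
        using S finite_N card_N_E card_Int_Diff[of "N u" F] by auto
      then show "real d / 2 \<le> real (card (N u \<inter> F))"
        using u \<psi> by (auto simp: S_def)
    qed
    also have "\<dots> = (\<Sum>v\<in>F. real (card (N v \<inter> S)))"
      using sum_degree_swap[OF S(1) F(1)] by (metis of_nat_sum)
    also have "\<dots> \<le> (\<Sum>v\<in>F. real d)"
      using F finite_N card_N_Od by (intro sum_mono) (metis Int_lower1 card_mono of_nat_le_iff subsetD)
    finally show ?thesis
      using d1 by (simp add: field_simps)
  qed
  have "(\<Sum>A\<in>\<A>. w q A) \<le> (\<Sum>A\<in>Pow S. w q A)"
    using sub S w_nonneg q by (intro sum_mono2) auto
  also have "\<dots> \<le> (\<Sum>A\<in>Pow S. (\<Prod>v\<in>F. 1 + q ^ card (N v \<inter> A)) / 2 ^ card F)"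
    using S F q by (intro sum_mono w_le_container) auto
  also have "\<dots> \<le> 2 powr (\<psi> * card S / d) * 2 powr (real (d + 2) * card F / d) / 2 ^ card F"
    unfolding sum_divide_distrib[symmetric]
    by (intro divide_right_mono hoelder_container S F q Y) (auto simp: S_def)
  also have "\<dots> = 2 powr ((\<psi> * card S + 2 * card F) / d)"
    using d1 by (simp add: powr_realpow[symmetric] powr_add[symmetric] powr_diff[symmetric] field_simps)
  also have "\<dots> \<le> 2 powr (g * (2 + 2 * \<psi>) / d)"
  proof -
    have "\<psi> * card S + 2 * card F \<le> \<psi> * (2 * card F) + 2 * card F"
      using \<psi> cardS by (intro add_mono mult_left_mono) auto
    also have "\<dots> = card F * (2 + 2 * \<psi>)"
      by (simp add: algebra_simps)
    also have "\<dots> \<le> g * (2 + 2 * \<psi>)"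
      using F \<psi> by (intro mult_right_mono) auto
    finally show ?thesis
      by (intro powr_mono divide_right_mono) auto
  qed
  finally show ?thesis .
qed

text \<open>Greedy covering: each step covers at least a proportion \<open>h / g\<close> of the high-degree
  vertices that are still uncovered.\<close>
lemma greedy_cover:
  fixes h g :: real
  assumes A: "A \<subseteq> E" and g: "real (card A) \<le> g" "g > 0" "h \<ge> 0" and H: "H \<subseteq> nbh A" "real (card H) \<le> g"
    and deg: "\<And>v. v \<in> H \<Longrightarrow> real (card (N v \<inter> A)) \<ge> h"
  shows "\<exists>X\<subseteq>A. card X \<le> m \<and> real (card (H - nbh X)) \<le> g * exp (- h * m / g)"
proof (induction m)
  case 0
  show ?case
    using H by (intro exI[of _ "{}"]) (auto simp: nbh_def)
next
  case (Suc m)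
  then obtain X where X: "X \<subseteq> A" "card X \<le> m" "real (card (H - nbh X)) \<le> g * exp (- h * m / g)"
    by auto
  define U where "U = H - nbh X"
  have UO: "U \<subseteq> Od" and finA: "finite A"
    using H A nbh_subset finite_E finite_subset[of _ E] by (auto simp: U_def)
  then have finU: "finite U"
    using finite_Od finite_subset by blast
  show ?case
  proof (cases "U = {}")
    case True
    then have "card (H - nbh X) = 0"
      by (simp only: U_def card.empty)
    then show ?thesis
      using X g by (intro exI[of _ X]) (auto simp del: card_0_eq card_eq_0_iff)
  next
    case False
    then have "A \<noteq> {}"
      using H by (auto simp: U_def nbh_def)
    \<comment> \<open>Averaging: the uncovered vertices receive at least \<open>h * card U\<close>
      edges from at most \<open>g\<close> vertices of \<open>A\<close>.\<close>
    have "\<exists>u\<in>A. real (card (N u \<inter> U)) \<ge> h * card U / g"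
    proof (rule ccontr)
      assume "\<not> ?thesis"
      then have "(\<Sum>u\<in>A. real (card (N u \<inter> U))) < (\<Sum>u\<in>A. h * card U / g)"
        using \<open>A \<noteq> {}\<close> finA by (intro sum_strict_mono) auto
      also have "\<dots> \<le> g * (h * card U / g)"
        using g unfolding sum_constant by (intro mult_right_mono) auto
      also have "\<dots> = (\<Sum>v\<in>U. h)"
        using g by simp
      also have "\<dots> \<le> (\<Sum>v\<in>U. real (card (N v \<inter> A)))"
        using deg by (intro sum_mono) (auto simp: U_def)
      also have "\<dots> = (\<Sum>u\<in>A. real (card (N u \<inter> U)))"
        using sum_degree_swap[OF A UO] by (metis of_nat_sum)
      finally show False by simp
    qed
    then obtain u where u: "u \<in> A" "real (card (N u \<inter> U)) \<ge> h * card U / g"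
      by auto
    have "H - nbh (insert u X) = U - N u \<inter> U"
      by (auto simp: U_def nbh_def)
    then have "real (card (H - nbh (insert u X))) = card U - real (card (N u \<inter> U))"
      using finU card_mono[of U "N u \<inter> U"] by (simp add: card_Diff_subset of_nat_diff)
    also have "\<dots> \<le> card U * (1 - h / g)"
      using u by (simp add: algebra_simps)
    also have "\<dots> \<le> card U * exp (- (h / g))"
      using exp_ge_add_one_self[of "- (h / g)"] by (intro mult_left_mono) auto
    also have "\<dots> \<le> g * exp (- h * m / g) * exp (- (h / g))"
      using X by (intro mult_right_mono) (auto simp: U_def)
    also have "\<dots> = g * exp (- h * Suc m / g)"
      using g by (simp add: exp_add[symmetric] field_simps)
    finally show ?thesis
      using u X by (intro exI[of _ "insert u X"]) (auto intro: order_trans[OF card_insert_le_m1] card_insert_le_m1 simp: card_insert_if finite_subset[OF X(1) finA])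
  qed
qed

text \<open>Take \<open>X\<close> of largest size among the subsets of \<open>A\<close> that cover
  \<open>\<psi>\<close> vertices outside \<open>F\<close> per element. A vertex of \<open>A\<close>
  with at least \<open>\<psi>\<close> neighbours still missed could be added, against
  maximality.\<close>

lemma greedy_extension:
  fixes \<psi> :: real
  assumes A: "A \<subseteq> E" and \<psi>: "\<psi> > 0"
  shows "\<exists>X\<subseteq>A. \<psi> * card X \<le> card (nbh X - F) \<and> (\<forall>u\<in>A. real (card (N u - (F \<union> nbh X))) < \<psi>)"
proof -
  define P where "P X \<longleftrightarrow> X \<subseteq> A \<and> \<psi> * card X \<le> card (nbh X - F)" for X
  have finA: "finite A"
    using A finite_E finite_subset by auto
  have "P {}"
    by (simp add: P_def)
  moreover have "\<forall>X. P X \<longrightarrow> card X \<le> card A"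
    using finA by (auto simp: P_def card_mono)
  ultimately obtain X where X: "P X" "\<And>Y. P Y \<Longrightarrow> card Y \<le> card X"
    using ex_has_greatest_nat[of P "{}" card "Suc (card A)"] by (auto simp: less_Suc_eq_le)
  have "real (card (N u - (F \<union> nbh X))) < \<psi>" if u: "u \<in> A" for u
  proof (rule ccontr)
    assume "\<not> ?thesis"
    then have ge: "real (card (N u - (F \<union> nbh X))) \<ge> \<psi>"
      by simp
    have "u \<notin> X"
    proof
      assume "u \<in> X"
      then have *: "N u - (F \<union> nbh X) = {}"
        by (auto simp: nbh_def)
      show False
        using ge \<psi> unfolding * by simp
    qed
    have finX: "finite X" "X \<subseteq> E"
      using X finA A finite_subset by (auto simp: P_def)
    have "nbh (insert u X) - F = (nbh X - F) \<union> (N u - (F \<union> nbh X))"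
      by (auto simp: nbh_def)
    then have "card (nbh (insert u X) - F) = card (nbh X - F) + card (N u - (F \<union> nbh X))"
      using finite_nbh[OF finX(2)] finite_N(2)[of u] u A by (simp only:) (subst card_Un_disjoint, auto)
    then have "\<psi> * card (insert u X) \<le> card (nbh (insert u X) - F)"
      using X(1) ge \<open>u \<notin> X\<close> finX by (simp add: P_def algebra_simps)
    then have "P (insert u X)"
      using X(1) u by (simp add: P_def)
    from X(2)[OF this] show False
      using \<open>u \<notin> X\<close> finX by simp
  qed
  then show ?thesis
    using X(1) by (auto simp: P_def)
qed

end

context cube_like begin

text \<open>Two consequences are used: \<open>nbh A\<close> lies within three steps of
  \<open>X\<close>, which limits the missed neighbours, and connectivity of \<open>A\<close> passes
  to \<open>X\<close> at a larger scale, which limits the choices of \<open>X\<close>.\<close>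

definition dominates :: "'a set \<Rightarrow> 'a set \<Rightarrow> bool" where
  "dominates X A \<longleftrightarrow> X \<subseteq> A \<and> (\<forall>u\<in>A. \<exists>x\<in>X. N u \<inter> N x \<noteq> {})"

text \<open>Every set with neighbourhood \<open>P\<close> is contained in \<open>clo P\<close>, so
  \<open>2 ^ card (clo P)\<close> bounds their number.\<close>

definition clo :: "'a set \<Rightarrow> 'a set" where "clo P = {u \<in> E. N u \<subseteq> P}"

text \<open>Greedy covering for about \<open>g * ln d / h\<close> steps shrinks the uncovered
  high-degree vertices to a proportion 1 / d; whatever else is uncovered is low. The maximal
  extension then adds at most one vertex per \<open>\<psi>\<close> uncovered ones.\<close>

lemma approximation:
  fixes h \<psi> :: real
  assumes A: "A \<subseteq> E" "A \<noteq> {}" and g: "card (nbh A) = g" and h: "h > 0" and \<psi>: "\<psi> > 0" "\<psi> \<le> d"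
  shows "\<exists>X. dominates X A \<and> (\<forall>u\<in>A. real (card (N u - nbh X)) \<le> \<psi>)
     \<and> real (card (nbh A - nbh X)) \<le> card (low h A) + g / d
     \<and> real (card X) \<le> g * ln d / h + 1 + (card (low h A) + g / d) / \<psi>"
proof -
  define H where "H = nbh A - low h A"
  define m where "m = nat \<lceil>g * ln d / h\<rceil>"
  have finA: "finite A"
    using A finite_E finite_subset by auto
  have cardA: "card A \<le> g"
    using card_le_nbh[OF A(1)] g by simp
  have gpos: "g > 0"
    using cardA A finA by (metis card_gt_0_iff le_zero_eq neq0_conv)
  have lnd: "ln (real d) \<ge> 0"
    using d1 by simp
  have m: "real m \<ge> g * ln d / h" "real m \<le> g * ln d / h + 1"
  proof -
    have "g * ln d / h \<ge> 0"
      using lnd h by simp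
    then show "real m \<ge> g * ln d / h" "real m \<le> g * ln d / h + 1"
      unfolding m_def by linarith+
  qed
  have "\<exists>X\<subseteq>A. card X \<le> m \<and> real (card (H - nbh X)) \<le> real g * exp (- h * m / g)"
  proof (rule greedy_cover[OF A(1)])
    show "real (card H) \<le> real g"
      unfolding g[symmetric] H_def using finite_nbh[OF A(1)] by (auto intro: card_mono)
  qed (use cardA gpos h in \<open>auto simp: H_def low_def\<close>)
  then obtain X1 where X1: "X1 \<subseteq> A" "card X1 \<le> m" "real (card (H - nbh X1)) \<le> g * exp (- h * m / g)"
    by auto
  have "exp (- h * m / g) \<le> exp (- ln d)"
    using m(1) gpos h by (simp add: field_simps)
  also have "\<dots> = 1 / d"
    using d1 by (simp add: exp_minus inverse_eq_divide)
  finally have "real g * exp (- h * m / g) \<le> real g * (1 / d)"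
    by (intro mult_left_mono) auto
  then have HX1: "real (card (H - nbh X1)) \<le> g / d"
    using X1(3) by simp
  have low: "low h A \<subseteq> nbh A" "finite (low h A)"
    using finite_nbh[OF A(1)] by (auto simp: low_def)
  have unc: "real (card (nbh A - nbh X1)) \<le> card (low h A) + g / d"
  proof -
    have "card (nbh A - nbh X1) \<le> card (low h A \<union> (H - nbh X1))"
      using finite_nbh[OF A(1)] low by (intro card_mono) (auto simp: H_def)
    also have "\<dots> \<le> card (low h A) + card (H - nbh X1)"
      by (rule card_Un_le)
    finally show ?thesis
      using HX1 by linarith
  qed
  obtain X2 where X2: "X2 \<subseteq> A" "\<psi> * card X2 \<le> card (nbh X2 - nbh X1)"
      "\<forall>u\<in>A. real (card (N u - (nbh X1 \<union> nbh X2))) < \<psi>"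
    using greedy_extension[OF A(1) \<psi>(1), of "nbh X1"] by auto
  define X where "X = X1 \<union> X2"
  have nX: "nbh X = nbh X1 \<union> nbh X2"
    by (simp add: X_def nbh_Un)
  have "card (nbh X2 - nbh X1) \<le> card (nbh A - nbh X1)"
    using finite_nbh[OF A(1)] nbh_mono[OF X2(1)] by (intro card_mono) auto
  then have "\<psi> * card X2 \<le> card (low h A) + g / d"
    using X2(2) unc by linarith
  then have "real (card X2) \<le> (card (low h A) + g / d) / \<psi>"
    using \<psi> by (simp add: field_simps)
  moreover have "card X \<le> card X1 + card X2"
    unfolding X_def by (rule card_Un_le)
  moreover have "real (card X1) \<le> g * ln d / h + 1"
    using X1(2) m(2) by linarith
  ultimately have "real (card X) \<le> g * ln d / h + 1 + (card (low h A) + g / d) / \<psi>"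
    by linarith
  moreover have "real (card (nbh A - nbh X)) \<le> card (low h A) + g / d"
  proof -
    have "card (nbh A - nbh X) \<le> card (nbh A - nbh X1)"
      using finite_nbh[OF A(1)] nX by (intro card_mono) auto
    then show ?thesis using unc by linarith
  qed
  moreover have "dominates X A"
    unfolding dominates_def
  proof (intro conjI ballI)
    show "X \<subseteq> A"
      using X1 X2 by (simp add: X_def)
    fix u assume u: "u \<in> A"
    \<comment> \<open>Fewer than \<open>\<psi> \<le> d\<close> neighbours of \<open>u\<close> are
      missed, so at least one is shared with \<open>X\<close>.\<close>
    then have "real (card (N u - nbh X)) < d"
      using X2(3) \<psi> nX by fastforce
    moreover have "card (N u) = d"
      using u A card_N_E by auto
    ultimately have "N u - nbh X \<noteq> N u"
      by auto
    then show "\<exists>x\<in>X. N u \<inter> N x \<noteq> {}"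
      by (auto simp: nbh_def)
  qed
  ultimately show ?thesis
    using X2(3) nX by (intro exI[of _ X]) (auto simp: less_imp_le)
qed

text \<open>A low vertex contributes at most (1 + 1/3) / 2 = 2/3 at 1/3 and at least (1 + 1/2) / 2 =
  3/4 at \<open>q\<close>, a ratio of 9/8.\<close>

lemma low_weight:
  assumes A: "A \<subseteq> E" and q: "1/3 \<le> q"
    and gain: "\<And>k. 1 \<le> k \<Longrightarrow> real k < h \<Longrightarrow> q ^ k \<ge> 1/2"
  shows "w (1/3) A * (9/8) ^ card (low h A) \<le> w q A"
proof -
  have low: "low h A \<subseteq> nbh A"
    by (auto simp: low_def)
  have fin: "finite (nbh A)"
    using finite_nbh[OF A] .
  have "w (1/3) A * (9/8) ^ card (low h A)
     = (\<Prod>v\<in>nbh A. (1 + (1/3) ^ card (N v \<inter> A)) / 2 * (if v \<in> low h A then 9/8 else 1))"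
    unfolding w_eq[OF A] prod.distrib using fin low by (simp add: prod.If_cases Int_absorb1)
  also have "\<dots> \<le> (\<Prod>v\<in>nbh A. (1 + q ^ card (N v \<inter> A)) / 2)"
  proof (intro prod_mono conjI)
    fix v assume v: "v \<in> nbh A"
    define k where "k = card (N v \<inter> A)"
    have "v \<in> Od" using v nbh_subset[OF A] by auto
    then have k1: "k \<ge> 1"
      using degree_zero_iff[OF A, of v] v unfolding k_def by linarith
    show "(1 + (1/3) ^ card (N v \<inter> A)) / 2 * (if v \<in> low h A then 9/8 else 1) \<le> (1 + q ^ card (N v \<inter> A)) / 2"
    proof (cases "v \<in> low h A")
      case True
      then have "q ^ k \<ge> 1/2"
        using gain k1 by (auto simp: low_def k_def)
      moreover have "(1/3::real) ^ k \<le> 1/3"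
        using power_decreasing[OF k1, of "1/3::real"] by simp
      ultimately show ?thesis
        using True by (simp add: k_def[symmetric])
    next
      case False
      have "(1/3) ^ k \<le> q ^ k"
        using q by (intro power_mono) auto
      then show ?thesis
        using False by (simp add: k_def)
    qed
  qed auto
  finally show ?thesis
    unfolding w_eq[OF A] .
qed

text \<open>The gain \<open>(9/8) ^ |low h A|\<close> pays for the part of the approximating set that
  is needed to control the low vertices.\<close>
lemma heavy_low_sum:
  fixes K D h \<psi> l q :: real
  assumes AA: "\<And>A. A \<in> \<A> \<Longrightarrow> A \<subseteq> E \<and> A \<noteq> {} \<and> card (nbh A) = g"
    and cnt: "\<And>m. real (card {X. card X = m \<and> (\<exists>A\<in>\<A>. dominates X A)}) \<le> K * D ^ m"
    and q: "1/3 \<le> q" "q \<le> 1"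
    and Y: "(\<Sum>k\<le>d. real (d choose k) * (1 + q ^ k) ^ d) \<le> 2 ^ (d + 2)"
    and gain: "\<And>k. 1 \<le> k \<Longrightarrow> real k < h \<Longrightarrow> q ^ k \<ge> 1/2"
    and h: "h > 0" and \<psi>: "0 < \<psi>" "\<psi> \<le> d / 2"
    and D: "1 \<le> D" "D \<le> (9/8) powr (\<psi> / 2)"
  shows "(\<Sum>A\<in>{A\<in>\<A>. real (card (low h A)) > l}. w (1/3) A)
     \<le> K * (g + 1) * 2 powr (g * (2 + 2 * \<psi>) / d) * D powr (g * ln d / h + 1 + g / (d * \<psi>)) * (9/8) powr (- l / 2)"
proof -
  define \<B> where "\<B> = {A\<in>\<A>. real (card (low h A)) > l}"
  define M where "M = g * ln d / h + 1 + g / (d * \<psi>)"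
  define W where "W = 2 powr (g * (2 + 2 * \<psi>) / d)"
  define Q where "Q X A \<longleftrightarrow> dominates X A \<and> (\<forall>u\<in>A. real (card (N u - nbh X)) \<le> \<psi>)
     \<and> real (card X) \<le> M + card (low h A) / \<psi>" for X A
  have "\<A> \<subseteq> Pow E" using AA by auto
  then have finB: "finite \<B>"
    using finite_E by (auto simp: \<B>_def intro: finite_subset[of _ "Pow E"])
  have "\<exists>X. Q X A" if "A \<in> \<B>" for A
  proof -
    have "A \<in> \<A>" using that by (simp add: \<B>_def)
    then have "\<exists>X. dominates X A \<and> (\<forall>u\<in>A. real (card (N u - nbh X)) \<le> \<psi>)
     \<and> real (card (nbh A - nbh X)) \<le> card (low h A) + g / d
     \<and> real (card X) \<le> g * ln d / h + 1 + (card (low h A) + g / d) / \<psi>"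
      using AA[of A] h \<psi> by (intro approximation) auto
    then show ?thesis
      unfolding Q_def M_def by (auto simp: add_divide_distrib algebra_simps)
  qed
  then obtain X where X: "Q (X A) A" if "A \<in> \<B>" for A
    by metis
  have XE: "X A \<subseteq> A" "X A \<subseteq> E" "card (X A) \<le> g" "nbh (X A) \<subseteq> Od" "card (nbh (X A)) \<le> g"
    if "A \<in> \<B>" for A
  proof -
    have A: "A \<subseteq> E" "card (nbh A) = g" using that AA by (auto simp: \<B>_def)
    show X1: "X A \<subseteq> A" using X[OF that] by (simp add: Q_def dominates_def)
    then show X2: "X A \<subseteq> E" using A by auto
    have "card (X A) \<le> card A"
      using X1 A finite_E finite_subset by (intro card_mono) auto
    then show "card (X A) \<le> g"
      using card_le_nbh[OF A(1)] A by simp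
    show "nbh (X A) \<subseteq> Od"
      using nbh_subset[OF X2] .
    show "card (nbh (X A)) \<le> g"
      unfolding A(2)[symmetric] using finite_nbh[OF A(1)] nbh_mono[OF X1] by (rule card_mono)
  qed
  have *: "w (1/3) A \<le> w q A * D powr (- real (card (X A))) * (D powr M * (9/8) powr (- l / 2))"
    if A: "A \<in> \<B>" for A
  proof -
    define s where "s = real (card (low h A))"
    have s: "s \<ge> l" "s \<ge> 0" using A by (auto simp: \<B>_def s_def)
    have "D powr (card (X A) - M) \<le> D powr (s / \<psi>)"
      using X[OF A] D(1) by (intro powr_mono) (auto simp: Q_def s_def)
    also have "\<dots> \<le> ((9/8) powr (\<psi> / 2)) powr (s / \<psi>)"
      using D s \<psi> by (intro powr_mono2) auto
    also have "\<dots> = (9/8) powr (s / 2)"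
      using \<psi> by (simp add: powr_powr)
    finally have 1: "D powr (card (X A) - M) \<le> (9/8) powr (s / 2)" .
    have "w (1/3) A * (9/8) powr s \<le> w q A"
      using low_weight[of A q h] AA[of A] A q gain by (simp add: \<B>_def s_def powr_realpow)
    then have w: "w (1/3) A \<le> w q A * (9/8) powr (- s)"
      by (simp add: powr_minus field_simps)
    \<comment> \<open>The gain is used in two halves: one pays for the at most
      \<open>s / \<psi>\<close> vertices of \<open>X A\<close> beyond \<open>M\<close>, the other is
      kept as decay in \<open>l\<close>.\<close>
    have "(9/8::real) powr (- s) = (9/8) powr (- s / 2) * (9/8) powr (- s / 2)"
      by (simp add: powr_add[symmetric])
    also have "\<dots> \<le> D powr (M - card (X A)) * (9/8) powr (- l / 2)"
    proof (intro mult_mono)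
      have "(9/8) powr (- s / 2) = 1 / (9/8) powr (s / 2)"
        by (simp add: powr_minus_divide)
      also have "\<dots> \<le> 1 / D powr (card (X A) - M)"
        using 1 D by (intro divide_left_mono) auto
      also have "\<dots> = D powr (M - card (X A))"
        by (simp add: powr_minus_divide[symmetric])
      finally show "(9/8) powr (- s / 2) \<le> D powr (M - card (X A))" .
    qed (use s in auto)
    also have "D powr (M - card (X A)) = D powr (- real (card (X A))) * D powr M"
      by (simp add: powr_add[symmetric])
    finally have "w q A * (9/8) powr (- s) \<le> w q A * (D powr (- real (card (X A))) * D powr M * (9/8) powr (- l / 2))"
      using w_nonneg[of q A] q by (intro mult_left_mono) auto
    with w show ?thesis
      by (simp add: mult.assoc)
  qed
  have sumX: "(\<Sum>A\<in>{A\<in>\<B>. X A = Z}. w q A) \<le> W" if "Z \<in> X ` \<B>" for Z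
    unfolding W_def
  proof (rule container_weight[where F = "nbh Z"])
    show "nbh Z \<subseteq> Od" "card (nbh Z) \<le> g"
      using XE(4,5) that by blast+
    show "A \<subseteq> E \<and> (\<forall>u\<in>A. real (card (N u - nbh Z)) \<le> \<psi>)" if "A \<in> {A \<in> \<B>. X A = Z}" for A
      using that X[of A] AA[of A] by (auto simp: Q_def \<B>_def)
  qed (use q \<psi> Y in auto)
  \<comment> \<open>Grouping by the approximating set: the container bound covers all
    \<open>A\<close> that share it, and the power of \<open>D\<close> cancels the number of
    approximating sets of each size, leaving \<open>K\<close> per size.\<close>
  have "(\<Sum>A\<in>\<B>. w q A * D powr (- real (card (X A)))) =
        (\<Sum>Z\<in>X ` \<B>. \<Sum>A\<in>{A\<in>\<B>. X A = Z}. w q A * D powr (- real (card (X A))))"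
    using finB by (intro sum.group[symmetric] finite_imageI order_refl)
  also have "\<dots> = (\<Sum>Z\<in>X ` \<B>. D powr (- real (card Z)) * (\<Sum>A\<in>{A\<in>\<B>. X A = Z}. w q A))"
    by (intro sum.cong refl) (auto simp: sum_distrib_left mult.commute intro!: sum.cong)
  also have "\<dots> \<le> (\<Sum>Z\<in>X ` \<B>. D powr (- real (card Z)) * W)"
    using sumX by (intro sum_mono mult_left_mono) auto
  also have "\<dots> = (\<Sum>Z\<in>X ` \<B>. D powr (- real (card Z))) * W"
    by (simp add: sum_distrib_right)
  also have "(\<Sum>Z\<in>X ` \<B>. D powr (- real (card Z)))
     = (\<Sum>m\<le>g. \<Sum>Z\<in>{Z\<in>X ` \<B>. card Z = m}. D powr (- real (card Z)))"
    using finB XE(3) by (intro sum.group[symmetric]) auto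
  also have "\<dots> \<le> (\<Sum>m\<le>g. K)"
  proof (intro sum_mono)
    fix m
    have fin: "finite {Z. card Z = m \<and> (\<exists>A\<in>\<A>. dominates Z A)}"
    proof (rule finite_subset[of _ "Pow E"])
      show "{Z. card Z = m \<and> (\<exists>A\<in>\<A>. dominates Z A)} \<subseteq> Pow E"
        using AA unfolding dominates_def by blast
    qed (use finite_E in simp)
    have "real (card {Z\<in>X ` \<B>. card Z = m}) \<le> card {Z. card Z = m \<and> (\<exists>A\<in>\<A>. dominates Z A)}"
      using X fin by (intro of_nat_mono card_mono) (auto simp: Q_def \<B>_def)
    also have "\<dots> \<le> K * D ^ m" by (rule cnt)
    finally have "real (card {Z\<in>X ` \<B>. card Z = m}) * D powr (- real m) \<le> K * D ^ m * D powr (- real m)"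
      by (intro mult_right_mono) auto
    also have "\<dots> = K"
      using D by (simp add: powr_minus powr_realpow field_simps)
    finally show "(\<Sum>Z\<in>{Z\<in>X ` \<B>. card Z = m}. D powr (- real (card Z))) \<le> K"
      by simp
  qed
  also have "(\<Sum>m\<le>g. K) * W = K * (g + 1) * W"
    by simp
  finally have sum: "(\<Sum>A\<in>\<B>. w q A * D powr (- real (card (X A)))) \<le> K * (g + 1) * W"
    by (simp add: W_def mult_right_mono)
  have "(\<Sum>A\<in>\<B>. w (1/3) A) \<le> (\<Sum>A\<in>\<B>. w q A * D powr (- real (card (X A))) * (D powr M * (9/8) powr (- l / 2)))"
    using * by (intro sum_mono) auto
  also have "\<dots> = (\<Sum>A\<in>\<B>. w q A * D powr (- real (card (X A)))) * (D powr M * (9/8) powr (- l / 2))"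
    by (simp add: sum_distrib_right)
  also have "\<dots> \<le> K * (g + 1) * W * (D powr M * (9/8) powr (- l / 2))"
    using sum by (intro mult_right_mono) auto
  finally show ?thesis
    by (simp add: \<B>_def W_def M_def mult_ac add.commute)
qed

text \<open>A vertex with at least \<open>h\<close> neighbours in \<open>A\<close> has a factor at
  most \<open>1 + (1/3) powr h\<close> times 1/2; a low one has at most 2/3, which is 4/3 times
  1/2.\<close>

lemma light_weight:
  assumes A: "A \<subseteq> E" and g: "card (nbh A) = g" and h: "h \<ge> 0" and l: "real (card (low h A)) \<le> l"
  shows "w (1/3) A \<le> (4/3) powr l * (1 + (1/3) powr h) ^ g / 2 ^ g"
proof -
  have fin: "finite (nbh A)" "low h A \<subseteq> nbh A"
    using finite_nbh[OF A] by (auto simp: low_def)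
  have "w (1/3) A = (\<Prod>v\<in>nbh A. (1 + (1/3) ^ card (N v \<inter> A))) / 2 ^ g"
    unfolding w_eq[OF A] prod_dividef by (simp add: g)
  also have "(\<Prod>v\<in>nbh A. (1 + (1/3) ^ card (N v \<inter> A))) \<le> (\<Prod>v\<in>nbh A. (if v \<in> low h A then 4/3 else 1) * (1 + (1/3) powr h))"
  proof (intro prod_mono conjI)
    fix v assume v: "v \<in> nbh A"
    define k where "k = card (N v \<inter> A)"
    have "v \<in> Od" using v nbh_subset[OF A] by auto
    then have k1: "k \<ge> 1"
      using degree_zero_iff[OF A, of v] v unfolding k_def by linarith
    show "1 + (1/3) ^ card (N v \<inter> A) \<le> (if v \<in> low h A then 4/3 else 1) * (1 + (1/3::real) powr h)"
    proof (cases "v \<in> low h A")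
      case True
      have "(1/3::real) ^ k \<le> 1/3"
        using power_decreasing[OF k1, of "1/3::real"] by simp
      then have "1 + (1/3::real) ^ k \<le> 4/3 * 1" by simp
      also have "\<dots> \<le> 4/3 * (1 + (1/3) powr h)"
        by (intro mult_left_mono) auto
      finally show ?thesis
        using True by (simp add: k_def)
    next
      case False
      then have "real k \<ge> h" using v by (simp add: low_def k_def)
      then have "(1/3::real) powr k \<le> (1/3) powr h"
        by (intro powr_mono') auto
      then show ?thesis
        using False by (simp add: k_def powr_realpow)
    qed
  qed auto
  also have "\<dots> = (4/3) ^ card (low h A) * (1 + (1/3) powr h) ^ g"
    unfolding prod.distrib using fin g by (simp add: prod.If_cases Int_absorb1)
  also have "\<dots> \<le> (4/3) powr l * (1 + (1/3) powr h) ^ g"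
  proof (intro mult_right_mono)
    have "(4/3::real) powr (card (low h A)) \<le> (4/3) powr l"
      using l by (intro powr_mono) auto
    then show "(4/3::real) ^ card (low h A) \<le> (4/3) powr l"
      by (simp add: powr_realpow)
  qed auto
  finally show ?thesis
    by (simp add: divide_right_mono)
qed

lemma nbh_nbh_nbh_subset:
  assumes "dominates X A" "A \<subseteq> E"
  shows "nbh A \<subseteq> nbh (nbh (nbh X))"
proof -
  have "A \<subseteq> nbh (nbh X)"
  proof
    fix u assume u: "u \<in> A"
    then obtain x where "x \<in> X" "N u \<inter> N x \<noteq> {}"
      using assms(1) unfolding dominates_def by blast
    then obtain v where x: "x \<in> X" "v \<in> N u" "v \<in> N x"
      by auto
    have "u \<in> N v"
      using u assms(2) x(2) N_E N_sym by blast
    then show "u \<in> nbh (nbh X)"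
      using x by (auto simp: nbh_def)
  qed
  then show ?thesis
    by (rule nbh_mono)
qed

lemma card_nbh3_le:
  assumes "X \<subseteq> E"
  shows "nbh (nbh (nbh X)) \<subseteq> Od" "card (nbh (nbh (nbh X))) \<le> d ^ 3 * card X"
proof -
  interpret dual: cube_like d Od E N by (rule dual)
  have 1: "nbh X \<subseteq> Od" using assms by (rule nbh_subset)
  then have 2: "nbh (nbh X) \<subseteq> E" by (rule dual.nbh_subset)
  then show "nbh (nbh (nbh X)) \<subseteq> Od" by (rule nbh_subset)
  have "card (nbh (nbh (nbh X))) \<le> d * (d * (d * card X))"
    using card_nbh_le[OF 2] dual.card_nbh_le[OF 1] card_nbh_le[OF assms]
    by (meson le_trans mult_le_mono2)
  then show "card (nbh (nbh (nbh X))) \<le> d ^ 3 * card X"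
    by (simp add: power3_eq_cube mult.assoc)
qed

text \<open>With few low vertices the whole neighbourhood \<open>P\<close> can be encoded cheaply,
  by \<open>X\<close> and the missed part \<open>U\<close>, a small subset of the third
  neighbourhood of \<open>X\<close>. Given \<open>P\<close> there are at most
  \<open>2 ^ card (clo P)\<close> sets, each of weight about \<open>2 powr (- g)\<close>, so the
  deficit \<open>\<tau>\<close> of the closure is gained.\<close>

lemma light_low_sum:
  fixes K D h \<psi> l \<tau> :: real
  assumes AA: "\<And>A. A \<in> \<A> \<Longrightarrow> A \<subseteq> E \<and> A \<noteq> {} \<and> card (nbh A) = g"
    and cnt: "\<And>m. real (card {X. card X = m \<and> (\<exists>A\<in>\<A>. dominates X A)}) \<le> K * D ^ m"
    and h: "h > 0" and \<psi>: "0 < \<psi>" "\<psi> \<le> d" and D: "1 \<le> D" and K: "K \<ge> 0"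
  shows "(\<Sum>A\<in>{A\<in>\<A>. real (card (low h A)) \<le> l \<and> real (card (clo (nbh A))) \<le> g - \<tau>}. w (1/3) A)
     \<le> K * (g + 1) * D powr (g * ln d / h + 1 + (l + g / d) / \<psi>) * exp (g / d) * d powr (4 * (l + g / d))
        * 2 powr (- \<tau>) * (4/3) powr l * (1 + (1/3) powr h) ^ g"
proof -
  define \<B> where "\<B> = {A\<in>\<A>. real (card (low h A)) \<le> l \<and> real (card (clo (nbh A))) \<le> g - \<tau>}"
  define M where "M = g * ln d / h + 1 + (l + g / d) / \<psi>"
  define r where "r = l + g / d"
  define \<X> where "\<X> = {X. (\<exists>A\<in>\<A>. dominates X A) \<and> real (card X) \<le> M}"
  define UU where "UU X = {U. U \<subseteq> nbh (nbh (nbh X)) \<and> real (card U) \<le> r}" for X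
  define L where "L = (4/3) powr l * (1 + (1/3) powr h) ^ g / 2 ^ g"
  have finB: "finite \<B>"
    using finite_E AA by (intro finite_subset[of \<B> "Pow E"]) (auto simp: \<B>_def)
  have XE: "X \<subseteq> E" "card X \<le> g" if X: "X \<in> \<X>" for X
  proof -
    obtain A where A: "A \<in> \<A>" "dominates X A"
      using X by (auto simp: \<X>_def)
    then have A': "A \<subseteq> E" "card (nbh A) = g" "X \<subseteq> A"
      using AA by (auto simp: dominates_def)
    then show "X \<subseteq> E" by auto
    have "card X \<le> card A"
      using A' finite_E finite_subset by (intro card_mono) auto
    then show "card X \<le> g"
      using card_le_nbh[OF A'(1)] A' by simp
  qed
  have finX: "finite \<X>"
    using XE(1) finite_E by (intro finite_subset[of \<X> "Pow E"]) auto
  have finU: "finite (UU X)" if "X \<in> \<X>" for X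
    using card_nbh3_le(1)[OF XE(1)[OF that]] finite_Od
    by (intro finite_subset[of "UU X" "Pow Od"]) (auto simp: UU_def)
  have cardU: "real (card (UU X)) \<le> exp (g / d) * d powr (4 * r)" if X: "X \<in> \<X>" for X
  proof -
    have fin: "finite (nbh (nbh (nbh X)))"
      using card_nbh3_le(1)[OF XE(1)[OF X]] finite_Od finite_subset by blast
    \<comment> \<open>The tilt d^(-4) is small enough that the third neighbourhood, of size at most
      d^3 g, costs only \<open>exp (g / d)\<close>.\<close>
    have "real (card (UU X)) \<le> (1 + 1 / real d ^ 4) ^ card (nbh (nbh (nbh X))) * (1 / real d ^ 4) powr (- r)"
      unfolding UU_def using fin d1 by (intro card_small_subsets) (auto simp: divide_le_eq_1)
    also have "\<dots> \<le> exp (g / d) * d powr (4 * r)"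
    proof (intro mult_mono)
      have "(1 + 1 / real d ^ 4) ^ card (nbh (nbh (nbh X))) \<le> (1 + 1 / real d ^ 4) ^ (d ^ 3 * g)"
        using card_nbh3_le(2)[OF XE(1)[OF X]] XE(2)[OF X]
        by (intro power_increasing) (auto intro: order_trans)
      also have "\<dots> \<le> exp (1 / real d ^ 4) ^ (d ^ 3 * g)"
        by (intro power_mono) auto
      also have "\<dots> = exp (g / d)"
        using d1 by (simp add: exp_of_nat_mult[symmetric] field_simps power4_eq_xxxx power3_eq_cube)
      finally show "(1 + 1 / real d ^ 4) ^ card (nbh (nbh (nbh X))) \<le> exp (g / d)" .
      have "(1 / real d ^ 4) = d powr (-4)"
        using d1 by (simp add: powr_minus_divide)
      then show "(1 / real d ^ 4) powr (- r) \<le> d powr (4 * r)"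
        by (simp only: powr_powr) simp
    qed auto
    finally show ?thesis .
  qed
  have cardX: "real (card \<X>) \<le> (g + 1) * (K * D powr M)"
  proof -
    have "real (card \<X>) = (\<Sum>m\<le>g. real (card {X\<in>\<X>. card X = m}))"
    proof -
      have "card ` \<X> \<subseteq> {..g}"
        using XE(2) by auto
      then show ?thesis
        using sum.group[OF finX, of "{..g}" card "\<lambda>_. 1::real"] by simp
    qed
    also have "\<dots> \<le> (\<Sum>m\<le>g. K * D powr M)"
    proof (intro sum_mono)
      fix m
      show "real (card {X\<in>\<X>. card X = m}) \<le> K * D powr M"
      proof (cases "real m \<le> M")
        case True
        have fin: "finite {Z. card Z = m \<and> (\<exists>A\<in>\<A>. dominates Z A)}"
          proof (rule finite_subset[of _ "Pow E"])
          show "{Z. card Z = m \<and> (\<exists>A\<in>\<A>. dominates Z A)} \<subseteq> Pow E"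
            using AA unfolding dominates_def by blast
        qed (use finite_E in simp)
        have "real (card {X\<in>\<X>. card X = m}) \<le> card {Z. card Z = m \<and> (\<exists>A\<in>\<A>. dominates Z A)}"
          using fin by (intro of_nat_mono card_mono) (auto simp: \<X>_def)
        also have "\<dots> \<le> K * D ^ m" by (rule cnt)
        also have "\<dots> \<le> K * D powr M"
          using True D K powr_mono[OF True D] by (intro mult_left_mono) (auto simp: powr_realpow)
        finally show ?thesis .
      next
        case False
        then have "{X\<in>\<X>. card X = m} = {}"
          by (auto simp: \<X>_def)
        then show ?thesis
          using K by (simp only: card.empty) simp
      qed
    qed
    also have "\<dots> = (g + 1) * (K * D powr M)"
      by simp
    finally show ?thesis .
  qed
  have PP: "nbh ` \<B> \<subseteq> (\<lambda>(X, U). nbh X \<union> U) ` (SIGMA X:\<X>. UU X)"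
  proof
    fix P assume "P \<in> nbh ` \<B>"
    then obtain A where A: "A \<in> \<B>" "P = nbh A" by auto
    then have A': "A \<in> \<A>" "A \<subseteq> E" "A \<noteq> {}" "card (nbh A) = g" "real (card (low h A)) \<le> l"
      using AA by (auto simp: \<B>_def)
    obtain X where X: "dominates X A" "real (card (nbh A - nbh X)) \<le> card (low h A) + g / d"
      "real (card X) \<le> g * ln d / h + 1 + (card (low h A) + g / d) / \<psi>"
      using approximation[OF A'(2,3,4) h \<psi>] by auto
    have "(card (low h A) + g / d) / \<psi> \<le> (l + g / d) / \<psi>"
      using A'(5) \<psi> by (intro divide_right_mono) auto
    then have "X \<in> \<X>"
      using X(1,3) A'(1) by (auto simp: \<X>_def M_def)
    moreover have "nbh A - nbh X \<in> UU X"
      using X(2) A'(5) nbh_nbh_nbh_subset[OF X(1) A'(2)] by (auto simp: UU_def r_def)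
    moreover have "P = nbh X \<union> (nbh A - nbh X)"
      using X(1) A(2) nbh_mono[of X A] by (auto simp: dominates_def)
    ultimately show "P \<in> (\<lambda>(X, U). nbh X \<union> U) ` (SIGMA X:\<X>. UU X)"
      by (intro image_eqI[of _ _ "(X, nbh A - nbh X)"]) auto
  qed
  have cardP: "real (card (nbh ` \<B>)) \<le> (g + 1) * (K * D powr M) * (exp (g / d) * d powr (4 * r))"
  proof -
    have fin: "finite (SIGMA X:\<X>. UU X)"
      using finX finU by auto
    have "card (nbh ` \<B>) \<le> card (SIGMA X:\<X>. UU X)"
      using card_mono[OF finite_imageI[OF fin] PP] card_image_le[OF fin, of "\<lambda>(X, U). nbh X \<union> U"] by linarith
    also have "\<dots> = (\<Sum>X\<in>\<X>. card (UU X))"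
      using finX finU by (intro card_SigmaI) auto
    finally have "real (card (nbh ` \<B>)) \<le> (\<Sum>X\<in>\<X>. real (card (UU X)))"
      by (metis of_nat_mono of_nat_sum)
    also have "\<dots> \<le> (\<Sum>X\<in>\<X>. exp (g / d) * d powr (4 * r))"
      using cardU by (intro sum_mono) auto
    also have "\<dots> = card \<X> * (exp (g / d) * d powr (4 * r))"
      by simp
    also have "\<dots> \<le> (g + 1) * (K * D powr M) * (exp (g / d) * d powr (4 * r))"
      using cardX by (intro mult_right_mono) auto
    finally show ?thesis .
  qed
  have "(\<Sum>A\<in>\<B>. w (1/3) A) = (\<Sum>P\<in>nbh ` \<B>. \<Sum>A\<in>{A\<in>\<B>. nbh A = P}. w (1/3) A)"
    using finB by (intro sum.group[symmetric]) auto
  also have "\<dots> \<le> (\<Sum>P\<in>nbh ` \<B>. 2 powr (g - \<tau>) * L)"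
  proof (intro sum_mono)
    fix P assume "P \<in> nbh ` \<B>"
    then have P: "real (card (clo P)) \<le> g - \<tau>" by (auto simp: \<B>_def)
    have finc: "finite (clo P)" using finite_E by (simp add: clo_def)
    have "{A\<in>\<B>. nbh A = P} \<subseteq> Pow (clo P)"
      using AA by (auto simp: \<B>_def clo_def nbh_def)
    then have "card {A\<in>\<B>. nbh A = P} \<le> 2 ^ card (clo P)"
      using card_mono[of "Pow (clo P)"] finc by (simp add: card_Pow)
    then have "real (card {A\<in>\<B>. nbh A = P}) \<le> real (2 ^ card (clo P))"
      by (rule of_nat_mono)
    also have "\<dots> = 2 powr card (clo P)"
      by (simp add: powr_realpow)
    also have "\<dots> \<le> 2 powr (g - \<tau>)"
      using P by (intro powr_mono) auto
    finally have c: "real (card {A\<in>\<B>. nbh A = P}) \<le> 2 powr (g - \<tau>)" .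
    have "(\<Sum>A\<in>{A\<in>\<B>. nbh A = P}. w (1/3) A) \<le> (\<Sum>A\<in>{A\<in>\<B>. nbh A = P}. L)"
      unfolding L_def using AA h by (intro sum_mono light_weight) (auto simp: \<B>_def)
    also have "\<dots> \<le> 2 powr (g - \<tau>) * L"
      unfolding sum_constant using c by (intro mult_right_mono) (auto simp: L_def)
    finally show "(\<Sum>A\<in>{A\<in>\<B>. nbh A = P}. w (1/3) A) \<le> 2 powr (g - \<tau>) * L" .
  qed
  also have "\<dots> = card (nbh ` \<B>) * (2 powr (g - \<tau>) * L)"
    by simp
  also have "\<dots> \<le> (g + 1) * (K * D powr M) * (exp (g / d) * d powr (4 * r)) * (2 powr (g - \<tau>) * L)"
    using cardP by (intro mult_right_mono) (auto simp: L_def)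
  also have "2 powr (g - \<tau>) * L = 2 powr (- \<tau>) * ((4/3) powr l * (1 + (1/3) powr h) ^ g)"
    by (simp add: L_def powr_diff powr_minus powr_realpow field_simps)
  finally show ?thesis
    by (simp add: \<B>_def M_def r_def mult_ac add.commute)
qed

end

section \<open>Numerical estimates and the choice of parameters\<close>

lemma two_powr_minus_le:
  fixes x :: real
  assumes "0 \<le> x" "x \<le> 1"
  shows "2 powr (- x) \<le> 1 - x / 3"
proof -
  have "1 + x / 2 \<le> 1 + x * ln 2"
    using ln2_ge_two_thirds assms mult_left_mono[of "1/2" "ln 2" x] by simp
  also have "\<dots> \<le> exp (x * ln 2)"
    by (rule exp_ge_add_one_self)
  also have "\<dots> = 2 powr x"
    by (simp add: powr_def)
  finally have "2 powr (- x) \<le> 1 / (1 + x / 2)"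
    using assms unfolding powr_minus_divide by (intro divide_left_mono) auto
  also have "\<dots> \<le> 1 - x / 3"
  proof -
    have "0 \<le> x / 6 * (1 - x)"
      using assms by simp
    then have "1 \<le> (1 - x / 3) * (1 + x / 2)"
      by (simp add: algebra_simps power2_eq_square)
    then show ?thesis
      using assms by (simp add: divide_le_eq)
  qed
  finally show ?thesis .
qed

text \<open>After division by \<open>2 ^ d\<close> the claim is a bound by 4. The term k = 0 gives
  1. The terms below \<open>2 * h * log 2 d\<close> are at most \<open>1 / d\<close> each, together
  1. Beyond that, \<open>q ^ k\<close> is at most 1 / d^2, so each d-th power is at most twice
  \<open>(1/2) ^ d\<close>, and all binomial coefficients together give 2.\<close>

lemma hoelder_sum_bound:
  fixes h q :: real
  assumes d: "d \<ge> 2" and h: "h > 0" and q: "q = 2 powr (- 1 / h)"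
    and c1: "real d ^ 2 * exp (- (real d / (6 * h))) \<le> 1"
    and c2: "(3/4) ^ d * d powr (2 * h * log 2 d) \<le> 1 / d"
  shows "(\<Sum>k\<le>d. real (d choose k) * (1 + q ^ k) ^ d) \<le> 2 ^ (d + 2)"
proof -
  have qk: "q ^ k = 2 powr (- (k / h))" for k
    by (simp add: q powr_power)
  have ch: "real (d choose k) \<le> real d ^ k" for k
  proof (cases "k \<le> d")
    case True
    then show ?thesis
      using binomial_le_pow[OF True] by (metis of_nat_le_iff of_nat_power)
  qed (simp add: binomial_eq_0)
  \<comment> \<open>Up to \<open>h\<close> the linear bound for \<open>2 powr (- x)\<close> produces
    a geometric term; between \<open>h\<close> and \<open>2 * h * log 2 d\<close> the base is at
    most 3/4, and \<open>c2\<close> absorbs the binomial coefficient.\<close>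
  have mid: "real (d choose k) * ((1 + q ^ k) / 2) ^ d \<le> 1 / d"
    if k: "1 \<le> k" "real k < 2 * h * log 2 d" for k
  proof (cases "real k \<le> h")
    case True
    have "(1 + q ^ k) / 2 \<le> 1 - k / (6 * h)"
      using two_powr_minus_le[of "k / h"] True h by (simp add: qk)
    also have "\<dots> \<le> exp (- (k / (6 * h)))"
      using exp_ge_add_one_self[of "- (k / (6 * h))"] by simp
    finally have "((1 + q ^ k) / 2) ^ d \<le> exp (- (k / (6 * h))) ^ d"
      by (intro power_mono) (auto simp: qk)
    also have "\<dots> = exp (- (real d / (6 * h))) ^ k"
      by (simp add: exp_of_nat_mult[symmetric] mult.commute)
    finally have "real (d choose k) * ((1 + q ^ k) / 2) ^ d \<le> real d ^ k * exp (- (real d / (6 * h))) ^ k"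
      using ch by (intro mult_mono) (auto simp: qk)
    also have "\<dots> = (d * exp (- (real d / (6 * h)))) ^ k"
      by (simp add: power_mult_distrib)
    also have "\<dots> \<le> (1 / d) ^ k"
      using c1 d by (intro power_mono) (auto simp: field_simps power2_eq_square)
    also have "\<dots> \<le> (1 / d) ^ 1"
      using k d by (intro power_decreasing) auto
    finally show ?thesis by simp
  next
    case False
    have "(1 + q ^ k) / 2 \<le> 3/4"
    proof -
      have "2 powr (- (k / h)) \<le> 2 powr (-1)"
        using False h by (intro powr_mono) auto
      moreover have "(2::real) powr (-1) = 1/2"
        by (simp add: powr_minus_divide)
      ultimately have "q ^ k \<le> 1/2"
        by (simp only: qk)
      then show ?thesis by simp
    qed
    then have "((1 + q ^ k) / 2) ^ d \<le> (3/4) ^ d"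
      by (intro power_mono) (auto simp: qk)
    moreover have "real (d choose k) \<le> d powr (2 * h * log 2 d)"
    proof -
      have "real (d choose k) \<le> d powr k"
        using ch d by (simp add: powr_realpow)
      also have "\<dots> \<le> d powr (2 * h * log 2 d)"
        using k d by (intro powr_mono) auto
      finally show ?thesis .
    qed
    ultimately have "real (d choose k) * ((1 + q ^ k) / 2) ^ d \<le> d powr (2 * h * log 2 d) * (3/4) ^ d"
      by (intro mult_mono) (auto simp: qk)
    then show ?thesis
      using c2 by (simp add: mult.commute)
  qed
  have large: "((1 + q ^ k) / 2) ^ d \<le> 2 * (1/2) ^ d" if k: "real k \<ge> 2 * h * log 2 d" for k
  proof -
    have "q ^ k \<le> 2 powr (- (2 * log 2 d))"
      unfolding qk using k h by (intro powr_mono) (auto simp: field_simps)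
    also have "\<dots> = 1 / real d ^ 2"
    proof -
      have "2 powr (- (2 * log 2 d)) = (2 powr (log 2 d)) powr (- 2)"
        by (simp add: powr_powr mult.commute)
      also have "\<dots> = real d powr (- 2)"
        using d by simp
      finally show ?thesis
        using d by (simp add: powr_minus_divide)
    qed
    also have "\<dots> \<le> 1 / (2 * d)"
      using d by (intro divide_left_mono) (auto simp: power2_eq_square)
    finally have "1 + q ^ k \<le> 1 + 1 / (2 * d)"
      by simp
    also have "\<dots> \<le> exp (1 / (2 * d))"
      using exp_ge_add_one_self[of "1 / (2 * real d)"] by simp
    finally have "(1 + q ^ k) ^ d \<le> exp (1 / (2 * d)) ^ d"
      by (intro power_mono) (auto simp: qk)
    also have "\<dots> = exp (1/2)"
      using d by (simp add: exp_of_nat_mult[symmetric])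
    also have "\<dots> \<le> 2"
      by (rule exp_half_le2)
    finally show ?thesis
      by (simp add: power_divide divide_right_mono)
  qed
  have "real (d choose k) * ((1 + q ^ k) / 2) ^ d
      \<le> (if k = 0 then 1 else 0) + (1 / d) * (if 1 \<le> k then 1 else 0) + real (d choose k) * (2 * (1/2) ^ d)" for k
  proof -
    consider "k = 0" | "1 \<le> k" "real k < 2 * h * log 2 d" | "1 \<le> k" "real k \<ge> 2 * h * log 2 d"
      by linarith
    then show ?thesis
    proof cases
      case 2
      then show ?thesis
        by (intro order_trans[OF mid[OF 2]]) simp
    next
      case 3
      then show ?thesis
        using mult_left_mono[OF large[OF 3(2)], of "real (d choose k)"] d by (intro add_increasing) auto
    qed auto
  qed
  then have "(\<Sum>k\<le>d. real (d choose k) * ((1 + q ^ k) / 2) ^ d)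
     \<le> (\<Sum>k\<le>d. (if k = 0 then 1 else 0) + (1 / d) * (if 1 \<le> k then 1 else 0) + real (d choose k) * (2 * (1/2) ^ d))"
    by (rule sum_mono)
  also have "\<dots> = 1 + (1 / d) * (\<Sum>k\<le>d. if 1 \<le> k then 1 else 0) + (\<Sum>k\<le>d. real (d choose k)) * (2 * (1/2) ^ d)"
    by (simp add: sum.distrib sum_distrib_left sum_distrib_right)
  also have "(\<Sum>k\<le>d. if 1 \<le> k then 1 else 0) = real d"
  proof -
    have "{..d} \<inter> {k. 1 \<le> k} = {1..d}" by auto
    then show ?thesis by (simp add: sum.If_cases)
  qed
  also have "(\<Sum>k\<le>d. real (d choose k)) = 2 ^ d"
    by (metis choose_row_sum of_nat_numeral of_nat_power of_nat_sum)
  also have "1 + 1 / real d * real d + 2 ^ d * (2 * (1/2) ^ d) = 4"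
    using d by (simp add: power_divide)
  finally have "(\<Sum>k\<le>d. real (d choose k) * ((1 + q ^ k) / 2) ^ d) * 2 ^ d \<le> 4 * 2 ^ d"
    by (intro mult_right_mono) auto
  then show ?thesis
    by (simp add: sum_distrib_right power_divide)
qed

text \<open>The side conditions for \<open>h = d powr (3/4)\<close>,
  \<open>\<psi> = d powr (1/4)\<close>, \<open>l = g * d powr (-7/10)\<close> and
  \<open>\<tau> = g * d powr (-6/10)\<close>. The last two clauses compare exponents per unit of
  \<open>g\<close>: description costs of order d^(-3/4) up to logarithms must lose against
  d^(-7/10), and the cost of the missed part, of order d^(-7/10) log d, against d^(-6/10).\<close>

definition large_dim :: "nat \<Rightarrow> bool" where
  "large_dim d \<longleftrightarrow> d \<ge> 16
     \<and> real d ^ 2 * exp (- (real d / (6 * d powr (3/4)))) \<le> 1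
     \<and> (3/4) ^ d * d powr (2 * d powr (3/4) * log 2 d) \<le> 1 / d
     \<and> 1 \<le> d powr (1/4) \<and> d powr (1/4) \<le> d / 2
     \<and> real d ^ 12 \<le> (9/8) powr (d powr (1/4) / 2) \<and> real d ^ 12 \<le> 2 ^ d
     \<and> (2 + 2 * d powr (1/4)) / d + 12 * log 2 d * (ln d / d powr (3/4) + 1 / (d * d powr (1/4)))
          \<le> d powr (-7/10) / 20
     \<and> 12 * log 2 d * (ln d / d powr (3/4) + (d powr (-7/10) + 1 / d) / d powr (1/4)) + 2 / d
          + 4 * log 2 d * (d powr (-7/10) + 1 / d) + d powr (-7/10) + 2 * (1/3) powr (d powr (3/4))
          + d powr (-7/10) / 100 \<le> d powr (-6/10)"

lemma eventually_large_dim: "eventually large_dim sequentially"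
proof -
  have "\<forall>\<^sub>F d in sequentially. (16::nat) \<le> d"
    by (rule eventually_ge_at_top)
  moreover have "\<forall>\<^sub>F d::nat in sequentially. real d ^ 2 * exp (- (real d / (6 * d powr (3/4)))) \<le> 1"
    by real_asymp
  moreover have "\<forall>\<^sub>F d::nat in sequentially. (3/4) ^ d * d powr (2 * d powr (3/4) * log 2 d) \<le> 1 / d"
    by real_asymp
  moreover have "\<forall>\<^sub>F d::nat in sequentially. 1 \<le> d powr (1/4)"
    by real_asymp
  moreover have "\<forall>\<^sub>F d::nat in sequentially. d powr (1/4) \<le> d / 2"
    by real_asymp
  moreover have "\<forall>\<^sub>F d::nat in sequentially. real d ^ 12 \<le> (9/8) powr (d powr (1/4) / 2)"
    by real_asymp
  moreover have "\<forall>\<^sub>F d::nat in sequentially. real d ^ 12 \<le> 2 ^ d"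
    by real_asymp
  moreover have "\<forall>\<^sub>F d::nat in sequentially.
      (2 + 2 * d powr (1/4)) / d + 12 * log 2 d * (ln d / d powr (3/4) + 1 / (d * d powr (1/4)))
          \<le> d powr (-7/10) / 20"
    by real_asymp
  moreover have "\<forall>\<^sub>F d::nat in sequentially.
      12 * log 2 d * (ln d / d powr (3/4) + (d powr (-7/10) + 1 / d) / d powr (1/4)) + 2 / d
          + 4 * log 2 d * (d powr (-7/10) + 1 / d) + d powr (-7/10) + 2 * (1/3) powr (d powr (3/4))
          + d powr (-7/10) / 100 \<le> d powr (-6/10)"
    by real_asymp
  ultimately show ?thesis
    by eventually_elim (simp add: large_dim_def)
qed

context cube_like begin

text \<open>Both estimates in a common form, with decay exponential in
  \<open>g * d powr (-7/10)\<close>. The factor \<open>K\<close> stays open because it will be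
  \<open>2 ^ d\<close> for connected sets and \<open>exp (card E / d ^ 12)\<close> for arbitrary
  ones; the base \<open>d ^ 12\<close> serves both.\<close>

lemma family_sum:
  fixes K :: real
  assumes ld: "large_dim d" and K: "K \<ge> 0"
    and AA: "\<And>A. A \<in> \<A> \<Longrightarrow> A \<subseteq> E \<and> A \<noteq> {} \<and> card (nbh A) = g"
    and cnt: "\<And>m. real (card {X. card X = m \<and> (\<exists>A\<in>\<A>. dominates X A)}) \<le> K * (real d ^ 12) ^ m"
  shows "(\<Sum>A\<in>{A\<in>\<A>. real (card (low (d powr (3/4)) A)) > g * d powr (-7/10)}. w (1/3) A)
        \<le> K * 4 ^ d * 2 powr (- (g * d powr (-7/10) / 100))" (is "?a \<le> ?r")
    and "(\<Sum>A\<in>{A\<in>\<A>. real (card (low (d powr (3/4)) A)) \<le> g * d powr (-7/10)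
            \<and> real (card (clo (nbh A))) \<le> g - g * d powr (-6/10)}. w (1/3) A)
        \<le> K * 4 ^ d * 2 powr (- (g * d powr (-7/10) / 100))" (is "?b \<le> ?r")
proof -
  define h where "h = d powr (3/4)"
  define \<psi> where "\<psi> = d powr (1/4)"
  define l where "l = g * d powr (-7/10)"
  define \<tau> where "\<tau> = g * d powr (-6/10)"
  \<comment> \<open>With this base \<open>q ^ k\<close> stays above 1/2 for all degrees below
    \<open>h\<close>.\<close>
  define q where "q = (2::real) powr (- 1 / h)"
  define D where "D = real d ^ 12"
  have d16: "d \<ge> 16" using ld by (simp add: large_dim_def)
  have hpos: "h > 0" "\<psi> > 0" using d16 by (auto simp: h_def \<psi>_def)
  have h1: "h \<ge> 1" using d16 by (simp add: h_def ge_one_powr_ge_zero)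
  have \<psi>: "1 \<le> \<psi>" "\<psi> \<le> d / 2" "D \<le> (9/8) powr (\<psi> / 2)" "D \<le> 2 ^ d" "1 \<le> D"
    using ld d16 by (auto simp: \<psi>_def D_def large_dim_def one_le_power)
  have Y: "(\<Sum>k\<le>d. real (d choose k) * (1 + q ^ k) ^ d) \<le> 2 ^ (d + 2)"
    using ld by (intro hoelder_sum_bound[of d h]) (auto simp: large_dim_def h_def q_def)
  have qk: "q ^ k = 2 powr (- (k / h))" for k
    by (simp add: q_def powr_power)
  have half: "(2::real) powr (-1) = 1/2" by (simp add: powr_minus_divide)
  have gain: "q ^ k \<ge> 1/2" if "1 \<le> k" "real k < h" for k
    unfolding qk half[symmetric] using that hpos by (intro powr_mono) auto
  have q13: "1/3 \<le> q" "q \<le> 1"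
  proof -
    have "2 powr (-1) \<le> q" unfolding q_def using h1 by (intro powr_mono) auto
    then show "1/3 \<le> q" by (simp only: half)
    show "q \<le> 1" unfolding q_def using hpos powr_mono[of "- 1 / h" 0 2] by simp
  qed
  have g1: "real g + 1 \<le> 2 ^ d" if ne: "\<A> \<noteq> {}"
  proof -
    obtain A where A: "A \<in> \<A>" using ne by auto
    then have "g \<le> card Od"
      using AA nbh_subset finite_Od card_mono by metis
    then have "g + 1 \<le> 2 ^ (d - 1) + 2 ^ (d - 1)"
      using card_Od by (metis add_mono one_le_numeral one_le_power)
    also have "\<dots> = 2 ^ d"
      using d16 by (cases d) auto
    finally have "real (g + 1) \<le> real (2 ^ d)"
      by (rule of_nat_mono)
    then show ?thesis
      by simp
  qed
  have Dp: "D = 2 powr (12 * log 2 d)"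
  proof -
    have "2 powr (12 * log 2 d) = (2 powr (log 2 d)) powr 12"
      by (simp add: powr_powr mult.commute)
    also have "\<dots> = D" using d16 by (simp add: D_def powr_numeral)
    finally show ?thesis by simp
  qed
  have Dpx: "D powr x = 2 powr (12 * log 2 d * x)" for x
    unfolding Dp powr_powr ..
  have dpx: "d powr x = 2 powr (log 2 d * x)" for x
    unfolding powr_powr[symmetric] using d16 by simp
  \<comment> \<open>The extra factor \<open>D\<close> comes from the summand 1 in the bound for the
    size of the approximating set.\<close>
  have pref: "K * (real g + 1) * D \<le> K * 4 ^ d" if "\<A> \<noteq> {}"
  proof -
    have "(real g + 1) * D \<le> 2 ^ d * 2 ^ d"
      using g1[OF that] \<psi> by (intro mult_mono) auto
    also have "\<dots> = 4 ^ d" by (simp add: power_mult_distrib[symmetric])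
    finally show ?thesis
      using mult_left_mono[of "(real g + 1) * D" "4 ^ d" K] K by (simp add: mult.assoc add.commute)
  qed
  \<comment> \<open>The constants fit because 1/14 - 1/20 exceeds 1/100; 1/14 is half of the
    exponent in \<open>2 powr (1/7) \<le> 9/8\<close>.\<close>
  have lin1: "x \<le> y / 20 \<Longrightarrow> 0 \<le> y \<Longrightarrow> x - y / 14 \<le> - (y / 100)"
    and lin2: "x + y / 100 \<le> z \<Longrightarrow> x - z \<le> - (y / 100)" for x y z :: real
    by linarith+
  show "?a \<le> ?r"
  proof (cases "\<A> = {}")
    case False
    have "?a \<le> K * (real g + 1) * 2 powr (g * (2 + 2 * \<psi>) / d) * D powr (g * ln d / h + 1 + g / (d * \<psi>)) * (9/8) powr (- l / 2)"
      unfolding h_def[symmetric] l_def[symmetric]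
      by (rule heavy_low_sum[where q = q]) (use AA cnt q13 Y gain hpos \<psi> in \<open>auto simp: D_def\<close>)
    also have "\<dots> = (K * (real g + 1) * D) * (2 powr (g * (2 + 2 * \<psi>) / d) * D powr (g * ln d / h + g / (d * \<psi>)) * (9/8) powr (- l / 2))"
      using \<psi> by (simp add: powr_add mult_ac)
    also have "\<dots> \<le> (K * 4 ^ d) * (2 powr (g * (2 + 2 * \<psi>) / d) * D powr (g * ln d / h + g / (d * \<psi>)) * 2 powr (- l / 14))"
    proof (rule mult_mono[OF pref[OF False]], rule mult_left_mono)
      have "(2::real) powr (1/7) \<le> 9/8"
      proof (rule power_le_imp_le_base[where n = 6])
        show "(2 powr (1/7)) ^ Suc 6 \<le> (9/8::real) ^ Suc 6"
          by (simp only: powr_power) (simp add: power_divide)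
      qed simp
      then have "(2 powr (1/7)) powr (l / 2) \<le> (9/8) powr (l / 2)"
        by (intro powr_mono2) (auto simp: l_def)
      then show "(9/8) powr (- l / 2) \<le> 2 powr (- l / 14)"
        by (simp add: powr_powr powr_minus_divide divide_simps)
    qed (use K in auto)
    also have "2 powr (g * (2 + 2 * \<psi>) / d) * D powr (g * ln d / h + g / (d * \<psi>)) * 2 powr (- l / 14)
        = 2 powr (g * ((2 + 2 * \<psi>) / d + 12 * log 2 d * (ln d / h + 1 / (d * \<psi>)) - d powr (-7/10) / 14))"
      by (simp add: Dp powr_powr powr_add[symmetric] l_def algebra_simps)
    also have "\<dots> \<le> 2 powr (g * (- (d powr (-7/10) / 100)))"
    proof (intro powr_mono mult_left_mono)
      have "(2 + 2 * \<psi>) / d + 12 * log 2 d * (ln d / h + 1 / (d * \<psi>)) \<le> d powr (-7/10) / 20"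
        using ld by (simp add: large_dim_def h_def \<psi>_def)
      moreover have "d powr (-7/10) \<ge> 0" by simp
      ultimately show "(2 + 2 * \<psi>) / d + 12 * log 2 d * (ln d / h + 1 / (d * \<psi>)) - d powr (-7/10) / 14
          \<le> - (d powr (-7/10) / 100)"
        by (rule lin1)
    qed auto
    finally show ?thesis using K by (simp add: mult_left_mono)
  qed (use K in simp)
  show "?b \<le> ?r"
  proof (cases "\<A> = {}")
    case False
    have "?b \<le> K * (real g + 1) * D powr (g * ln d / h + 1 + (l + g / d) / \<psi>) * exp (g / d) * d powr (4 * (l + g / d))
        * 2 powr (- \<tau>) * (4/3) powr l * (1 + (1/3) powr h) ^ g"
      unfolding h_def[symmetric] l_def[symmetric] \<tau>_def[symmetric]
      by (rule light_low_sum) (use AA cnt hpos \<psi> K in \<open>auto simp: D_def\<close>)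
    also have "\<dots> = (K * (real g + 1) * D) * (D powr (g * ln d / h + (l + g / d) / \<psi>) * exp (g / d) * d powr (4 * (l + g / d))
        * 2 powr (- \<tau>) * (4/3) powr l * (1 + (1/3) powr h) ^ g)"
      using \<psi> by (simp add: powr_add mult_ac)
    also have "\<dots> \<le> (K * 4 ^ d) * (D powr (g * ln d / h + (l + g / d) / \<psi>) * 2 powr (2 * g / d) * d powr (4 * (l + g / d))
        * 2 powr (- \<tau>) * 2 powr l * 2 powr (g * (2 * (1/3) powr h)))"
    proof (rule mult_mono[OF pref[OF False]], intro mult_mono order_refl mult_nonneg_nonneg)
      have e: "exp x \<le> 2 powr (2 * x)" if "x \<ge> 0" for x :: real
        using that ln2_ge_two_thirds mult_left_mono[of "1/2" "ln 2" "2 * x"] by (simp add: powr_def)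
      show "exp (g / d) \<le> 2 powr (2 * g / d)"
        using e[of "g / d"] by simp
      show "(4/3) powr l \<le> 2 powr l"
        by (intro powr_mono2) (auto simp: l_def)
      have "(1 + (1/3) powr h) ^ g \<le> exp ((1/3) powr h) ^ g"
        by (intro power_mono) auto
      also have "\<dots> = exp (g * (1/3) powr h)"
        by (simp add: exp_of_nat_mult)
      also have "\<dots> \<le> 2 powr (2 * (g * (1/3) powr h))"
        by (rule e) simp
      finally show "(1 + (1/3) powr h) ^ g \<le> 2 powr (g * (2 * (1/3) powr h))"
        by (simp add: mult_ac)
    qed (use K in auto)
    also have "D powr (g * ln d / h + (l + g / d) / \<psi>) * 2 powr (2 * g / d) * d powr (4 * (l + g / d))
        * 2 powr (- \<tau>) * 2 powr l * 2 powr (g * (2 * (1/3) powr h))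
      = 2 powr (12 * log 2 d * (g * ln d / h + (l + g / d) / \<psi>) + 2 * g / d + log 2 d * (4 * (l + g / d))
          + - \<tau> + l + g * (2 * (1/3) powr h))"
      unfolding dpx Dpx by (simp only: powr_add)
    also have "\<dots> = 2 powr (g * (12 * log 2 d * (ln d / h + (d powr (-7/10) + 1 / d) / \<psi>) + 2 / d
          + 4 * log 2 d * (d powr (-7/10) + 1 / d) + d powr (-7/10) + 2 * (1/3) powr h - d powr (-6/10)))"
      by (simp add: l_def \<tau>_def algebra_simps add_divide_distrib)
    also have "\<dots> \<le> 2 powr (g * (- (d powr (-7/10) / 100)))"
    proof (intro powr_mono mult_left_mono)
      have "12 * log 2 d * (ln d / h + (d powr (-7/10) + 1 / d) / \<psi>) + 2 / d
          + 4 * log 2 d * (d powr (-7/10) + 1 / d) + d powr (-7/10) + 2 * (1/3) powr h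
          + d powr (-7/10) / 100 \<le> d powr (-6/10)"
        using ld by (simp add: large_dim_def h_def \<psi>_def)
      then show "12 * log 2 d * (ln d / h + (d powr (-7/10) + 1 / d) / \<psi>) + 2 / d
          + 4 * log 2 d * (d powr (-7/10) + 1 / d) + d powr (-7/10) + 2 * (1/3) powr h - d powr (-6/10)
          \<le> - (d powr (-7/10) / 100)"
        by (rule lin2)
    qed auto
    finally show ?thesis using K by (simp add: mult_left_mono)
  qed (use K in simp)
qed

end

section \<open>Polymers\<close>

lemma linked_insert:
  assumes "linked R C" "x \<in> C" "R x y" "R y x"
  shows "linked R (insert y C)"
  unfolding linked_def
proof (intro allI impI)
  fix D assume D: "D \<subset> insert y C \<and> D \<noteq> {}"
  show "\<exists>a\<in>D. \<exists>b\<in>insert y C - D. R a b"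
  proof (cases "D \<inter> C \<subset> C \<and> D \<inter> C \<noteq> {}")
    case True
    then have "\<exists>a\<in>D \<inter> C. \<exists>b\<in>C - D \<inter> C. R a b"
      using assms(1) unfolding linked_def by blast
    then show ?thesis by blast
  next
    case False
    then consider "C \<subseteq> D" | "D \<inter> C = {}" by blast
    then show ?thesis
    proof cases
      case 1
      then have "x \<in> D" "y \<notin> D"
        using D assms(2) by auto
      then show ?thesis using assms(3) by blast
    next
      case 2
      then have "y \<in> D" "x \<notin> D"
        using D assms(2) by auto
      then show ?thesis using assms(2,4) by blast
    qed
  qed
qed

text \<open>Take a linked set through \<open>u\<close> of largest size; an edge leaving it could be
  used to enlarge it.\<close>

lemma linked_component:
  assumes "finite A" "u \<in> A" and sym: "\<And>x y. R x y \<Longrightarrow> R y x"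
  shows "\<exists>C\<subseteq>A. u \<in> C \<and> linked R C \<and> (\<forall>x\<in>C. \<forall>y\<in>A - C. \<not> R x y)"
proof -
  define P where "P C \<longleftrightarrow> C \<subseteq> A \<and> u \<in> C \<and> linked R C" for C
  have "P {u}"
    using assms(2) by (auto simp: P_def linked_def)
  moreover have "\<forall>C. P C \<longrightarrow> card C < Suc (card A)"
    using assms(1) by (auto simp: P_def card_mono less_Suc_eq_le)
  ultimately obtain C where C: "P C" "\<And>D. P D \<Longrightarrow> card D \<le> card C"
    using ex_has_greatest_nat[of P "{u}" card "Suc (card A)"] by auto
  have "\<not> R x y" if "x \<in> C" "y \<in> A - C" for x y
  proof
    assume "R x y"
    then have "P (insert y C)"
      using C(1) that linked_insert[of R C x y] \<open>R x y\<close> sym[OF \<open>R x y\<close>] by (auto simp: P_def)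
    then have "card (insert y C) \<le> card C"
      by (rule C(2))
    moreover have "finite C"
      using C(1) assms(1) finite_subset by (auto simp: P_def)
    ultimately show False
      using that by simp
  qed
  then show ?thesis
    using C(1) by (auto simp: P_def)
qed

context cube_like begin

definition near :: "'a \<Rightarrow> 'a \<Rightarrow> bool" where "near u u' \<longleftrightarrow> N u \<inter> N u' \<noteq> {}"

text \<open>The endpoints of a \<open>near\<close> edge, each \<open>near\<close> a vertex of a
  dominating set, chain three relations. Keeping the intermediate vertices in \<open>E\<close> makes
  the balls countable step by step.\<close>

definition near3 :: "'a \<Rightarrow> 'a \<Rightarrow> bool" where
  "near3 x y \<longleftrightarrow> (\<exists>u\<in>E. \<exists>u'\<in>E. near x u \<and> near u u' \<and> near u' y)"

lemma near_sym: "near x y \<Longrightarrow> near y x"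
  by (auto simp: near_def)

lemma near3_sym: "near3 x y \<Longrightarrow> near3 y x"
  unfolding near3_def using near_sym by blast

lemma near_refl: "u \<in> E \<Longrightarrow> near u u"
  using card_N_E[of u] d1 by (auto simp: near_def)

lemma near_ball:
  assumes "x \<in> E" "B \<subseteq> E"
  shows "{y\<in>E. \<exists>b\<in>B. near b y} \<subseteq> nbh (nbh B)"
proof
  fix y assume "y \<in> {y\<in>E. \<exists>b\<in>B. near b y}"
  then obtain b v where "y \<in> E" "b \<in> B" "v \<in> N b" "v \<in> N y"
    by (auto simp: near_def)
  moreover then have "y \<in> N v"
    using assms(2) N_E N_sym by blast
  ultimately show "y \<in> nbh (nbh B)"
    by (auto simp: nbh_def)
qed

lemma card_nbh2_le:
  assumes "B \<subseteq> E"
  shows "nbh (nbh B) \<subseteq> E" "card (nbh (nbh B)) \<le> d\<^sup>2 * card B"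
proof -
  interpret dual: cube_like d Od E N by (rule dual)
  have 1: "nbh B \<subseteq> Od" using assms by (rule nbh_subset)
  then show "nbh (nbh B) \<subseteq> E" by (rule dual.nbh_subset)
  have "card (nbh (nbh B)) \<le> d * (d * card B)"
    using dual.card_nbh_le[OF 1] card_nbh_le[OF assms] by (meson le_trans mult_le_mono2)
  then show "card (nbh (nbh B)) \<le> d\<^sup>2 * card B"
    by (simp add: power2_eq_square mult.assoc)
qed

lemma card_near_ball_le:
  assumes "B \<subseteq> E"
  shows "card {y\<in>E. \<exists>b\<in>B. near b y} \<le> d\<^sup>2 * card B"
proof (cases "B = {}")
  case False
  then obtain x where "x \<in> E" using assms by auto
  have "finite (nbh (nbh B))"
    using card_nbh2_le(1)[OF assms] finite_E finite_subset by blast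
  then show ?thesis
    using card_mono[OF _ near_ball[OF \<open>x \<in> E\<close> assms]] card_nbh2_le(2)[OF assms] by linarith
qed simp

lemma card_near_le: "x \<in> E \<Longrightarrow> card {y\<in>E. near x y} \<le> d\<^sup>2"
  using card_near_ball_le[of "{x}"] by simp

lemma card_near3_le:
  assumes "x \<in> E"
  shows "card {y\<in>E. near3 x y} \<le> d ^ 6"
proof -
  define B1 where "B1 = {y\<in>E. \<exists>b\<in>{x}. near b y}"
  define B2 where "B2 = {y\<in>E. \<exists>b\<in>B1. near b y}"
  define B3 where "B3 = {y\<in>E. \<exists>b\<in>B2. near b y}"
  have "card B1 \<le> d\<^sup>2 * 1"
    unfolding B1_def using assms card_near_ball_le[of "{x}"] by simp
  moreover have "card B2 \<le> d\<^sup>2 * card B1"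
    unfolding B2_def by (rule card_near_ball_le) (auto simp: B1_def)
  moreover have "card B3 \<le> d\<^sup>2 * card B2"
    unfolding B3_def by (rule card_near_ball_le) (auto simp: B2_def)
  ultimately have "card B3 \<le> d\<^sup>2 * (d\<^sup>2 * (d\<^sup>2 * 1))"
    by (meson le_trans mult_le_mono2)
  also have "\<dots> = d ^ 6"
    by (simp add: power_add[symmetric])
  also have "B3 = {y\<in>E. near3 x y}"
    by (auto simp: B1_def B2_def B3_def near3_def)
  finally show ?thesis .
qed

text \<open>For a cut \<open>D\<close> of \<open>X\<close> let \<open>D'\<close> consist of the
  vertices of \<open>C\<close> near \<open>D\<close>. Either \<open>D'\<close> is all of
  \<open>C\<close> and contains a vertex of \<open>X - D\<close>, or a \<open>near\<close> edge of
  \<open>C\<close> leaves \<open>D'\<close>; its outer endpoint is near some vertex of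
  \<open>X\<close>, which cannot lie in \<open>D\<close>.\<close>

lemma linked_dominating:
  assumes C: "C \<subseteq> E" "linked near C" and X: "dominates X C"
  shows "linked near3 X"
  unfolding linked_def
proof (intro allI impI)
  fix D assume D: "D \<subset> X \<and> D \<noteq> {}"
  have XC: "X \<subseteq> C" "X \<subseteq> E" and dom: "\<And>u. u \<in> C \<Longrightarrow> \<exists>x\<in>X. near x u"
    using X C near_sym by (auto simp: dominates_def near_def Int_commute)
  define D' where "D' = {u\<in>C. \<exists>x\<in>D. near x u}"
  have DD: "D \<subseteq> D'"
  proof
    fix x assume "x \<in> D"
    then have "x \<in> C" "near x x"
      using D XC near_refl by auto
    then show "x \<in> D'"
      using \<open>x \<in> D\<close> by (auto simp: D'_def)
  qed
  show "\<exists>x\<in>D. \<exists>y\<in>X - D. near3 x y"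
  proof (cases "D' = C")
    case True
    obtain y where y: "y \<in> X - D" using D by auto
    then have "y \<in> D'" using True XC by auto
    then obtain x where x: "x \<in> D" "near x y" by (auto simp: D'_def)
    moreover have "x \<in> E" "y \<in> E" using x y D XC by auto
    ultimately have "near3 x y"
      using near_refl by (auto simp: near3_def)
    then show ?thesis using x y by blast
  next
    case False
    then have "D' \<subset> C" "D' \<noteq> {}"
      using DD D by (auto simp: D'_def)
    then obtain u u' where u: "u \<in> D'" "u' \<in> C - D'" "near u u'"
      using C(2) unfolding linked_def by blast
    obtain x where x: "x \<in> D" "near x u" using u by (auto simp: D'_def)
    obtain y where y: "y \<in> X" "near y u'" using dom[of u'] u by auto
    have "y \<notin> D" using u y by (auto simp: D'_def)
    have "u \<in> E" "u' \<in> E" using u C by (auto simp: D'_def)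
    then have "near3 x y"
      using x y u near_sym by (auto simp: near3_def)
    then show ?thesis using x y \<open>y \<notin> D\<close> by blast
  qed
qed

text \<open>The possible components. A neighbourhood below half of the side keeps the closure at
  density at most 1/2, where isoperimetry is effective.\<close>

definition polymers :: "'a set \<Rightarrow> 'a set set" where
  "polymers S = {C. C \<subseteq> S \<and> C \<noteq> {} \<and> linked near C \<and> 2 * card (nbh C) < card E}"

text \<open>A dominating set of a polymer is connected for \<open>near3\<close>, whose degrees are
  at most \<open>d ^ 6\<close>; walking each tree edge twice gives the exponent 12, and
  \<open>2 ^ d\<close> covers the choice of a root.\<close>

lemma count_dominating:
  "real (card {X. card X = m \<and> (\<exists>A\<in>{C\<in>polymers E. card (nbh C) = g}. dominates X A)}) \<le> 2 ^ d * (real d ^ 12) ^ m"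
proof -
  let ?X = "{X. card X = m \<and> (\<exists>A\<in>{C\<in>polymers E. card (nbh C) = g}. dominates X A)}"
  have sub: "?X \<subseteq> {X. X \<subseteq> E \<and> X \<noteq> {} \<and> card X = m \<and> linked near3 X}"
  proof
    fix X assume "X \<in> ?X"
    then obtain C where C: "C \<subseteq> E" "C \<noteq> {}" "linked near C" "dominates X C" "card X = m"
      by (auto simp: polymers_def)
    moreover have "X \<subseteq> E" "X \<noteq> {}"
      using C by (auto simp: dominates_def)
    ultimately show "X \<in> {X. X \<subseteq> E \<and> X \<noteq> {} \<and> card X = m \<and> linked near3 X}"
      using linked_dominating[of C X] by auto
  qed
  show ?thesis
  proof (cases "m = 0")
    case True
    have "?X = {}"
    proof -
      have "{X. X \<subseteq> E \<and> X \<noteq> {} \<and> card X = m \<and> linked near3 X} = {}"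
        using True finite_subset[OF _ finite_E] by auto
      then show ?thesis using sub by blast
    qed
    then show ?thesis by (simp only: card.empty) simp
  next
    case False
    have "?X \<subseteq> (\<Union>r\<in>E. {X. X \<subseteq> E \<and> r \<in> X \<and> card X = m \<and> linked near3 X})"
      using sub by blast
    moreover have "finite (\<Union>r\<in>E. {X. X \<subseteq> E \<and> r \<in> X \<and> card X = m \<and> linked near3 X})"
      using finite_E by auto
    ultimately have "card ?X \<le> card (\<Union>r\<in>E. {X. X \<subseteq> E \<and> r \<in> X \<and> card X = m \<and> linked near3 X})"
      by (intro card_mono)
    also have "\<dots> \<le> (\<Sum>r\<in>E. card {X. X \<subseteq> E \<and> r \<in> X \<and> card X = m \<and> linked near3 X})"
      using finite_E by (intro card_UN_le)
    also have "\<dots> \<le> (\<Sum>r\<in>E. (d ^ 6) ^ (2 * (m - 1)))"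
      using finite_E card_near3_le near3_sym False by (intro sum_mono card_linked_sets_le) auto
    also have "\<dots> \<le> 2 ^ d * (d ^ 12) ^ m"
    proof -
      have "(d ^ 6) ^ (2 * (m - 1)) \<le> (d ^ 12) ^ m"
        unfolding power_mult[symmetric] using d1 by (intro power_increasing) auto
      moreover have "card E \<le> 2 ^ d"
        unfolding card_E by (intro power_increasing) auto
      ultimately show ?thesis
        by (simp add: mult_le_mono)
    qed
    finally have "real (card ?X) \<le> real (2 ^ d * (d ^ 12) ^ m)"
      by (rule of_nat_mono)
    then show ?thesis by simp
  qed
qed

text \<open>Isoperimetry is applied to the closure instead of \<open>C\<close>: it has the same
  neighbourhood and density at most 1/2, so it is smaller than that neighbourhood by a factor
  \<open>1 + 1 / (2 * sqrt d)\<close>. As 1/2 < 6/10, this beats the required deficit for large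
  \<open>d\<close>, which is \<open>c\<close>.\<close>

lemma closure_small:
  assumes C: "C \<subseteq> E" "2 * card (nbh C) < card E"
    and c: "1 \<le> (1 + 1 / (2 * sqrt d)) * (1 - d powr (-6/10))"
  shows "real (card (clo (nbh C))) \<le> card (nbh C) - card (nbh C) * d powr (-6/10)"
proof -
  define A where "A = clo (nbh C)"
  define a where "a = real (card A)"
  define g where "g = real (card (nbh C))"
  define n where "n = (2::real) ^ (d - 1)"
  have A: "A \<subseteq> E" "nbh A = nbh C"
    using C(1) by (auto simp: A_def clo_def nbh_def)
  have ag: "a \<le> g"
    using card_le_nbh[OF A(1)] A(2) by (simp add: a_def g_def)
  have gn: "2 * g < n"
  proof -
    have "real (2 * card (nbh C)) < real (card E)"
      using C(2) by (rule of_nat_less_iff[THEN iffD2])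
    then show ?thesis by (simp add: g_def n_def card_E)
  qed
  have sd: "sqrt d > 0" using d1 by simp
  have an: "a / n \<le> 1 / 2" "a \<ge> 0"
    using ag gn by (auto simp: a_def field_simps)
  have "g \<ge> a + a * (1 - a / n) / sqrt d"
    using iso_E[OF A(1)] A(2) by (simp add: nbh_def a_def g_def n_def)
  moreover have "a * (1 - a / n) / sqrt d \<ge> a * (1/2) / sqrt d"
    using an sd by (intro divide_right_mono mult_left_mono) auto
  ultimately have "a * (1 + 1 / (2 * sqrt d)) \<le> g"
    by (simp add: algebra_simps)
  also have "g \<le> g * ((1 + 1 / (2 * sqrt d)) * (1 - d powr (-6/10)))"
    using mult_left_mono[OF c, of g] by (simp add: g_def)
  finally have "a * (1 + 1 / (2 * sqrt d)) \<le> g * (1 - d powr (-6/10)) * (1 + 1 / (2 * sqrt d))"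
    by (simp add: mult_ac)
  moreover have "1 + 1 / (2 * sqrt d) > 0"
    using sd by (intro add_pos_nonneg) auto
  ultimately have "a \<le> g * (1 - d powr (-6/10))"
    by (rule mult_right_le_imp_le)
  then show ?thesis
    by (simp add: a_def g_def A_def algebra_simps)
qed

text \<open>With at least d^2 / 3 neighbours the decay exponent in \<open>family_sum\<close> is of
  order d^(13/10), superlinear, while root, prefactor and choice of \<open>g\<close> cost only
  \<open>16 ^ d\<close>. By \<open>closure_small\<close> the light family needs no separate case of
  large closure.\<close>

lemma big_polymers_sum:
  assumes ld: "large_dim d" and c: "1 \<le> (1 + 1 / (2 * sqrt d)) * (1 - d powr (-6/10))"
  shows "(\<Sum>C\<in>{C\<in>polymers E. real (card (nbh C)) \<ge> d\<^sup>2 / 3}. w (1/3) C)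
     \<le> 2 * 16 ^ d * 2 powr (- (d powr (13/10) / 300))"
proof -
  define \<A> where "\<A> g = {C\<in>polymers E. card (nbh C) = g}" for g
  define r where "r g = 2 ^ d * 4 ^ d * 2 powr (- (real g * d powr (-7/10) / 100))" for g :: nat
  have fin: "finite (polymers E)"
    using finite_E by (intro finite_subset[of "polymers E" "Pow E"]) (auto simp: polymers_def)
  have d0: "d > 0" using d1 by simp
  have *: "(\<Sum>C\<in>\<A> g. w (1/3) C) \<le> 2 * r g" for g
  proof -
    have AA: "A \<subseteq> E \<and> A \<noteq> {} \<and> card (nbh A) = g" if "A \<in> \<A> g" for A
      using that by (auto simp: \<A>_def polymers_def)
    have cl: "real (card (clo (nbh A))) \<le> real g - real g * d powr (-6/10)" if "A \<in> \<A> g" for A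
      using closure_small[OF _ _ c, of A] that by (auto simp: \<A>_def polymers_def)
    define \<A>1 where "\<A>1 = {A\<in>\<A> g. real (card (low (d powr (3/4)) A)) > g * d powr (-7/10)}"
    define \<A>2 where "\<A>2 = {A\<in>\<A> g. real (card (low (d powr (3/4)) A)) \<le> g * d powr (-7/10)
            \<and> real (card (clo (nbh A))) \<le> g - g * d powr (-6/10)}"
    have split: "\<A> g = \<A>1 \<union> \<A>2" "\<A>1 \<inter> \<A>2 = {}"
      using cl unfolding \<A>1_def \<A>2_def by force+
    moreover have "finite (\<A> g)"
      using fin by (simp add: \<A>_def)
    ultimately have "(\<Sum>C\<in>\<A> g. w (1/3) C) = (\<Sum>C\<in>\<A>1. w (1/3) C) + (\<Sum>C\<in>\<A>2. w (1/3) C)"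
      by (simp add: sum.union_disjoint)
    also have "\<dots> \<le> r g + r g"
      unfolding r_def \<A>1_def \<A>2_def
      by (intro add_mono family_sum[OF ld _ AA]) (use count_dominating in \<open>auto simp: \<A>_def\<close>)
    finally show ?thesis by simp
  qed
  define G where "G = {g. g \<le> 2 ^ (d - 1) \<and> real g \<ge> d\<^sup>2 / 3}"
  have finG: "finite G" "card G \<le> 2 ^ d"
  proof -
    have sub: "G \<subseteq> {..2 ^ (d - 1)}" by (auto simp: G_def)
    then show "finite G" using finite_subset by blast
    have "card G \<le> 2 ^ (d - 1) + 1"
      using card_mono[OF _ sub] by simp
    also have "\<dots> \<le> 2 ^ (d - 1) + 2 ^ (d - 1)" by simp
    also have "\<dots> = 2 ^ d" using d0 by (cases d) auto
    finally show "card G \<le> 2 ^ d" .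
  qed
  have "(\<Sum>C\<in>{C\<in>polymers E. real (card (nbh C)) \<ge> d\<^sup>2 / 3}. w (1/3) C)
     = (\<Sum>g\<in>G. \<Sum>C\<in>{C\<in>{C\<in>polymers E. real (card (nbh C)) \<ge> d\<^sup>2 / 3}. card (nbh C) = g}. w (1/3) C)"
  proof (rule sum.group[symmetric])
    show "(\<lambda>C. card (nbh C)) ` {C \<in> polymers E. d\<^sup>2 / 3 \<le> real (card (nbh C))} \<subseteq> G"
      using card_E by (auto simp: G_def polymers_def)
  qed (use fin finG in auto)
  also have "\<dots> \<le> (\<Sum>g\<in>G. \<Sum>C\<in>\<A> g. w (1/3) C)"
    using fin w_nonneg by (intro sum_mono sum_mono2) (auto simp: \<A>_def)
  also have "\<dots> \<le> (\<Sum>g\<in>G. 2 * (2 ^ d * 4 ^ d * 2 powr (- (d powr (13/10) / 300))))"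
  proof (rule sum_mono)
    fix g assume g: "g \<in> G"
    have "d powr (13/10) / 3 = d\<^sup>2 / 3 * d powr (-7/10)"
      using d0 powr_add[of d 2 "-7/10"] by (simp add: powr_numeral)
    also have "\<dots> \<le> real g * d powr (-7/10)"
      using g by (intro mult_right_mono) (auto simp: G_def)
    finally have "r g \<le> 2 ^ d * 4 ^ d * 2 powr (- (d powr (13/10) / 300))"
      unfolding r_def by (intro mult_left_mono powr_mono) auto
    then show "(\<Sum>C\<in>\<A> g. w (1/3) C) \<le> 2 * (2 ^ d * 4 ^ d * 2 powr (- (d powr (13/10) / 300)))"
      using *[of g] by linarith
  qed
  also have "\<dots> = card G * (2 * (2 ^ d * 4 ^ d * 2 powr (- (d powr (13/10) / 300))))"
    by simp
  also have "\<dots> \<le> 2 ^ d * (2 * (2 ^ d * 4 ^ d * 2 powr (- (d powr (13/10) / 300))))"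
    using of_nat_mono[OF finG(2), where 'a = real] by (intro mult_right_mono) auto
  also have "\<dots> = 2 * ((2 * 2 * 4) ^ d) * 2 powr (- (d powr (13/10) / 300))"
    unfolding power_mult_distrib by simp
  finally show ?thesis by simp
qed

end

text \<open>The summands belong to polymers with 2 to 6 vertices, to those with at least 7 vertices
  but fewer than D^2 / 3 neighbours, and to those with at least D^2 / 3 neighbours. The leading
  factor \<open>D\<close> accounts for the number of sizes.\<close>

definition polymer_error :: "nat \<Rightarrow> real" where
  "polymer_error D = D * (2 ^ D * (real D ^ 20 * (2/3) ^ (2 * D - 4) + (real D ^ 4 * (2/3) powr (D / 3)) ^ 7))
     + 2 * 16 ^ D * 2 powr (- (D powr (13/10) / 300))"

section \<open>Polymers with few neighbours\<close>

context cube_like begin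

lemma sum_square_degree_le:
  assumes A: "A \<subseteq> E" "A \<noteq> {}"
  shows "(\<Sum>v\<in>Od. (card (N v \<inter> A))\<^sup>2) \<le> card A * (d + 2 * (card A - 1))"
proof -
  have finA: "finite A" using A finite_E finite_subset by auto
  have "(\<Sum>v\<in>Od. (card (N v \<inter> A))\<^sup>2) = (\<Sum>v\<in>Od. \<Sum>u\<in>A. if u \<in> N v then card (N v \<inter> A) else 0)"
    using finA by (intro sum.cong refl) (simp add: sum.If_cases power2_eq_square Int_commute)
  also have "\<dots> = (\<Sum>u\<in>A. \<Sum>v\<in>Od. if u \<in> N v then card (N v \<inter> A) else 0)"
    by (rule sum.swap)
  also have "\<dots> = (\<Sum>u\<in>A. \<Sum>u'\<in>A. card (N u' \<inter> N u))"
  proof (rule sum.cong[OF refl])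
    fix u assume u: "u \<in> A"
    then have Nu: "N u \<subseteq> Od" "{v \<in> Od. u \<in> N v} = N u"
      using A N_E N_sym by blast+
    have "(\<Sum>v\<in>Od. if u \<in> N v then card (N v \<inter> A) else 0) = (\<Sum>v\<in>{v \<in> Od. u \<in> N v}. card (N v \<inter> A))"
      using finite_Od by (simp add: sum.If_cases Int_def)
    also have "\<dots> = (\<Sum>u'\<in>A. card (N u' \<inter> N u))"
      unfolding Nu(2) by (rule sum_degree_swap[OF A(1) Nu(1)])
    finally show "(\<Sum>v\<in>Od. if u \<in> N v then card (N v \<inter> A) else 0) = (\<Sum>u'\<in>A. card (N u' \<inter> N u))" .
  qed
  also have "\<dots> \<le> (\<Sum>u\<in>A. d + 2 * (card A - 1))"
  proof (rule sum_mono)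
    fix u assume u: "u \<in> A"
    have "(\<Sum>u'\<in>A. card (N u' \<inter> N u)) = card (N u) + (\<Sum>u'\<in>A - {u}. card (N u' \<inter> N u))"
      using u finA by (simp add: sum.remove)
    also have "\<dots> \<le> d + (\<Sum>u'\<in>A - {u}. 2)"
    proof (intro add_mono sum_mono)
      show "card (N u) \<le> d"
        using u A card_N_E by auto
      show "card (N u' \<inter> N u) \<le> 2" if "u' \<in> A - {u}" for u'
        using that u A by (intro codegree_E) auto
    qed
    finally show "(\<Sum>u'\<in>A. card (N u' \<inter> N u)) \<le> d + 2 * (card A - 1)"
      using u finA by simp
  qed
  finally show ?thesis by simp
qed

text \<open>Cauchy-Schwarz for the degrees into \<open>A\<close>: their sum is
  \<open>d * card A\<close>, and the codegree bound controls the sum of their squares.\<close>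

lemma card_nbh_ge:
  assumes A: "A \<subseteq> E" "A \<noteq> {}"
  shows "d\<^sup>2 * card A \<le> card (nbh A) * (d + 2 * (card A - 1))"
proof -
  have m: "card A > 0" using A finite_E finite_subset by (metis card_gt_0_iff)
  have "real ((d * card A)\<^sup>2) = (\<Sum>v\<in>nbh A. real (card (N v \<inter> A)))\<^sup>2"
    using sum_degree_nbh[OF A(1)] by (simp flip: of_nat_sum)
  also have "\<dots> \<le> card (nbh A) * (\<Sum>v\<in>nbh A. (real (card (N v \<inter> A)))\<^sup>2)"
    using sum_squared_le_sum_of_squares[of "\<lambda>v. real (card (N v \<inter> A))" "nbh A"] finite_nbh[OF A(1)]
    by (simp add: mult.commute)
  also have "(\<Sum>v\<in>nbh A. (real (card (N v \<inter> A)))\<^sup>2) \<le> (\<Sum>v\<in>Od. (real (card (N v \<inter> A)))\<^sup>2)"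
    using nbh_subset[OF A(1)] finite_Od by (intro sum_mono2) auto
  also have "(\<Sum>v\<in>Od. (real (card (N v \<inter> A)))\<^sup>2) \<le> card A * (d + 2 * (card A - 1))"
    using of_nat_mono[OF sum_square_degree_le[OF A], where 'a = real] by simp
  finally have "real ((d * card A)\<^sup>2) \<le> real (card (nbh A) * (card A * (d + 2 * (card A - 1))))"
    by (simp add: mult_left_mono)
  then have "(d * card A)\<^sup>2 \<le> card (nbh A) * (card A * (d + 2 * (card A - 1)))"
    by (rule of_nat_le_iff[THEN iffD1])
  then have "card A * (d\<^sup>2 * card A) \<le> card A * (card (nbh A) * (d + 2 * (card A - 1)))"
    by (simp add: power2_eq_square mult_ac)
  then show ?thesis using m by simp
qed

lemma w_le_power:
  assumes "A \<subseteq> E"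
  shows "w (1/3) A \<le> (2/3) ^ card (nbh A)"
proof -
  have "w (1/3) A \<le> (\<Prod>v\<in>nbh A. 2/3)"
    unfolding w_eq[OF assms]
  proof (intro prod_mono conjI)
    fix v assume v: "v \<in> nbh A"
    then have "card (N v \<inter> A) \<ge> 1"
      using degree_zero_iff[OF assms, of v] nbh_subset[OF assms] by (metis less_one not_le subsetD)
    then have "(1/3::real) ^ card (N v \<inter> A) \<le> (1/3) ^ 1"
      by (intro power_decreasing) auto
    then show "(1 + (1/3) ^ card (N v \<inter> A)) / 2 \<le> (2/3::real)"
      by simp
  qed auto
  then show ?thesis by simp
qed

lemma count_linked:
  assumes "m \<ge> 1"
  shows "real (card {C. C \<subseteq> E \<and> card C = m \<and> linked near C}) \<le> 2 ^ d * real d ^ (4 * (m - 1))"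
proof -
  let ?X = "{C. C \<subseteq> E \<and> card C = m \<and> linked near C}"
  have "?X \<subseteq> (\<Union>r\<in>E. {X. X \<subseteq> E \<and> r \<in> X \<and> card X = m \<and> linked near X})"
  proof
    fix C assume C: "C \<in> ?X"
    then have "C \<noteq> {}" using assms by auto
    then show "C \<in> (\<Union>r\<in>E. {X. X \<subseteq> E \<and> r \<in> X \<and> card X = m \<and> linked near X})"
      using C by auto
  qed
  moreover have "finite (\<Union>r\<in>E. {X. X \<subseteq> E \<and> r \<in> X \<and> card X = m \<and> linked near X})"
    using finite_E by auto
  ultimately have "card ?X \<le> card (\<Union>r\<in>E. {X. X \<subseteq> E \<and> r \<in> X \<and> card X = m \<and> linked near X})"
    by (intro card_mono)
  also have "\<dots> \<le> (\<Sum>r\<in>E. card {X. X \<subseteq> E \<and> r \<in> X \<and> card X = m \<and> linked near X})"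
    using finite_E by (intro card_UN_le)
  also have "\<dots> \<le> (\<Sum>r\<in>E. (d\<^sup>2) ^ (2 * (m - 1)))"
    using finite_E card_near_le near_sym assms by (intro sum_mono card_linked_sets_le) auto
  also have "\<dots> = card E * d ^ (4 * (m - 1))"
    by (simp add: power_mult[symmetric])
  also have "\<dots> \<le> 2 ^ d * d ^ (4 * (m - 1))"
    unfolding card_E using d1 by (intro mult_le_mono power_increasing) auto
  finally have "real (card ?X) \<le> real (2 ^ d * d ^ (4 * (m - 1)))"
    by (rule of_nat_mono)
  then show ?thesis by simp
qed

text \<open>Fewer than d^2 / 3 neighbours force fewer than \<open>d\<close> vertices, and in this
  range each vertex accounts for at least d / 3 neighbours. From 7 vertices on, the resulting decay
  beats the \<open>2 ^ d\<close> choices of a root. For smaller sizes the neighbourhood bound 2d - 4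
  is sharper and leaves (8/9)^d up to powers of d.\<close>

lemma small_polymers_sum:
  assumes d4: "d \<ge> 4" and c: "real d ^ 4 * (2/3) powr (d / 3) \<le> 1"
  shows "(\<Sum>C\<in>{C\<in>polymers E. card C \<ge> 2 \<and> real (card (nbh C)) < d\<^sup>2 / 3}. w (1/3) C)
     \<le> d * (2 ^ d * (real d ^ 20 * (2/3) ^ (2 * d - 4) + (real d ^ 4 * (2/3) powr (d / 3)) ^ 7))"
proof -
  define P where "P = {C\<in>polymers E. card C \<ge> 2 \<and> real (card (nbh C)) < d\<^sup>2 / 3}"
  define T where "T = 2 ^ d * (real d ^ 20 * (2/3) ^ (2 * d - 4) + (real d ^ 4 * (2/3) powr (d / 3)) ^ 7)"
  have finP: "finite P"
    using finite_E by (intro finite_subset[of P "Pow E"]) (auto simp: P_def polymers_def)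
  have PE: "C \<subseteq> E" "C \<noteq> {}" "linked near C" "2 \<le> card C" "finite C" "3 * card (nbh C) < d\<^sup>2"
    if "C \<in> P" for C
  proof -
    show "C \<subseteq> E" "C \<noteq> {}" "linked near C" "2 \<le> card C"
      using that by (auto simp: P_def polymers_def)
    then show "finite C" using finite_E finite_subset by blast
    have "real (3 * card (nbh C)) < real (d\<^sup>2)"
      using that by (simp add: P_def)
    then show "3 * card (nbh C) < d\<^sup>2" by (rule of_nat_less_iff[THEN iffD1])
  qed
  have small: "card C < d" if C: "C \<in> P" for C
  proof (rule ccontr)
    assume "\<not> card C < d"
    \<comment> \<open>For exactly \<open>d\<close> vertices the factor
      \<open>d + 2 * (d - 1)\<close> is below \<open>3 * d\<close>, which forces d^2 / 3
      neighbours.\<close>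
    then obtain A where A: "A \<subseteq> C" "card A = d"
      using obtain_subset_with_card_n[of d C] by (metis not_less)
    have AE: "A \<subseteq> E" "A \<noteq> {}" using A PE[OF C] d1 by auto
    have "d\<^sup>2 * d \<le> card (nbh A) * (d + 2 * (d - 1))"
      using card_nbh_ge[OF AE] A by simp
    also have "\<dots> \<le> card (nbh C) * (3 * d)"
      using nbh_mono[OF A(1)] finite_nbh[OF PE(1)[OF C]] by (intro mult_le_mono card_mono) auto
    finally have "d\<^sup>2 * d \<le> (3 * card (nbh C)) * d" by (simp add: mult_ac)
    then show False
      using PE(6)[OF C] d1 by simp
  qed
  have weight: "(\<Sum>C\<in>{C\<in>P. card C = m}. w (1/3) C) \<le> T" if m: "m \<in> {2..<d}" for m
  proof -
    have cnt: "real (card {C\<in>P. card C = m}) \<le> 2 ^ d * real d ^ (4 * (m - 1))"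
    proof -
      have "finite {C. C \<subseteq> E \<and> card C = m \<and> linked near C}"
        by (rule finite_subset[of _ "Pow E"]) (use finite_E in auto)
      then have "card {C\<in>P. card C = m} \<le> card {C. C \<subseteq> E \<and> card C = m \<and> linked near C}"
        by (rule card_mono) (use PE(1,3) in blast)
      then show ?thesis
        using count_linked[of m] m of_nat_mono[of "card {C\<in>P. card C = m}" _, where 'a = real]
        by (meson atLeastLessThan_iff le_trans one_le_numeral order_trans)
    qed
    show ?thesis
    proof (cases "m \<le> 6")
      case True
      have g: "card (nbh C) \<ge> 2 * d - 4" if C: "C \<in> P" "card C = m" for C
      proof (rule ccontr)
        assume "\<not> ?thesis"
        then have lt: "int (card (nbh C)) \<le> 2 * int d - 5" by linarith
        \<comment> \<open>Over the integers and with m = k + 2 no subtraction is truncated; after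
          expansion all terms on the left are non-negative because \<open>d\<close> is at least 4,
          and one is positive.\<close>
        obtain k where k: "m = k + 2" using m by (metis add.commute atLeastLessThan_iff le_iff_add)
        have "d\<^sup>2 * card C \<le> card (nbh C) * (d + 2 * (card C - 1))"
          by (rule card_nbh_ge[OF PE(1,2)[OF C(1)]])
        then have "int (d\<^sup>2 * m) \<le> int (card (nbh C) * (d + 2 * (m - 1)))"
          using C(2) by (simp only: of_nat_le_iff)
        also have "\<dots> = int (card (nbh C)) * (int d + 2 * (int k + 1))"
          using k by (simp add: algebra_simps)
        also have "\<dots> \<le> (2 * int d - 5) * (int d + 2 * (int k + 1))"
          using lt by (intro mult_right_mono) auto
        finally have "int d * int d * (int k + 2) \<le> (2 * int d - 5) * (int d + 2 * (int k + 1))"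
          by (simp add: k power2_eq_square algebra_simps)
        then have "int k * (int d * (int d - 4)) + int d + 10 * (int k + 1) \<le> 0"
          by (simp add: algebra_simps)
        moreover have "int k * (int d * (int d - 4)) \<ge> 0" using d4 by simp
        ultimately show False by simp
      qed
      have "(\<Sum>C\<in>{C\<in>P. card C = m}. w (1/3) C) \<le> (\<Sum>C\<in>{C\<in>P. card C = m}. (2/3) ^ (2 * d - 4))"
      proof (rule sum_mono)
        fix C assume C: "C \<in> {C\<in>P. card C = m}"
        have "w (1/3) C \<le> (2/3) ^ card (nbh C)"
          using C PE(1) by (intro w_le_power) blast
        also have "\<dots> \<le> (2/3) ^ (2 * d - 4)"
          using C g by (intro power_decreasing) auto
        finally show "w (1/3) C \<le> (2/3) ^ (2 * d - 4)" .
      qed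
      also have "\<dots> = card {C\<in>P. card C = m} * (2/3) ^ (2 * d - 4)"
        by simp
      also have "\<dots> \<le> (2 ^ d * real d ^ 20) * (2/3) ^ (2 * d - 4)"
      proof (intro mult_right_mono order_trans[OF cnt] mult_left_mono)
        show "real d ^ (4 * (m - 1)) \<le> real d ^ 20"
          using True d1 by (intro power_increasing) auto
      qed auto
      also have "\<dots> \<le> T"
        by (simp add: T_def distrib_left)
      finally show ?thesis .
    next
      case False
      have g: "d * m \<le> 3 * card (nbh C)" if C: "C \<in> P" "card C = m" for C
      proof -
        have "d\<^sup>2 * m \<le> card (nbh C) * (d + 2 * (m - 1))"
          using card_nbh_ge[OF PE(1,2)[OF C(1)]] C(2) by simp
        also have "\<dots> \<le> card (nbh C) * (3 * d)"
          using m by (intro mult_le_mono) auto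
        finally have "d * (d * m) \<le> d * (3 * card (nbh C))"
          by (simp add: power2_eq_square mult_ac)
        then show ?thesis using d1 by simp
      qed
      have "(\<Sum>C\<in>{C\<in>P. card C = m}. w (1/3) C) \<le> (\<Sum>C\<in>{C\<in>P. card C = m}. ((2/3) powr (d / 3)) ^ m)"
      proof (rule sum_mono)
        fix C assume C: "C \<in> {C\<in>P. card C = m}"
        have "real (d * m) \<le> real (3 * card (nbh C))"
          using C g by (intro of_nat_mono) auto
        then have le: "m * (d / 3) \<le> real (card (nbh C))"
          by (simp add: mult.commute)
        have "w (1/3) C \<le> (2/3) ^ card (nbh C)"
          using C PE(1) by (intro w_le_power) blast
        also have "\<dots> = (2/3) powr card (nbh C)"
          by (simp add: powr_realpow)
        also have "\<dots> \<le> (2/3) powr (m * (d / 3))"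
          using le by (intro powr_mono') auto
        also have "\<dots> = ((2/3) powr (d / 3)) ^ m"
          by (subst powr_power) auto
        finally show "w (1/3) C \<le> ((2/3) powr (d / 3)) ^ m" .
      qed
      also have "\<dots> = card {C\<in>P. card C = m} * ((2/3) powr (d / 3)) ^ m"
        by simp
      also have "\<dots> \<le> (2 ^ d * (real d ^ 4) ^ m) * ((2/3) powr (d / 3)) ^ m"
      proof (intro mult_right_mono order_trans[OF cnt] mult_left_mono)
        show "real d ^ (4 * (m - 1)) \<le> (real d ^ 4) ^ m"
          unfolding power_mult[symmetric] using d1 by (intro power_increasing) auto
      qed auto
      also have "\<dots> = 2 ^ d * (real d ^ 4 * (2/3) powr (d / 3)) ^ m"
        by (simp add: power_mult_distrib)
      also have "\<dots> \<le> 2 ^ d * (real d ^ 4 * (2/3) powr (d / 3)) ^ 7"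
        using c False by (intro mult_left_mono power_decreasing) auto
      also have "\<dots> \<le> T"
        by (simp add: T_def distrib_left)
      finally show ?thesis .
    qed
  qed
  have "(\<Sum>C\<in>P. w (1/3) C) = (\<Sum>m\<in>{2..<d}. \<Sum>C\<in>{C\<in>P. card C = m}. w (1/3) C)"
    using finP PE(4) small by (intro sum.group[symmetric]) auto
  also have "\<dots> \<le> (\<Sum>m\<in>{2..<d}. T)"
    by (rule sum_mono) (rule weight)
  also have "\<dots> \<le> d * T"
    by (auto simp: T_def intro!: mult_right_mono)
  finally show ?thesis
    by (simp add: P_def T_def)
qed

section \<open>From polymer weights to sums over sets with small neighbourhood\<close>

lemma w_disjoint_union:
  assumes "A \<subseteq> E" "B \<subseteq> E" "nbh A \<inter> nbh B = {}"
  shows "w q (A \<union> B) = w q A * w q B"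
  unfolding w_def prod.distrib[symmetric]
proof (intro prod.cong refl)
  fix v assume v: "v \<in> Od"
  have "N v \<inter> A = {} \<or> N v \<inter> B = {}"
    using assms in_nbh_iff[OF assms(1) v] in_nbh_iff[OF assms(2) v] by auto
  then show "(1 + q ^ card (N v \<inter> (A \<union> B))) / 2 = (1 + q ^ card (N v \<inter> A)) / 2 * ((1 + q ^ card (N v \<inter> B)) / 2)"
    by (auto simp: Int_Un_distrib)
qed

text \<open>Adding a vertex \<open>u\<close>, a set containing \<open>u\<close> splits into the
  component \<open>C\<close> of \<open>u\<close> and the rest, with multiplicative weight and in an
  injective way. Hence the sum grows by a factor of at most 1 plus the total weight of the polymers
  through \<open>u\<close>, and 1 + t is at most exp t.\<close>

lemma polymer_bound:
  assumes S: "S \<subseteq> E" and q: "q \<ge> 0"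
  shows "(\<Sum>A\<in>{A. A \<subseteq> S \<and> 2 * card (nbh A) < card E}. w q A) \<le> exp (\<Sum>C\<in>polymers S. w q C)"
proof -
  have "finite S" using S finite_E finite_subset by auto
  then show ?thesis
    using S
  proof (induction S rule: finite_induct)
    case empty
    have "{A. A \<subseteq> {} \<and> 2 * card (nbh A) < card E} \<subseteq> {{}}" by auto
    then have "(\<Sum>A\<in>{A. A \<subseteq> {} \<and> 2 * card (nbh A) < card E}. w q A) \<le> (\<Sum>A\<in>{{}}. w q A)"
      using q w_nonneg by (intro sum_mono2) auto
    also have "\<dots> = 1" by (simp add: w_def)
    finally have "(\<Sum>A\<in>{A. A \<subseteq> {} \<and> 2 * card (nbh A) < card E}. w q A) \<le> 1" .
    moreover have "polymers {} = {}" by (auto simp: polymers_def)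
    ultimately show ?case by simp
  next
    case (insert u S)
    define Z where "Z S = {A. A \<subseteq> S \<and> 2 * card (nbh A) < card E}" for S
    define Pu where "Pu = {C\<in>polymers (insert u S). u \<in> C}"
    have fin: "finite (Z T)" "finite (polymers T)" if "T \<subseteq> E" for T
      using that finite_E finite_subset[OF that finite_E]
      by (auto simp: Z_def polymers_def intro: finite_subset[of _ "Pow T"])
    have SE: "S \<subseteq> E" "u \<in> E" "insert u S \<subseteq> E" using insert.prems by auto
    have "\<exists>C. C \<in> Pu \<and> A - C \<in> Z S \<and> C \<subseteq> A \<and> w q A = w q C * w q (A - C)"
      if A: "A \<in> Z (insert u S)" "u \<in> A" for A
    proof -
      have AE: "A \<subseteq> E" using A SE by (auto simp: Z_def)
      then have finA: "finite A" using finite_E finite_subset by blast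
      obtain C where C: "C \<subseteq> A" "u \<in> C" "linked near C" "\<forall>x\<in>C. \<forall>y\<in>A - C. \<not> near x y"
        using linked_component[OF finA A(2), of near] near_sym by auto
      have disj: "nbh C \<inter> nbh (A - C) = {}"
        using C(4) by (auto simp: nbh_def near_def)
      have le: "card (nbh C) \<le> card (nbh A)" "card (nbh (A - C)) \<le> card (nbh A)"
        using C(1) AE by (auto intro!: card_mono finite_nbh nbh_mono)
      have "C \<in> Pu"
        using C A le by (auto simp: Pu_def polymers_def Z_def)
      moreover have "A - C \<in> Z S"
        using C A le by (auto simp: Z_def)
      moreover have "w q A = w q C * w q (A - C)"
        using w_disjoint_union[of C "A - C"] C(1) AE disj by (auto simp: Un_absorb1)
      ultimately show ?thesis using C(1) by blast
    qed
    then have "\<forall>A\<in>{A\<in>Z (insert u S). u \<in> A}. \<exists>C. C \<in> Pu \<and> A - C \<in> Z S \<and> C \<subseteq> A \<and> w q A = w q C * w q (A - C)"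
      by blast
    from bchoice[OF this] obtain c where "\<forall>A\<in>{A\<in>Z (insert u S). u \<in> A}.
        c A \<in> Pu \<and> A - c A \<in> Z S \<and> c A \<subseteq> A \<and> w q A = w q (c A) * w q (A - c A)" ..
    then have c: "c A \<in> Pu" "A - c A \<in> Z S" "c A \<subseteq> A" "w q A = w q (c A) * w q (A - c A)"
      if "A \<in> Z (insert u S)" "u \<in> A" for A
      using that by auto
    let ?Zu = "{A\<in>Z (insert u S). u \<in> A}"
    have inj: "inj_on (\<lambda>A. (c A, A - c A)) ?Zu"
      using c(3) by (intro inj_onI) (metis (mono_tags, lifting) Diff_partition fst_conv mem_Collect_eq snd_conv)
    have "(\<Sum>A\<in>?Zu. w q A) = (\<Sum>A\<in>?Zu. (\<lambda>(C, B). w q C * w q B) (c A, A - c A))"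
      using c(4) by (intro sum.cong) auto
    also have "\<dots> = (\<Sum>(C, B)\<in>(\<lambda>A. (c A, A - c A)) ` ?Zu. w q C * w q B)"
      by (simp add: sum.reindex[OF inj])
    also have "\<dots> \<le> (\<Sum>(C, B)\<in>Pu \<times> Z S. w q C * w q B)"
      using c fin SE q w_nonneg by (intro sum_mono2) (auto simp: Pu_def)
    also have "\<dots> = (\<Sum>C\<in>Pu. w q C) * (\<Sum>B\<in>Z S. w q B)"
      by (simp add: sum_product sum.cartesian_product)
    finally have u: "(\<Sum>A\<in>?Zu. w q A) \<le> (\<Sum>C\<in>Pu. w q C) * (\<Sum>B\<in>Z S. w q B)" .
    have "Z (insert u S) = Z S \<union> ?Zu" "Z S \<inter> ?Zu = {}"
      using insert(2) by (auto simp: Z_def)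
    then have "(\<Sum>A\<in>Z (insert u S). w q A) = (\<Sum>A\<in>Z S. w q A) + (\<Sum>A\<in>?Zu. w q A)"
      using fin SE by (metis (no_types, lifting) finite_Un sum.union_disjoint)
    also have "\<dots> \<le> (1 + (\<Sum>C\<in>Pu. w q C)) * (\<Sum>B\<in>Z S. w q B)"
      using u by (simp add: algebra_simps)
    also have "\<dots> \<le> exp (\<Sum>C\<in>Pu. w q C) * exp (\<Sum>C\<in>polymers S. w q C)"
      using insert.IH[OF SE(1)] q w_nonneg
      by (intro mult_mono) (auto simp: Z_def intro!: sum_nonneg)
    also have "\<dots> = exp ((\<Sum>C\<in>Pu. w q C) + (\<Sum>C\<in>polymers S. w q C))"
      by (simp add: exp_add)
    also have "(\<Sum>C\<in>Pu. w q C) + (\<Sum>C\<in>polymers S. w q C) = (\<Sum>C\<in>polymers (insert u S). w q C)"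
    proof -
      have "polymers (insert u S) = Pu \<union> polymers S" "Pu \<inter> polymers S = {}"
        using insert(2) by (auto simp: Pu_def polymers_def)
      then show ?thesis
        using fin SE by (metis (no_types, lifting) finite_Un sum.union_disjoint)
    qed
    finally show ?case by (simp add: Z_def)
  qed
qed

lemma w_singleton:
  assumes "u \<in> E"
  shows "w q {u} = ((1 + q) / 2) ^ d"
proof -
  have "w q {u} = (\<Prod>v\<in>N u. (1 + q) / 2)"
  proof -
    have "card (N v \<inter> {u}) = 1" if "v \<in> N u" for v
    proof -
      have "u \<in> N v" using that assms N_E N_sym by blast
      then have "N v \<inter> {u} = {u}" by auto
      then show ?thesis by simp
    qed
    then show ?thesis
      using w_eq[of "{u}" q] assms by (simp add: nbh_def)
  qed
  then show ?thesis using card_N_E[OF assms] by simp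
qed

text \<open>Singletons are kept at the true \<open>q\<close> and form the main term; all other
  polymers are estimated at 1/3 by monotonicity of the weight.\<close>

lemma small_neighbourhood_sum:
  assumes ld: "large_dim d" and q: "0 \<le> q" "q \<le> 1/3"
    and c1: "real d ^ 4 * (2/3) powr (d / 3) \<le> 1"
    and c2: "1 \<le> (1 + 1 / (2 * sqrt d)) * (1 - d powr (-6/10))"
  shows "(\<Sum>A\<in>{A. A \<subseteq> E \<and> 2 * card (nbh A) < card E}. w q A)
     \<le> exp (card E * ((1 + q) / 2) ^ d + polymer_error d)"
proof -
  define P1 where "P1 = {C\<in>polymers E. card C = 1}"
  define P2 where "P2 = {C\<in>polymers E. card C \<ge> 2 \<and> real (card (nbh C)) < d\<^sup>2 / 3}"
  define P3 where "P3 = {C\<in>polymers E. real (card (nbh C)) \<ge> d\<^sup>2 / 3}"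
  have fin: "finite (polymers E)"
    using finite_E by (intro finite_subset[of "polymers E" "Pow E"]) (auto simp: polymers_def)
  have "card C \<ge> 1" if "C \<in> polymers E" for C
    using that finite_subset[OF _ finite_E, of C] by (auto simp: polymers_def Suc_le_eq card_gt_0_iff)
  then have sub: "polymers E \<subseteq> P1 \<union> P2 \<union> P3"
    by (force simp: P1_def P2_def P3_def)
  have "P1 \<subseteq> (\<lambda>u. {u}) ` E"
    by (auto simp: P1_def polymers_def card_1_singleton_iff)
  then have P1: "(\<Sum>C\<in>P1. w q C) \<le> card E * ((1 + q) / 2) ^ d"
  proof -
    have "(\<Sum>C\<in>P1. w q C) \<le> (\<Sum>C\<in>(\<lambda>u. {u}) ` E. w q C)"
      using \<open>P1 \<subseteq> (\<lambda>u. {u}) ` E\<close> finite_E q w_nonneg by (intro sum_mono2) auto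
    also have "\<dots> = (\<Sum>u\<in>E. w q {u})"
      by (simp add: sum.reindex inj_on_def)
    also have "\<dots> = card E * ((1 + q) / 2) ^ d"
      by (simp add: w_singleton)
    finally show ?thesis .
  qed
  have d4: "d \<ge> 4" using ld by (simp add: large_dim_def)
  have "(\<Sum>C\<in>polymers E. w q C) \<le> (\<Sum>C\<in>P1 \<union> P2 \<union> P3. w q C)"
    using sub fin q w_nonneg by (intro sum_mono2) (auto simp: P1_def P2_def P3_def)
  also have "\<dots> \<le> (\<Sum>C\<in>P1. w q C) + (\<Sum>C\<in>P2. w q C) + (\<Sum>C\<in>P3. w q C)"
  proof -
    have "(\<Sum>C\<in>X \<union> Y. w q C) \<le> (\<Sum>C\<in>X. w q C) + (\<Sum>C\<in>Y. w q C)"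
      if "finite X" "finite Y" for X Y :: "'a set set"
      using that q w_nonneg[of q] sum_nonneg[of "X \<inter> Y" "w q"] by (simp add: sum_Un)
    from this[of "P1 \<union> P2" P3] this[of P1 P2] show ?thesis
      using fin by (simp add: P1_def P2_def P3_def)
  qed
  also have "(\<Sum>C\<in>P2. w q C) \<le> (\<Sum>C\<in>P2. w (1/3) C)"
    using q by (intro sum_mono w_mono) auto
  also have "(\<Sum>C\<in>P3. w q C) \<le> (\<Sum>C\<in>P3. w (1/3) C)"
    using q by (intro sum_mono w_mono) auto
  also note P1
  also note small_polymers_sum[OF d4 c1, folded P2_def]
  also note big_polymers_sum[OF ld c2, folded P3_def]
  finally have "(\<Sum>C\<in>polymers E. w q C) \<le> card E * ((1 + q) / 2) ^ d + polymer_error d"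
    by (simp add: polymer_error_def add.assoc)
  then show ?thesis
    by (intro order_trans[OF polymer_bound[OF order_refl q(1)]]) simp
qed

end

section \<open>Pairs of sets with large neighbourhoods\<close>

lemma sum_le_three_parts:
  fixes f :: "'a \<Rightarrow> real"
  assumes "S \<subseteq> X \<union> Y \<union> Z" "finite X" "finite Y" "finite Z" and nn: "\<And>x. f x \<ge> 0"
  shows "sum f S \<le> sum f X + sum f Y + sum f Z"
proof -
  have "sum f (X \<union> Y) \<le> sum f X + sum f Y" if "finite X" "finite Y" for X Y
    using that nn by (simp add: sum_Un sum_nonneg)
  from this[of "X \<union> Y" Z] this[of X Y] have "sum f (X \<union> Y \<union> Z) \<le> sum f X + sum f Y + sum f Z"
    using assms by simp
  moreover have "sum f S \<le> sum f (X \<union> Y \<union> Z)"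
    using assms by (intro sum_mono2) auto
  ultimately show ?thesis by simp
qed

text \<open>One summand per alternative: \<open>A\<close> has many low vertices or is far from
  closed; \<open>B\<close> contains many vertices of high degree into \<open>A\<close>;
  \<open>B\<close> is tiny. Here \<open>n\<close> is the size of one side.\<close>

definition balanced_error :: "nat \<Rightarrow> real" where
  "balanced_error D = (let n = 2 ^ D / 2; h = D powr (3/4) in
     2 * 8 ^ D * exp (n / D ^ 12) * 2 powr (- (n * D powr (-7/10) / 200))
     + 2 powr (2 * n / D) * 3 powr (- (h / 2 * (n / D))) * exp (n * 3 powr (- (h / 2)))
     + (2/3) powr (n / 2) * exp (n * (1/10)) * 10 powr ((1 / D + D powr (-7/10) + 4 * D powr (-1/10)) * n))"

context cube_like begin

definition edges_between :: "'a set \<Rightarrow> 'a set \<Rightarrow> nat" where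
  "edges_between A B = (\<Sum>v\<in>B. card (N v \<inter> A))"

lemma sum_edges_between:
  assumes "A \<subseteq> E"
  shows "(\<Sum>B\<in>Pow Od. q ^ edges_between A B) = 2 ^ card E * w q A"
proof -
  have "(\<Sum>B\<in>Pow Od. q ^ edges_between A B) = (\<Prod>v\<in>Od. 1 + q ^ card (N v \<inter> A))"
    unfolding edges_between_def power_sum by (rule sum_Pow_prod) (rule finite_Od)
  also have "\<dots> = 2 ^ card E * w q A"
    unfolding w_def prod_dividef using card_E card_Od by simp
  finally show ?thesis .
qed

text \<open>\<open>container_weight\<close> with the whole side \<open>Od\<close> as container, so
  that no neighbour is missed. The loss 2^(2n/d) is affordable next to the gain in
  \<open>many_high_sum\<close>, which will be 3 to a power of order n d^(-1/4).\<close>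

lemma total_weight:
  assumes ld: "large_dim d"
  shows "(\<Sum>A\<in>Pow E. w (1/3) A) \<le> 2 powr (2 * card E / d)"
proof -
  define h where "h = d powr (3/4)"
  define q where "q = (2::real) powr (- 1 / h)"
  have d16: "d \<ge> 16" using ld by (simp add: large_dim_def)
  then have h1: "h \<ge> 1" by (simp add: h_def ge_one_powr_ge_zero)
  have q13: "1/3 \<le> q" "q \<le> 1"
  proof -
    have "2 powr (-1) \<le> q" unfolding q_def using h1 by (intro powr_mono) auto
    moreover have "(2::real) powr (-1) = 1/2" by (simp add: powr_minus_divide)
    ultimately show "1/3 \<le> q" by linarith
    show "q \<le> 1" unfolding q_def using h1 powr_mono[of "- 1 / h" 0 2] by simp
  qed
  have Y: "(\<Sum>k\<le>d. real (d choose k) * (1 + q ^ k) ^ d) \<le> 2 ^ (d + 2)"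
    using ld by (intro hoelder_sum_bound[of d h]) (auto simp: large_dim_def h_def q_def)
  have "(\<Sum>A\<in>Pow E. w (1/3) A) \<le> (\<Sum>A\<in>Pow E. w q A)"
    using q13 by (intro sum_mono w_mono) auto
  also have "\<dots> \<le> 2 powr (real (card E) * (2 + 2 * 0) / d)"
  proof (rule container_weight[where F = Od])
    show "A \<subseteq> E \<and> (\<forall>u\<in>A. real (card (N u - Od)) \<le> 0)" if "A \<in> Pow E" for A
    proof -
      have "card (N u - Od) = 0" if "u \<in> A" for u
      proof -
        have "N u - Od = {}" using that \<open>A \<in> Pow E\<close> N_E by blast
        then show ?thesis by (simp only: card.empty)
      qed
      then show ?thesis using that by auto
    qed
  qed (use q13 Y card_E card_Od in auto)
  finally show ?thesis by (simp add: mult.commute)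
qed

lemma count_all_dominating:
  assumes "\<And>A. A \<in> \<A> \<Longrightarrow> A \<subseteq> E"
  shows "real (card {X. card X = m \<and> (\<exists>A\<in>\<A>. dominates X A)}) \<le> exp (card E / d ^ 12) * (real d ^ 12) ^ m"
proof -
  define y where "y = 1 / real d ^ 12"
  have y: "0 < y" "y \<le> 1" using d1 by (auto simp: y_def divide_le_eq_1)
  have "{X. card X = m \<and> (\<exists>A\<in>\<A>. dominates X A)} \<subseteq> {X. X \<subseteq> E \<and> real (card X) \<le> real m}"
    using assms by (auto simp: dominates_def)
  moreover have "finite {X. X \<subseteq> E \<and> real (card X) \<le> real m}"
    using finite_E by auto
  ultimately have "real (card {X. card X = m \<and> (\<exists>A\<in>\<A>. dominates X A)}) \<le> card {X. X \<subseteq> E \<and> real (card X) \<le> real m}"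
    by (intro of_nat_mono card_mono)
  also have "\<dots> \<le> (1 + y) ^ card E * y powr (- real m)"
    by (rule card_small_subsets[OF finite_E y])
  also have "\<dots> \<le> exp y ^ card E * (real d ^ 12) ^ m"
  proof (intro mult_mono power_mono)
    show "y powr (- real m) \<le> (real d ^ 12) ^ m"
      using y d1 by (simp add: powr_minus powr_realpow) (simp add: y_def power_one_over)
  qed (use y in auto)
  also have "exp y ^ card E = exp (card E / d ^ 12)"
    by (simp add: y_def exp_of_nat_mult[symmetric])
  finally show ?thesis .
qed

text \<open>Neighbourhoods of at least half the side turn the decay of \<open>family_sum\<close>
  into one in n d^(-7/10). Summing over the sizes \<open>g\<close> raises \<open>4 ^ d\<close> to
  \<open>8 ^ d\<close>.\<close>

lemma unclosed_sum:
  assumes ld: "large_dim d"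
  shows "(\<Sum>A\<in>{A. A \<subseteq> E \<and> card E \<le> 2 * card (nbh A) \<and>
            (real (card (low (d powr (3/4)) A)) > card (nbh A) * d powr (-7/10)
             \<or> real (card (clo (nbh A))) \<le> card (nbh A) - card (nbh A) * d powr (-6/10))}. w (1/3) A)
      \<le> 2 * 8 ^ d * exp (card E / d ^ 12) * 2 powr (- (card E * d powr (-7/10) / 200))" (is "sum _ ?S \<le> _")
proof -
  define K where "K = exp (card E / d ^ 12)"
  define \<A> where "\<A> g = {A. A \<subseteq> E \<and> A \<noteq> {} \<and> card (nbh A) = g}" for g
  define G where "G = {g. g \<le> card E \<and> card E \<le> 2 * g}"
  define R where "R = 2 * (K * 4 ^ d * 2 powr (- (card E * d powr (-7/10) / 200)))"
  have finA: "finite (\<A> g)" for g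
    using finite_E by (auto simp: \<A>_def)
  have cEpos: "card E > 0" by (simp add: card_E)
  have finG: "finite G" "card G \<le> 2 ^ d"
  proof -
    have sub: "G \<subseteq> {..2 ^ (d - 1)}" by (auto simp: G_def card_E)
    then show "finite G" using finite_subset by blast
    have "card G \<le> 2 ^ (d - 1) + 1"
      using card_mono[OF _ sub] by simp
    also have "\<dots> \<le> 2 ^ (d - 1) + 2 ^ (d - 1)" by simp
    also have "\<dots> = 2 ^ d" using d1 by (cases d) auto
    finally show "card G \<le> 2 ^ d" .
  qed
  have *: "(\<Sum>A\<in>{A\<in>?S. card (nbh A) = g}. w (1/3) A) \<le> R" if g: "g \<in> G" for g
  proof -
    define \<A>1 where "\<A>1 = {A\<in>\<A> g. real (card (low (d powr (3/4)) A)) > g * d powr (-7/10)}"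
    define \<A>2 where "\<A>2 = {A\<in>\<A> g. real (card (low (d powr (3/4)) A)) \<le> g * d powr (-7/10)
            \<and> real (card (clo (nbh A))) \<le> g - g * d powr (-6/10)}"
    have AA: "A \<subseteq> E \<and> A \<noteq> {} \<and> card (nbh A) = g" if "A \<in> \<A> g" for A
      using that by (auto simp: \<A>_def)
    have ne: "A \<noteq> {}" if "card E \<le> 2 * card (nbh A)" for A
      using that cEpos by (auto simp: nbh_def)
    have "{A\<in>?S. card (nbh A) = g} \<subseteq> \<A>1 \<union> \<A>2 \<union> {}"
      using ne by (auto simp: \<A>1_def \<A>2_def \<A>_def)
    then have "(\<Sum>A\<in>{A\<in>?S. card (nbh A) = g}. w (1/3) A) \<le> sum (w (1/3)) \<A>1 + sum (w (1/3)) \<A>2 + sum (w (1/3)) {}"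
      using finA w_nonneg by (intro sum_le_three_parts) (auto simp: \<A>1_def \<A>2_def)
    also have "\<dots> \<le> 2 * (K * 4 ^ d * 2 powr (- (g * d powr (-7/10) / 100)))"
    proof -
      have cnt: "real (card {X. card X = m \<and> (\<exists>A\<in>\<A> g. dominates X A)}) \<le> K * (real d ^ 12) ^ m" for m
        unfolding K_def by (rule count_all_dominating) (simp add: \<A>_def)
      have K: "K \<ge> 0" by (simp add: K_def)
      show ?thesis
        using family_sum[OF ld K AA cnt, folded \<A>1_def \<A>2_def] by simp
    qed
    also have "\<dots> \<le> R"
      unfolding R_def
    proof (intro mult_left_mono powr_mono)
      have "real (card E) \<le> real (2 * g)"
        using g by (intro of_nat_mono) (auto simp: G_def)
      then have "card E * d powr (-7/10) \<le> (2 * g) * d powr (-7/10)"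
        by (intro mult_right_mono) auto
      then show "- (g * d powr (-7/10) / 100) \<le> - (card E * d powr (-7/10) / 200)"
        by simp
    qed (auto simp: K_def)
    finally show ?thesis .
  qed
  have "sum (w (1/3)) ?S = (\<Sum>g\<in>G. \<Sum>A\<in>{A\<in>?S. card (nbh A) = g}. w (1/3) A)"
  proof (rule sum.group[symmetric])
    have "card (nbh A) \<le> card E" if "A \<subseteq> E" for A
      using card_mono[OF finite_Od nbh_subset[OF that]] card_E card_Od by simp
    then show "(\<lambda>A. card (nbh A)) ` ?S \<subseteq> G"
      by (auto simp: G_def)
  qed (use finite_E finG in auto)
  also have "\<dots> \<le> (\<Sum>g\<in>G. R)"
    by (rule sum_mono) (rule *)
  also have "\<dots> = card G * R" by simp
  also have "\<dots> \<le> 2 ^ d * R"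
    using of_nat_mono[OF finG(2), where 'a = real] by (intro mult_right_mono) (auto simp: R_def K_def)
  also have "\<dots> = 2 * (2 * 4) ^ d * K * 2 powr (- (card E * d powr (-7/10) / 200))"
    unfolding power_mult_distrib by (simp add: R_def)
  finally show ?thesis by (simp add: K_def)
qed

text \<open>Tilting by \<open>s = 3 powr (h / 2)\<close> for each vertex of \<open>B\<close> of high
  degree. Such a vertex carries a factor of at most \<open>3 powr (- h)\<close>, so even the tilted
  sum exceeds the plain one by at most \<open>1 + 3 powr (- (h / 2))\<close> per vertex.\<close>

lemma many_high_sum:
  fixes h r :: real
  assumes A: "A \<subseteq> E" and h: "h \<ge> 0"
  shows "(\<Sum>B\<in>{B. B \<subseteq> Od \<and> real (card (B \<inter> (nbh A - low h A))) \<ge> r}. (1/3) ^ edges_between A B)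
     \<le> 2 ^ card E * w (1/3) A * 3 powr (- (h / 2 * r)) * exp (card E * 3 powr (- (h / 2)))"
proof -
  define H where "H = nbh A - low h A"
  define s where "s = (3::real) powr (h / 2)"
  define \<theta> where "\<theta> v = (1/3::real) ^ card (N v \<inter> A)" for v
  have s: "s > 0" "s \<ge> 1" using h by (auto simp: s_def ge_one_powr_ge_zero)
  have H: "H \<subseteq> Od" using nbh_subset[OF A] by (auto simp: H_def)
  have card_filter: "(\<Prod>v\<in>B. if v \<in> H then s else 1) = s ^ card (B \<inter> H)" if "B \<subseteq> Od" for B
    using finite_subset[OF that finite_Od] by (simp add: prod.If_cases)
  have "(\<Sum>B\<in>{B. B \<subseteq> Od \<and> real (card (B \<inter> H)) \<ge> r}. (1/3) ^ edges_between A B)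
      \<le> (\<Sum>B\<in>{B. B \<subseteq> Od \<and> real (card (B \<inter> H)) \<ge> r}. s powr (- r) * (\<Prod>v\<in>B. (if v \<in> H then s else 1) * \<theta> v))"
  proof (rule sum_mono)
    fix B assume B: "B \<in> {B. B \<subseteq> Od \<and> real (card (B \<inter> H)) \<ge> r}"
    have "1 \<le> s powr (card (B \<inter> H) - r)"
      using B s by (auto intro: ge_one_powr_ge_zero)
    also have "\<dots> = s powr (- r) * s ^ card (B \<inter> H)"
      using s by (simp add: powr_diff powr_minus powr_realpow field_simps)
    finally have "1 * (1/3) ^ edges_between A B \<le> s powr (- r) * s ^ card (B \<inter> H) * (1/3) ^ edges_between A B"
      by (intro mult_right_mono) auto
    then show "(1/3) ^ edges_between A B \<le> s powr (- r) * (\<Prod>v\<in>B. (if v \<in> H then s else 1) * \<theta> v)"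
      using B card_filter[of B] by (simp add: prod.distrib \<theta>_def edges_between_def power_sum mult_ac)
  qed
  also have "\<dots> \<le> (\<Sum>B\<in>Pow Od. s powr (- r) * (\<Prod>v\<in>B. (if v \<in> H then s else 1) * \<theta> v))"
    using finite_Od s by (intro sum_mono2) (auto simp: \<theta>_def intro!: mult_nonneg_nonneg prod_nonneg)
  also have "\<dots> = s powr (- r) * (\<Prod>v\<in>Od. 1 + (if v \<in> H then s else 1) * \<theta> v)"
    unfolding sum_distrib_left[symmetric] by (simp only: sum_Pow_prod[OF finite_Od])
  also have "\<dots> \<le> s powr (- r) * (\<Prod>v\<in>Od. (1 + \<theta> v) * (1 + 3 powr (- (h / 2))))"
  proof (intro mult_left_mono prod_mono conjI)
    fix v assume v: "v \<in> Od"
    have \<theta>: "\<theta> v \<ge> 0" by (simp add: \<theta>_def)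
    show "1 + (if v \<in> H then s else 1) * \<theta> v \<le> (1 + \<theta> v) * (1 + 3 powr (- (h / 2)))"
    proof (cases "v \<in> H")
      case True
      then have "real (card (N v \<inter> A)) \<ge> h"
        by (auto simp: H_def low_def)
      then have "(1/3::real) powr (card (N v \<inter> A)) \<le> (1/3) powr h"
        by (intro powr_mono') auto
      then have "\<theta> v \<le> 3 powr (- h)"
        by (simp only: \<theta>_def powr_realpow[of "1/3"] zero_less_divide_1_iff zero_less_numeral)
          (simp add: powr_divide powr_minus_divide)
      then have "s * \<theta> v \<le> s * 3 powr (- h)"
        using s by (intro mult_left_mono) auto
      also have "\<dots> = 3 powr (- (h / 2))"
        by (simp add: s_def powr_add[symmetric])
      finally have "1 + s * \<theta> v \<le> 1 * (1 + 3 powr (- (h / 2)))" by simp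
      also have "\<dots> \<le> (1 + \<theta> v) * (1 + 3 powr (- (h / 2)))"
        using \<theta> by (intro mult_right_mono) auto
      finally show ?thesis using True by simp
    next
      case False
      then show ?thesis using \<theta> by (simp add: algebra_simps)
    qed
    show "0 \<le> 1 + (if v \<in> H then s else 1) * \<theta> v"
      using \<theta> s by simp
  qed auto
  also have "\<dots> = s powr (- r) * (2 ^ card E * w (1/3) A) * (1 + 3 powr (- (h / 2))) ^ card E"
    unfolding prod.distrib \<theta>_def w_def prod_dividef using card_E card_Od by simp
  also have "\<dots> \<le> s powr (- r) * (2 ^ card E * w (1/3) A) * exp (3 powr (- (h / 2))) ^ card E"
    using w_nonneg by (intro mult_left_mono power_mono) auto
  also have "\<dots> = 2 ^ card E * w (1/3) A * 3 powr (- (h / 2 * r)) * exp (card E * 3 powr (- (h / 2)))"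
    by (simp add: s_def powr_powr exp_of_nat_mult)
  finally show ?thesis by (simp add: H_def)
qed

text \<open>Each set has weight at most (2/3)^(n/2). The tilt 1/10 is chosen so that its cost
  exp(n/10) does not use up this decay; the remaining power of 10 is harmless when
  \<open>\<rho>\<close> is small.\<close>

lemma small_set_sum:
  fixes \<rho> :: real
  shows "(\<Sum>A\<in>{A. A \<subseteq> E \<and> real (card A) \<le> \<rho> * card E \<and> card E \<le> 2 * card (nbh A)}. w (1/3) A)
     \<le> (2/3) powr (card E / 2) * exp (card E * (1/10)) * 10 powr (\<rho> * card E)" (is "sum _ ?S \<le> _")
proof -
  have "sum (w (1/3)) ?S \<le> (\<Sum>A\<in>?S. (2/3) powr (card E / 2))"
  proof (rule sum_mono)
    fix A assume A: "A \<in> ?S"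
    have "real (card E) \<le> real (2 * card (nbh A))"
      using A by (intro of_nat_mono) auto
    then have le: "card E / 2 \<le> real (card (nbh A))" by simp
    have "w (1/3) A \<le> (2/3) ^ card (nbh A)"
      using A by (intro w_le_power) auto
    also have "\<dots> = (2/3) powr card (nbh A)"
      by (simp add: powr_realpow)
    also have "\<dots> \<le> (2/3) powr (card E / 2)"
      using le by (intro powr_mono') auto
    finally show "w (1/3) A \<le> (2/3) powr (card E / 2)" .
  qed
  also have "\<dots> = (2/3) powr (card E / 2) * card ?S"
    by simp
  also have "\<dots> \<le> (2/3) powr (card E / 2) * (exp (card E * (1/10)) * 10 powr (\<rho> * card E))"
  proof (rule mult_left_mono)
    have "real (card ?S) \<le> card {A. A \<subseteq> E \<and> real (card A) \<le> \<rho> * card E}"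
      using finite_E by (intro of_nat_mono card_mono) auto
    also have "\<dots> \<le> (1 + 1/10) ^ card E * (1/10) powr (- (\<rho> * card E))"
      by (rule card_small_subsets[OF finite_E]) auto
    also have "\<dots> \<le> exp (1/10) ^ card E * 10 powr (\<rho> * card E)"
    proof (intro mult_mono power_mono)
      show "1 + 1/10 \<le> exp (1/10::real)" by (rule exp_ge_add_one_self)
    qed (auto simp: powr_minus powr_divide)
    also have "exp (1/10) ^ card E = exp (card E * (1/10))"
      by (simp only: exp_of_nat_mult)
    finally show "real (card ?S) \<le> exp (card E * (1/10)) * 10 powr (\<rho> * card E)" .
  qed auto
  finally show ?thesis by (simp add: mult.assoc)
qed

text \<open>Isoperimetry read backwards: a closure almost as large as its neighbourhood barely
  expands, so its density is close to 1. The exponent -1/10 is 1/2 - 6/10.\<close>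

lemma closure_large:
  assumes A: "A \<subseteq> E" "card E \<le> 2 * card (nbh A)"
    and cl: "real (card (clo (nbh A))) > card (nbh A) - card (nbh A) * d powr (-6/10)"
    and c: "d powr (-6/10) \<le> 1/2"
  shows "card E - real (card (nbh A)) \<le> 4 * d powr (-1/10) * card E"
proof -
  define C where "C = clo (nbh A)"
  define a where "a = real (card C)"
  define g where "g = real (card (nbh A))"
  define n where "n = real (card E)"
  have C: "C \<subseteq> E" "nbh C = nbh A"
    using A(1) by (auto simp: C_def clo_def nbh_def)
  have ag: "a \<le> g"
    using card_le_nbh[OF C(1)] C(2) by (simp add: a_def g_def)
  have n0: "n > 0" by (simp add: n_def card_E)
  have gn: "n \<le> 2 * g"
  proof -
    have "real (card E) \<le> real (2 * card (nbh A))" using A(2) by (rule of_nat_mono)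
    then show ?thesis by (simp add: n_def g_def)
  qed
  have gn2: "g \<le> n"
    using card_mono[OF finite_Od nbh_subset[OF A(1)]] card_E card_Od by (simp add: g_def n_def)
  have iso: "g \<ge> a + a * (1 - a / n) / sqrt d"
    using iso_E[OF C(1)] C(2) by (simp add: nbh_def a_def g_def n_def card_E)
  have ac: "a > g - g * d powr (-6/10)"
    using cl by (simp add: a_def g_def C_def)
  have "g * d powr (-6/10) \<le> g * (1/2)"
    using c by (intro mult_left_mono) (auto simp: g_def)
  then have a4: "a \<ge> n / 4" using ac gn by linarith
  have "n / 4 * (1 - a / n) \<le> a * (1 - a / n)"
    using a4 ag gn2 n0 by (intro mult_right_mono) (auto simp: divide_le_eq)
  also have "\<dots> = (a * (1 - a / n) / sqrt d) * sqrt d"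
    using d1 by simp
  also have "\<dots> \<le> (n * d powr (-6/10)) * sqrt d"
  proof (rule mult_right_mono)
    have "g * d powr (-6/10) \<le> n * d powr (-6/10)"
      using gn2 by (intro mult_right_mono) auto
    then show "a * (1 - a / n) / sqrt d \<le> n * d powr (-6/10)"
      using iso ac by linarith
  qed auto
  also have "\<dots> = n * d powr (-1/10)"
    using d1 by (simp add: powr_half_sqrt[symmetric] powr_add[symmetric])
  finally have "n / 4 - a / 4 \<le> n * d powr (-1/10)"
    using n0 by (simp add: right_diff_distrib)
  then have "n - a \<le> 4 * d powr (-1/10) * n"
    by (simp add: mult.commute)
  then show ?thesis using ag by (simp add: n_def g_def)
qed

text \<open>Typically \<open>A\<close> is almost as large as its neighbourhood up to closure, hence by isoperimetry the
  neighbourhood is almost everything; then \<open>B\<close> is tiny, which is unlikely for a set with a large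
  neighbourhood.\<close>
lemma balanced_pairs_sum:
  assumes ld: "large_dim d" and c: "d powr (-6/10) \<le> 1/2"
  shows "(\<Sum>(A, B)\<in>{(A, B). A \<subseteq> E \<and> B \<subseteq> Od \<and> card E \<le> 2 * card (nbh A) \<and> card E \<le> 2 * card (nbh B)}.
      (1/3) ^ edges_between A B) \<le> 2 ^ card E * balanced_error d" (is "sum _ ?S \<le> _")
proof -
  interpret dual: cube_like d Od E N by (rule dual)
  define n where "n = real (card E)"
  define h where "h = d powr (3/4)"
  define \<rho> where "\<rho> = 1 / d + d powr (-7/10) + 4 * d powr (-1/10)"
  define f where "f = (\<lambda>(A, B). (1/3::real) ^ edges_between A B)"
  define \<A> where "\<A> = {A. A \<subseteq> E \<and> card E \<le> 2 * card (nbh A) \<and>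
            (real (card (low h A)) > card (nbh A) * d powr (-7/10)
             \<or> real (card (clo (nbh A))) \<le> card (nbh A) - card (nbh A) * d powr (-6/10))}"
  define Q where "Q A = {B. B \<subseteq> Od \<and> real (card (B \<inter> (nbh A - low h A))) \<ge> n / d}" for A
  define \<B> where "\<B> = {B. B \<subseteq> Od \<and> real (card B) \<le> \<rho> * card Od \<and> card Od \<le> 2 * card (nbh B)}"
  have cc: "card Od = card E" by (simp add: card_E card_Od)
  have nD: "n = 2 ^ d / 2" using d1 by (cases d) (auto simp: n_def card_E)
  have "?S \<subseteq> (\<A> \<times> Pow Od) \<union> (SIGMA A:Pow E. Q A) \<union> (Pow E \<times> \<B>)"
  proof (rule subsetI, rule ccontr)
    fix x
    assume x: "x \<in> ?S" and nx: "x \<notin> (\<A> \<times> Pow Od) \<union> (SIGMA A:Pow E. Q A) \<union> (Pow E \<times> \<B>)"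
    obtain A B where AB: "A \<subseteq> E" "B \<subseteq> Od" "card E \<le> 2 * card (nbh A)" "card E \<le> 2 * card (nbh B)"
        and xAB: "x = (A, B)"
      using x by auto
    have n1: "(A, B) \<notin> \<A> \<times> Pow Od" and n2: "(A, B) \<notin> (SIGMA A:Pow E. Q A)" and n3: "(A, B) \<notin> Pow E \<times> \<B>"
      using nx by (auto simp: xAB)
    show False
    proof -
      have A: "real (card (low h A)) \<le> card (nbh A) * d powr (-7/10)"
          "real (card (clo (nbh A))) > card (nbh A) - card (nbh A) * d powr (-6/10)"
        using AB n1 by (auto simp: \<A>_def)
      have finB: "finite B" using AB finite_Od finite_subset by blast
      have gn: "card (nbh A) \<le> card E"
        using card_mono[OF finite_Od nbh_subset[OF AB(1)]] cc by simp
      have low: "finite (low h A)" "low h A \<subseteq> nbh A"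
        using finite_nbh[OF AB(1)] by (auto simp: low_def)
      \<comment> \<open>The first two alternatives being excluded, the three pieces are bounded by n
        / d, by the number of low vertices, and by \<open>closure_large\<close>; their sum defines
        \<open>\<rho>\<close>.\<close>
      have "B \<subseteq> (B \<inter> (nbh A - low h A)) \<union> low h A \<union> (Od - nbh A)"
        using AB by auto
      then have "card B \<le> card ((B \<inter> (nbh A - low h A)) \<union> low h A \<union> (Od - nbh A))"
        using finB low finite_Od by (intro card_mono) auto
      also have "\<dots> \<le> card (B \<inter> (nbh A - low h A)) + card (low h A) + card (Od - nbh A)"
        by (meson add_le_mono card_Un_le le_refl le_trans)
      finally have "real (card B) \<le> real (card (B \<inter> (nbh A - low h A)) + card (low h A) + card (Od - nbh A))"
        by (rule of_nat_mono)
      moreover have "real (card (Od - nbh A)) = card E - real (card (nbh A))"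
        using nbh_subset[OF AB(1)] finite_nbh[OF AB(1)] gn cc by (simp add: card_Diff_subset of_nat_diff)
      moreover have "card E - real (card (nbh A)) \<le> 4 * d powr (-1/10) * n"
        using closure_large[OF AB(1,3) A(2) c] by (simp add: n_def)
      moreover have "real (card (low h A)) \<le> d powr (-7/10) * n"
      proof -
        have "card (nbh A) * d powr (-7/10) \<le> n * d powr (-7/10)"
          using gn by (intro mult_right_mono) (auto simp: n_def)
        then show ?thesis using A(1) by (simp add: mult.commute)
      qed
      moreover have "real (card (B \<inter> (nbh A - low h A))) \<le> 1 / d * n"
        using n2 AB by (auto simp: Q_def)
      ultimately have "real (card B) \<le> \<rho> * n"
        unfolding \<rho>_def distrib_right by linarith
      then have "B \<in> \<B>"
        using AB cc by (simp add: \<B>_def n_def)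
      then show False using n3 AB by simp
    qed
  qed
  moreover have "finite (\<A> \<times> Pow Od)" "finite (Pow E \<times> \<B>)"
    using finite_E finite_Od by (auto simp: \<A>_def \<B>_def)
  moreover have "finite (SIGMA A:Pow E. Q A)"
    using finite_E finite_Od by (intro finite_SigmaI) (auto simp: Q_def)
  moreover have "f x \<ge> 0" for x
    by (auto simp: f_def split: prod.splits)
  ultimately have "sum f ?S \<le> sum f (\<A> \<times> Pow Od) + sum f (SIGMA A:Pow E. Q A) + sum f (Pow E \<times> \<B>)"
    by (intro sum_le_three_parts)
  also have "sum f (\<A> \<times> Pow Od) = (\<Sum>A\<in>\<A>. \<Sum>B\<in>Pow Od. (1/3) ^ edges_between A B)"
    by (simp add: f_def sum.cartesian_product)
  also have "\<dots> = (\<Sum>A\<in>\<A>. 2 ^ card E * w (1/3) A)"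
    by (intro sum.cong refl sum_edges_between) (simp add: \<A>_def)
  also have "\<dots> = 2 ^ card E * sum (w (1/3)) \<A>"
    by (simp add: sum_distrib_left)
  also have "sum (w (1/3)) \<A> \<le> 2 * 8 ^ d * exp (n / d ^ 12) * 2 powr (- (n * d powr (-7/10) / 200))"
    using unclosed_sum[OF ld] by (simp add: \<A>_def h_def n_def)
  also have "sum f (SIGMA A:Pow E. Q A) = (\<Sum>A\<in>Pow E. \<Sum>B\<in>Q A. (1/3) ^ edges_between A B)"
    using finite_E finite_Od unfolding f_def by (intro sum.Sigma[symmetric]) (auto simp: Q_def)
  also have "\<dots> \<le> (\<Sum>A\<in>Pow E. 2 ^ card E * w (1/3) A * 3 powr (- (h / 2 * (n / d))) * exp (n * 3 powr (- (h / 2))))"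
    unfolding Q_def n_def by (intro sum_mono many_high_sum) (auto simp: h_def)
  also have "\<dots> = 2 ^ card E * (sum (w (1/3)) (Pow E) * 3 powr (- (h / 2 * (n / d))) * exp (n * 3 powr (- (h / 2))))"
    by (simp add: sum_distrib_left sum_distrib_right mult_ac)
  also have "sum (w (1/3)) (Pow E) \<le> 2 powr (2 * n / d)"
    using total_weight[OF ld] by (simp add: n_def)
  also have "sum f (Pow E \<times> \<B>) = (\<Sum>A\<in>Pow E. \<Sum>B\<in>\<B>. (1/3) ^ edges_between A B)"
    by (simp add: f_def sum.cartesian_product)
  \<comment> \<open>For tiny \<open>B\<close> the roles are exchanged: summing over \<open>A\<close>
    first leaves the weight of \<open>B\<close> in the dual graph.\<close>
  also have "\<dots> = (\<Sum>B\<in>\<B>. \<Sum>A\<in>Pow E. (1/3) ^ edges_between A B)"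
    by (rule sum.swap)
  also have "\<dots> = (\<Sum>B\<in>\<B>. \<Sum>A\<in>Pow E. (1/3) ^ dual.edges_between B A)"
    unfolding edges_between_def dual.edges_between_def
    by (intro sum.cong refl arg_cong2[where f = power] sum_degree_swap) (auto simp: \<B>_def)
  also have "\<dots> = (\<Sum>B\<in>\<B>. 2 ^ card E * dual.w (1/3) B)"
    unfolding cc[symmetric] by (intro sum.cong refl dual.sum_edges_between) (auto simp: \<B>_def)
  also have "\<dots> = 2 ^ card E * sum (dual.w (1/3)) \<B>"
    by (simp add: sum_distrib_left)
  also have "sum (dual.w (1/3)) \<B> \<le> (2/3) powr (n / 2) * exp (n * (1/10)) * 10 powr (\<rho> * n)"
    using dual.small_set_sum[of \<rho>] unfolding \<B>_def n_def cc by simp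
  finally have "sum f ?S \<le> 2 ^ card E * (2 * 8 ^ d * exp (n / d ^ 12) * 2 powr (- (n * d powr (-7/10) / 200)))
      + 2 ^ card E * (2 powr (2 * n / d) * 3 powr (- (h / 2 * (n / d))) * exp (n * 3 powr (- (h / 2))))
      + 2 ^ card E * ((2/3) powr (n / 2) * exp (n * (1/10)) * 10 powr (\<rho> * n))"
    by simp
  then show ?thesis
    by (simp add: f_def balanced_error_def Let_def nD[symmetric] h_def \<rho>_def distrib_left)
qed

end

section \<open>First and second moments\<close>

lemma sum_Pow_prod_bool:
  fixes f :: "'a \<Rightarrow> bool \<Rightarrow> 'b :: comm_semiring_1"
  assumes "finite S"
  shows "(\<Sum>B\<in>Pow S. \<Prod>v\<in>S. f v (v \<in> B)) = (\<Prod>v\<in>S. f v False + f v True)"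
  using assms
proof (induction S rule: finite_induct)
  case (insert u S)
  have 1: "(\<Prod>v\<in>insert u S. f v (v \<in> B)) = f u False * (\<Prod>v\<in>S. f v (v \<in> B))" if "B \<in> Pow S" for B
  proof -
    have "u \<notin> B" using that insert(2) by auto
    then show ?thesis using insert(1,2) by simp
  qed
  have 2: "(\<Prod>v\<in>insert u S. f v (v \<in> insert u B)) = f u True * (\<Prod>v\<in>S. f v (v \<in> B))" if "B \<in> Pow S" for B
  proof -
    have "(\<Prod>v\<in>S. f v (v \<in> insert u B)) = (\<Prod>v\<in>S. f v (v \<in> B))"
    proof (rule prod.cong[OF refl])
      fix x assume "x \<in> S"
      then have "x \<noteq> u" using insert(2) by auto
      then show "f x (x \<in> insert u B) = f x (x \<in> B)" by simp
    qed
    then show ?thesis using insert(1,2) by simp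
  qed
  have "(\<Sum>B\<in>Pow (insert u S). \<Prod>v\<in>insert u S. f v (v \<in> B))
      = (\<Sum>B\<in>Pow S. f u False * (\<Prod>v\<in>S. f v (v \<in> B))) + (\<Sum>B\<in>Pow S. f u True * (\<Prod>v\<in>S. f v (v \<in> B)))"
    unfolding sum_Pow_insert[OF insert(1,2)] using 1 2 by (intro arg_cong2[where f = plus] sum.cong) auto
  also have "\<dots> = (f u False + f u True) * (\<Prod>v\<in>S. f v False + f v True)"
    by (simp add: sum_distrib_left[symmetric] insert.IH distrib_right)
  finally show ?case
    using insert(1,2) by simp
qed simp

lemma sum_UN_le:
  fixes f :: "'a \<Rightarrow> real"
  assumes "finite I" "\<And>i. i \<in> I \<Longrightarrow> finite (F i)" "\<And>x. f x \<ge> 0"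
  shows "sum f (\<Union>i\<in>I. F i) \<le> (\<Sum>i\<in>I. sum f (F i))"
  using assms(1,2)
proof (induction I rule: finite_induct)
  case (insert i I)
  have "sum f (F i \<union> (\<Union>i\<in>I. F i)) \<le> sum f (F i) + sum f (\<Union>i\<in>I. F i)"
    using insert.prems insert(1) assms(3) by (simp add: sum_Un sum_nonneg)
  then show ?case
    using insert by fastforce
qed simp

context cube_like begin

text \<open>The edges themselves and not only their number, because the second moment depends on the
  union of the edges of two configurations.\<close>

definition pairs :: "'a set \<Rightarrow> 'a set \<Rightarrow> ('a \<times> 'a) set" where
  "pairs A B = {(u, v). u \<in> A \<and> v \<in> B \<and> v \<in> N u}"

text \<open>Each vertex of the other side then has at most one neighbour in \<open>A\<close>, which
  makes the weights exact powers.\<close>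

definition good :: "'a set \<Rightarrow> bool" where
  "good A \<longleftrightarrow> (\<forall>u\<in>A. \<forall>u'\<in>A. u \<noteq> u' \<longrightarrow> N u \<inter> N u' = {})"

lemma finite_pairs: "A \<subseteq> E \<Longrightarrow> B \<subseteq> Od \<Longrightarrow> finite (pairs A B)"
  using finite_E finite_Od by (intro finite_subset[of "pairs A B" "E \<times> Od"]) (auto simp: pairs_def)

lemma card_pairs_subset:
  assumes "T \<subseteq> pairs E Od"
  shows "card T = (\<Sum>v\<in>Od. card {u. (u, v) \<in> T})"
proof -
  have finT: "finite T"
    using assms finite_pairs[of E Od] finite_subset by blast
  have "card T = (\<Sum>v\<in>Od. card {p\<in>T. snd p = v})"
  proof -
    have "snd ` T \<subseteq> Od"
      using assms by (auto simp: pairs_def)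
    then show ?thesis
      using sum.group[OF finT finite_Od, of snd "\<lambda>_. 1::nat"] by simp
  qed
  also have "\<dots> = (\<Sum>v\<in>Od. card {u. (u, v) \<in> T})"
  proof (intro sum.cong refl)
    fix v
    have "{p\<in>T. snd p = v} = (\<lambda>u. (u, v)) ` {u. (u, v) \<in> T}"
      by auto
    then show "card {p\<in>T. snd p = v} = card {u. (u, v) \<in> T}"
      by (simp add: card_image inj_on_def)
  qed
  finally show ?thesis .
qed

lemma card_pairs:
  assumes "A \<subseteq> E" "B \<subseteq> Od"
  shows "card (pairs A B) = edges_between A B"
proof -
  have "card (pairs A B) = (\<Sum>v\<in>Od. card {u. (u, v) \<in> pairs A B})"
    using assms by (intro card_pairs_subset) (auto simp: pairs_def)
  also have "\<dots> = (\<Sum>v\<in>Od. if v \<in> B then card (N v \<inter> A) else 0)"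
  proof (intro sum.cong refl)
    fix v assume v: "v \<in> Od"
    have "{u. (u, v) \<in> pairs A B} = (if v \<in> B then N v \<inter> A else {})"
      using v assms N_sym by (auto simp: pairs_def)
    then show "card {u. (u, v) \<in> pairs A B} = (if v \<in> B then card (N v \<inter> A) else 0)"
      by auto
  qed
  also have "\<dots> = edges_between A B"
    using assms finite_Od by (simp add: edges_between_def sum.If_cases Int_absorb1)
  finally show ?thesis .
qed

text \<open>Either one part has a small neighbourhood, and summing over the other part exactly
  yields a weight \<open>w\<close>, or \<open>balanced_pairs_sum\<close> applies. The two choices of
  the small part give the factor 2.\<close>

lemma first_moment_le:
  assumes ld: "large_dim d" and q: "0 \<le> q" "q \<le> 1/3"
    and c1: "real d ^ 4 * (2/3) powr (d / 3) \<le> 1"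
    and c2: "1 \<le> (1 + 1 / (2 * sqrt d)) * (1 - d powr (-6/10))"
    and c3: "d powr (-6/10) \<le> 1/2"
  shows "(\<Sum>(A, B)\<in>Pow E \<times> Pow Od. q ^ card (pairs A B))
     \<le> 2 ^ card E * (2 * exp (card E * ((1 + q) / 2) ^ d + polymer_error d) + balanced_error d)"
proof -
  interpret dual: cube_like d Od E N by (rule dual)
  define f where "f = (\<lambda>(A, B). q ^ card (pairs A B))"
  define \<D> where "\<D> = {A. A \<subseteq> E \<and> 2 * card (nbh A) < card E}"
  define \<D>' where "\<D>' = {B. B \<subseteq> Od \<and> 2 * card (nbh B) < card Od}"
  define \<S> where "\<S> = {(A, B). A \<subseteq> E \<and> B \<subseteq> Od \<and> card E \<le> 2 * card (nbh A) \<and> card E \<le> 2 * card (nbh B)}"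
  have cc: "card Od = card E" by (simp add: card_E card_Od)
  have "Pow E \<times> Pow Od \<subseteq> \<D> \<times> Pow Od \<union> Pow E \<times> \<D>' \<union> \<S>"
    by (auto simp: \<D>_def \<D>'_def \<S>_def cc)
  moreover have "finite (\<D> \<times> Pow Od)" "finite (Pow E \<times> \<D>')"
    using finite_E finite_Od by (auto simp: \<D>_def \<D>'_def)
  moreover have "finite \<S>"
    using finite_E finite_Od by (intro finite_subset[of \<S> "Pow E \<times> Pow Od"]) (auto simp: \<S>_def)
  moreover have "f x \<ge> 0" for x
    using q by (auto simp: f_def split: prod.splits)
  ultimately have "sum f (Pow E \<times> Pow Od) \<le> sum f (\<D> \<times> Pow Od) + sum f (Pow E \<times> \<D>') + sum f \<S>"
    by (intro sum_le_three_parts)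
  also have "sum f (\<D> \<times> Pow Od) = (\<Sum>A\<in>\<D>. \<Sum>B\<in>Pow Od. q ^ edges_between A B)"
    unfolding f_def by (subst sum.cartesian_product[symmetric]) (auto simp: \<D>_def card_pairs intro!: sum.cong)
  also have "\<dots> = (\<Sum>A\<in>\<D>. 2 ^ card E * w q A)"
    by (intro sum.cong refl sum_edges_between) (simp add: \<D>_def)
  also have "\<dots> = 2 ^ card E * sum (w q) \<D>"
    by (simp add: sum_distrib_left)
  also have "sum (w q) \<D> \<le> exp (card E * ((1 + q) / 2) ^ d + polymer_error d)"
    unfolding \<D>_def by (rule small_neighbourhood_sum[OF ld q c1 c2])
  also have "sum f (Pow E \<times> \<D>') = (\<Sum>A\<in>Pow E. \<Sum>B\<in>\<D>'. q ^ edges_between A B)"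
    unfolding f_def by (subst sum.cartesian_product[symmetric]) (auto simp: \<D>'_def card_pairs intro!: sum.cong)
  also have "\<dots> = (\<Sum>B\<in>\<D>'. \<Sum>A\<in>Pow E. q ^ edges_between A B)"
    by (rule sum.swap)
  also have "\<dots> = (\<Sum>B\<in>\<D>'. \<Sum>A\<in>Pow E. q ^ dual.edges_between B A)"
    unfolding edges_between_def dual.edges_between_def
    by (intro sum.cong refl arg_cong2[where f = power] sum_degree_swap) (auto simp: \<D>'_def)
  also have "\<dots> = (\<Sum>B\<in>\<D>'. 2 ^ card E * dual.w q B)"
    unfolding cc[symmetric] by (intro sum.cong refl dual.sum_edges_between) (auto simp: \<D>'_def)
  also have "\<dots> = 2 ^ card E * sum (dual.w q) \<D>'"
    by (simp add: sum_distrib_left)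
  also have "sum (dual.w q) \<D>' \<le> exp (card E * ((1 + q) / 2) ^ d + polymer_error d)"
    using dual.small_neighbourhood_sum[OF ld q c1 c2] unfolding \<D>'_def cc .
  also have "sum f \<S> \<le> 2 ^ card E * balanced_error d"
  proof -
    have "sum f \<S> \<le> (\<Sum>(A, B)\<in>\<S>. (1/3) ^ edges_between A B)"
      unfolding f_def
    proof (intro sum_mono)
      fix x assume "x \<in> \<S>"
      then obtain A B where x: "x = (A, B)" "A \<subseteq> E" "B \<subseteq> Od" by (auto simp: \<S>_def)
      have "q ^ edges_between A B \<le> (1/3) ^ edges_between A B"
        using q by (intro power_mono) auto
      then show "(case x of (A, B) \<Rightarrow> q ^ card (pairs A B)) \<le> (case x of (A, B) \<Rightarrow> (1/3) ^ edges_between A B)"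
        using x by (simp add: card_pairs)
    qed
    also have "\<dots> \<le> 2 ^ card E * balanced_error d"
      unfolding \<S>_def by (rule balanced_pairs_sum[OF ld c3])
    finally show ?thesis .
  qed
  finally show ?thesis
    by (simp add: f_def algebra_simps)
qed

section \<open>Moments of sets with disjoint neighbourhoods\<close>

lemma good_degree_le_one:
  assumes "A \<subseteq> E" "good A" "v \<in> Od"
  shows "card (N v \<inter> A) \<le> 1"
proof -
  have "x = y" if "x \<in> N v \<inter> A" "y \<in> N v \<inter> A" for x y
  proof (rule ccontr)
    assume "x \<noteq> y"
    then have "N x \<inter> N y = {}"
      using that assms(2) by (auto simp: good_def)
    moreover have "v \<in> N x" "v \<in> N y"
      using that assms N_sym by blast+
    ultimately show False by auto
  qed
  then show ?thesis
    using finite_N(1)[OF assms(3)] card_le_Suc0_iff_eq[of "N v \<inter> A"] by auto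
qed

lemma w_good:
  assumes "A \<subseteq> E" "good A"
  shows "w q A = (((1 + q) / 2) ^ d) ^ card A"
proof -
  have "w q A = (\<Prod>v\<in>Od. ((1 + q) / 2) ^ card (N v \<inter> A))"
    unfolding w_def
  proof (intro prod.cong refl)
    fix v assume "v \<in> Od"
    then have "card (N v \<inter> A) \<le> 1"
      using assms by (intro good_degree_le_one)
    then have "card (N v \<inter> A) = 0 \<or> card (N v \<inter> A) = 1" by linarith
    then show "(1 + q ^ card (N v \<inter> A)) / 2 = ((1 + q) / 2) ^ card (N v \<inter> A)"
      by (elim disjE) simp_all
  qed
  also have "\<dots> = ((1 + q) / 2) ^ (d * card A)"
    by (simp add: power_sum[symmetric] sum_degree[OF assms(1)])
  finally show ?thesis by (simp add: power_mult)
qed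

text \<open>Union bound over the pairs of vertices with a common neighbour.\<close>
lemma good_sum_ge:
  fixes x :: real
  assumes x: "x \<ge> 0"
  shows "(\<Sum>A\<in>{A. A \<subseteq> E \<and> good A}. x ^ card A) \<ge> (1 + x) ^ card E * (1 - card E * real d ^ 2 * x\<^sup>2)"
proof -
  define R where "R = (SIGMA u:E. {u'\<in>E. u' \<noteq> u \<and> near u u'})"
  define F where "F = (\<lambda>(u, u'). {A. A \<subseteq> E \<and> u \<in> A \<and> u' \<in> A})"
  have finR: "finite R" using finite_E by (auto simp: R_def)
  have finF: "finite (F p)" for p using finite_E by (auto simp: F_def split: prod.splits)
  have cR: "real (card R) \<le> card E * real d ^ 2"
  proof -
    have "card R = (\<Sum>u\<in>E. card {u'\<in>E. u' \<noteq> u \<and> near u u'})"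
      unfolding R_def using finite_E by (intro card_SigmaI) auto
    also have "\<dots> \<le> (\<Sum>u\<in>E. d\<^sup>2)"
    proof (rule sum_mono)
      fix u assume "u \<in> E"
      have "card {u'\<in>E. u' \<noteq> u \<and> near u u'} \<le> card {u'\<in>E. near u u'}"
        using finite_E by (intro card_mono) auto
      then show "card {u'\<in>E. u' \<noteq> u \<and> near u u'} \<le> d\<^sup>2"
        using card_near_le[OF \<open>u \<in> E\<close>] by linarith
    qed
    finally have "real (card R) \<le> real (card E * d\<^sup>2)"
      using of_nat_mono[of "card R" "card E * d\<^sup>2"] by simp
    then show ?thesis by simp
  qed
  have F_sum: "(\<Sum>A\<in>F p. x ^ card A) \<le> x\<^sup>2 * (1 + x) ^ card E" if pR: "p \<in> R" for p
  proof -
    obtain u u' where p: "p = (u, u')" "u \<in> E" "u' \<in> E" "u \<noteq> u'" using pR by (auto simp: R_def)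
    have "(\<Sum>A\<in>F p. x ^ card A) = (\<Sum>A\<in>(\<lambda>A. insert u (insert u' A)) ` Pow (E - {u, u'}). x ^ card A)"
    proof (rule sum.cong[OF _ refl])
      show "F p = (\<lambda>A. insert u (insert u' A)) ` Pow (E - {u, u'})"
      proof (intro equalityI subsetI)
        fix A assume "A \<in> F p"
        then have "A = insert u (insert u' (A - {u, u'}))" "A - {u, u'} \<in> Pow (E - {u, u'})"
          using p by (auto simp: F_def)
        then show "A \<in> (\<lambda>A. insert u (insert u' A)) ` Pow (E - {u, u'})" by blast
      qed (use p in \<open>auto simp: F_def\<close>)
    qed
    also have "\<dots> = (\<Sum>A\<in>Pow (E - {u, u'}). x ^ card (insert u (insert u' A)))"
    proof (rule sum.reindex_cong[OF _ refl refl])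
      show "inj_on (\<lambda>A. insert u (insert u' A)) (Pow (E - {u, u'}))"
      proof (rule inj_onI)
        fix A B assume "A \<in> Pow (E - {u, u'})" "B \<in> Pow (E - {u, u'})"
          "insert u (insert u' A) = insert u (insert u' B)"
        then show "A = B" by blast
      qed
    qed
    also have "\<dots> = (\<Sum>A\<in>Pow (E - {u, u'}). x\<^sup>2 * x ^ card A)"
    proof (rule sum.cong[OF refl])
      fix A assume A: "A \<in> Pow (E - {u, u'})"
      then have "finite A" "u \<notin> A" "u' \<notin> A" using finite_E finite_subset[of A E] by auto
      then show "x ^ card (insert u (insert u' A)) = x\<^sup>2 * x ^ card A"
        using p(4) by (simp add: power2_eq_square)
    qed
    also have "\<dots> = x\<^sup>2 * (1 + x) ^ card (E - {u, u'})"
      using finite_E by (simp add: sum_distrib_left[symmetric] sum_Pow_power_card)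
    also have "\<dots> \<le> x\<^sup>2 * (1 + x) ^ card E"
      using x finite_E by (intro mult_left_mono power_increasing card_mono) auto
    finally show ?thesis .
  qed
  have "(1 + x) ^ card E = (\<Sum>A\<in>Pow E. x ^ card A)"
    using finite_E by (simp add: sum_Pow_power_card)
  also have "\<dots> \<le> (\<Sum>A\<in>{A. A \<subseteq> E \<and> good A} \<union> (\<Union>p\<in>R. F p). x ^ card A)"
  proof (rule sum_mono2)
    show "finite ({A. A \<subseteq> E \<and> good A} \<union> (\<Union>p\<in>R. F p))"
      using finite_E finR finF by auto
    show "Pow E \<subseteq> {A. A \<subseteq> E \<and> good A} \<union> (\<Union>p\<in>R. F p)"
    proof
      fix A assume A: "A \<in> Pow E"
      show "A \<in> {A. A \<subseteq> E \<and> good A} \<union> (\<Union>p\<in>R. F p)"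
      proof (cases "good A")
        case False
        then obtain u u' where u: "u \<in> A" "u' \<in> A" "u \<noteq> u'" "N u \<inter> N u' \<noteq> {}"
          by (auto simp: good_def)
        then have "(u, u') \<in> R" "A \<in> F (u, u')"
          using A by (auto simp: R_def F_def near_def)
        then show ?thesis by blast
      qed (use A in auto)
    qed
  qed (use x in auto)
  also have "\<dots> \<le> (\<Sum>A\<in>{A. A \<subseteq> E \<and> good A}. x ^ card A) + (\<Sum>A\<in>(\<Union>p\<in>R. F p). x ^ card A)"
    using finite_E finR finF x by (subst sum_Un) (auto intro!: sum_nonneg)
  also have "(\<Sum>A\<in>(\<Union>p\<in>R. F p). x ^ card A) \<le> (\<Sum>p\<in>R. \<Sum>A\<in>F p. x ^ card A)"
    using finR finF x by (intro sum_UN_le) auto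
  also have "\<dots> \<le> (\<Sum>p\<in>R. x\<^sup>2 * (1 + x) ^ card E)"
    by (rule sum_mono) (rule F_sum)
  also have "\<dots> = card R * (x\<^sup>2 * (1 + x) ^ card E)" by simp
  also have "\<dots> \<le> card E * real d ^ 2 * (x\<^sup>2 * (1 + x) ^ card E)"
    using cR x by (intro mult_right_mono) auto
  finally show ?thesis by (simp add: algebra_simps)
qed

text \<open>Disjoint neighbourhoods of size \<open>d\<close> leave room for at most
  \<open>card E / d\<close> vertices; the tilt 1 / d then gives a number far below 2^n.\<close>

lemma count_good:
  "real (card {A. A \<subseteq> E \<and> good A}) \<le> exp (card E / d) * d powr (card E / d)"
proof -
  have "{A. A \<subseteq> E \<and> good A} \<subseteq> {A. A \<subseteq> E \<and> real (card A) \<le> card E / d}"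
  proof safe
    fix A assume A: "A \<subseteq> E" "good A"
    have "d * card A = (\<Sum>v\<in>Od. card (N v \<inter> A))"
      by (rule sum_degree[OF A(1), symmetric])
    also have "\<dots> \<le> (\<Sum>v\<in>Od. 1)"
      by (rule sum_mono) (rule good_degree_le_one[OF A])
    finally have "d * card A \<le> card E" using card_E card_Od by simp
    then have "real (d * card A) \<le> real (card E)" by (rule of_nat_mono)
    then show "real (card A) \<le> card E / d"
      using d1 by (simp add: field_simps)
  qed
  then have "real (card {A. A \<subseteq> E \<and> good A}) \<le> card {A. A \<subseteq> E \<and> real (card A) \<le> card E / d}"
    using finite_E by (intro of_nat_mono card_mono) auto
  also have "\<dots> \<le> (1 + 1 / d) ^ card E * (1 / d) powr (- (card E / d))"
    using d1 by (intro card_small_subsets finite_E) auto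
  also have "\<dots> \<le> exp (1 / d) ^ card E * d powr (card E / d)"
  proof (intro mult_mono power_mono)
    show "1 + 1 / real d \<le> exp (1 / d)" by (rule exp_ge_add_one_self)
  qed (use d1 in \<open>auto simp: powr_minus powr_divide\<close>)
  also have "exp (1 / d) ^ card E = exp (card E / d)"
    by (simp add: exp_of_nat_mult[symmetric])
  finally show ?thesis .
qed

text \<open>For fixed \<open>A\<close> and \<open>A'\<close> the sum over \<open>B\<close> and
  \<open>B'\<close> factorises over the vertices of \<open>Od\<close>, then regroups over
  \<open>E\<close>: a vertex in one of the two sets contributes \<open>((1 + q) / 2) ^ d\<close>, a
  common one \<open>((1 + 3 * q) / 4) ^ d\<close>. Dropping goodness makes the sum over
  \<open>A\<close> and \<open>A'\<close> a product too. The common vertices are the source of the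
  threshold 2/3.\<close>

lemma second_moment_same_side:
  fixes q :: real
  assumes q: "0 \<le> q"
  shows "(\<Sum>(A, A')\<in>{A. A \<subseteq> E \<and> good A} \<times> {A. A \<subseteq> E \<and> good A}. \<Sum>(B, B')\<in>Pow Od \<times> Pow Od.
            q ^ card (pairs A B \<union> pairs A' B'))
     \<le> 4 ^ card E * (1 + 2 * ((1 + q) / 2) ^ d + ((1 + 3 * q) / 4) ^ d) ^ card E"
proof -
  define x where "x = (1 + q) / 2"
  define y where "y = (1 + 3 * q) / 4"
  define g where "g A A' u = (if u \<in> A then (if u \<in> A' then y ^ d else x ^ d) else if u \<in> A' then x ^ d else 1)" for A A' and u :: 'a
  have inner: "(\<Sum>(B, B')\<in>Pow Od \<times> Pow Od. q ^ card (pairs A B \<union> pairs A' B')) = 4 ^ card E * (\<Prod>u\<in>E. g A A' u)"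
    if A: "A \<subseteq> E" "good A" and A': "A' \<subseteq> E" "good A'" for A A'
  proof -
    define s where "s v b b' = q ^ card (N v \<inter> ((if b then A else {}) \<union> (if b' then A' else {})))" for v b b'
    have "q ^ card (pairs A B \<union> pairs A' B') = (\<Prod>v\<in>Od. s v (v \<in> B) (v \<in> B'))"
      if B: "B \<subseteq> Od" "B' \<subseteq> Od" for B B'
    proof -
      have "card (pairs A B \<union> pairs A' B') = (\<Sum>v\<in>Od. card {u. (u, v) \<in> pairs A B \<union> pairs A' B'})"
        using A A' B by (intro card_pairs_subset) (auto simp: pairs_def)
      also have "\<dots> = (\<Sum>v\<in>Od. card (N v \<inter> ((if v \<in> B then A else {}) \<union> (if v \<in> B' then A' else {}))))"
      proof (rule sum.cong[OF refl])
        fix v assume v: "v \<in> Od"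
        have "v \<in> N u \<longleftrightarrow> u \<in> N v" if "u \<in> A \<union> A'" for u
          using that v A A' N_sym by blast
        then have "{u. (u, v) \<in> pairs A B \<union> pairs A' B'} = N v \<inter> ((if v \<in> B then A else {}) \<union> (if v \<in> B' then A' else {}))"
          by (auto simp: pairs_def)
        then show "card {u. (u, v) \<in> pairs A B \<union> pairs A' B'} = card (N v \<inter> ((if v \<in> B then A else {}) \<union> (if v \<in> B' then A' else {})))"
          by simp
      qed
      finally show ?thesis by (simp add: s_def power_sum)
    qed
    then have "(\<Sum>(B, B')\<in>Pow Od \<times> Pow Od. q ^ card (pairs A B \<union> pairs A' B'))
        = (\<Sum>B\<in>Pow Od. \<Sum>B'\<in>Pow Od. \<Prod>v\<in>Od. s v (v \<in> B) (v \<in> B'))"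
      by (subst sum.cartesian_product[symmetric]) (auto intro!: sum.cong)
    also have "\<dots> = (\<Sum>B\<in>Pow Od. \<Prod>v\<in>Od. s v (v \<in> B) False + s v (v \<in> B) True)"
      by (intro sum.cong refl sum_Pow_prod_bool[OF finite_Od, of "\<lambda>v b'. s v (v \<in> B) b'" for B])
    also have "\<dots> = (\<Prod>v\<in>Od. (s v False False + s v False True) + (s v True False + s v True True))"
      using sum_Pow_prod_bool[OF finite_Od, of "\<lambda>v b. s v b False + s v b True"] by simp
    also have "\<dots> = (\<Prod>v\<in>Od. 4 * (x ^ card (N v \<inter> (A - A')) * x ^ card (N v \<inter> (A' - A)) * y ^ card (N v \<inter> (A \<inter> A'))))"
    proof (intro prod.cong refl)
      fix v assume v: "v \<in> Od"
      define a1 where "a1 = card (N v \<inter> (A - A'))"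
      define a2 where "a2 = card (N v \<inter> (A' - A))"
      define c where "c = card (N v \<inter> (A \<inter> A'))"
      note fin = finite_N(1)[OF v]
      have eA: "card (N v \<inter> A) = a1 + c"
        unfolding a1_def c_def using fin by (subst card_Un_disjoint[symmetric]) (auto intro!: arg_cong[where f = card])
      have eA': "card (N v \<inter> A') = a2 + c"
        unfolding a2_def c_def using fin by (subst card_Un_disjoint[symmetric]) (auto intro!: arg_cong[where f = card])
      have eU: "card (N v \<inter> (A \<union> A')) = a1 + a2 + c"
      proof -
        have "N v \<inter> (A \<union> A') = (N v \<inter> A) \<union> (N v \<inter> (A' - A))" by auto
        moreover have "card ((N v \<inter> A) \<union> (N v \<inter> (A' - A))) = card (N v \<inter> A) + card (N v \<inter> (A' - A))"
          using fin by (intro card_Un_disjoint) auto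
        ultimately show ?thesis using eA by (simp add: a2_def)
      qed
      \<comment> \<open>In the five cases the four terms sum to 4, to 2 + 2 q = 4 x, to (1 + q)^2 =
        4 x^2, or to 1 + 3 q = 4 y.\<close>
      have "a1 + c \<le> 1" "a2 + c \<le> 1"
        using good_degree_le_one[OF A v] good_degree_le_one[OF A' v] eA eA' by simp_all
      then consider "c = 1" "a1 = 0" "a2 = 0" | "c = 0" "a1 = 0" "a2 = 0" | "c = 0" "a1 = 1" "a2 = 0"
        | "c = 0" "a1 = 0" "a2 = 1" | "c = 0" "a1 = 1" "a2 = 1"
        by linarith
      then have "1 + q ^ (a2 + c) + (q ^ (a1 + c) + q ^ (a1 + a2 + c)) = 4 * (x ^ a1 * x ^ a2 * y ^ c)"
        by cases (simp_all add: x_def y_def field_simps power2_eq_square)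
      then show "(s v False False + s v False True) + (s v True False + s v True True)
          = 4 * (x ^ card (N v \<inter> (A - A')) * x ^ card (N v \<inter> (A' - A)) * y ^ card (N v \<inter> (A \<inter> A')))"
        by (simp add: s_def eA eA' eU a1_def[symmetric] a2_def[symmetric] c_def[symmetric])
    qed
    also have "\<dots> = 4 ^ card E * (x ^ (d * card (A - A')) * x ^ (d * card (A' - A)) * y ^ (d * card (A \<inter> A')))"
    proof -
      have "A - A' \<subseteq> E" "A' - A \<subseteq> E" "A \<inter> A' \<subseteq> E" using A A' by auto
      then show ?thesis
        using card_E card_Od by (simp add: prod.distrib power_sum[symmetric] sum_degree)
    qed
    also have "x ^ (d * card (A - A')) * x ^ (d * card (A' - A)) * y ^ (d * card (A \<inter> A')) = (\<Prod>u\<in>E. g A A' u)"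
    proof -
      have "(\<Prod>u\<in>E. g A A' u) = (\<Prod>u\<in>E. (if u \<in> A - A' then x ^ d else 1) * (if u \<in> A' - A then x ^ d else 1) * (if u \<in> A \<inter> A' then y ^ d else 1))"
        by (intro prod.cong refl) (auto simp: g_def)
      also have "\<dots> = (x ^ d) ^ card (A - A') * (x ^ d) ^ card (A' - A) * (y ^ d) ^ card (A \<inter> A')"
      proof -
        have "E \<inter> (A - A') = A - A'" "E \<inter> (A' - A) = A' - A" "E \<inter> (A \<inter> A') = A \<inter> A'"
          using A A' by auto
        then show ?thesis
          unfolding prod.distrib using finite_E by (simp add: prod.If_cases Collect_conj_eq[symmetric] Int_def[symmetric] set_diff_eq[symmetric] del: Diff_iff Int_iff)
      qed
      finally show ?thesis by (simp add: power_mult)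
    qed
    finally show ?thesis .
  qed
  have x0: "x \<ge> 0" "y \<ge> 0" using q by (auto simp: x_def y_def)
  have "(\<Sum>(A, A')\<in>{A. A \<subseteq> E \<and> good A} \<times> {A. A \<subseteq> E \<and> good A}. \<Sum>(B, B')\<in>Pow Od \<times> Pow Od.
            q ^ card (pairs A B \<union> pairs A' B'))
     = (\<Sum>(A, A')\<in>{A. A \<subseteq> E \<and> good A} \<times> {A. A \<subseteq> E \<and> good A}. 4 ^ card E * (\<Prod>u\<in>E. g A A' u))"
    by (intro sum.cong refl) (clarsimp simp: inner)
  also have "\<dots> \<le> (\<Sum>(A, A')\<in>Pow E \<times> Pow E. 4 ^ card E * (\<Prod>u\<in>E. g A A' u))"
  proof (intro sum_mono2)
    have "g A A' u \<ge> 0" for A A' u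
      using x0 by (simp add: g_def)
    then have "0 \<le> 4 ^ card E * (\<Prod>u\<in>E. g A A' u)" for A A'
      by (intro mult_nonneg_nonneg prod_nonneg) auto
    then show "0 \<le> (case p of (A, A') \<Rightarrow> 4 ^ card E * (\<Prod>u\<in>E. g A A' u))" for p
      by (cases p) simp
  qed (use finite_E in auto)
  also have "\<dots> = 4 ^ card E * (\<Sum>A\<in>Pow E. \<Sum>A'\<in>Pow E. \<Prod>u\<in>E. g A A' u)"
    by (simp add: sum.cartesian_product[symmetric] sum_distrib_left)
  also have "(\<Sum>A\<in>Pow E. \<Sum>A'\<in>Pow E. \<Prod>u\<in>E. g A A' u) = (1 + 2 * x ^ d + y ^ d) ^ card E"
  proof -
    define t where "t b b' = (if b then (if b' then y ^ d else x ^ d) else if b' then x ^ d else 1)" for b b'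
    have "(\<Sum>A\<in>Pow E. \<Sum>A'\<in>Pow E. \<Prod>u\<in>E. g A A' u) = (\<Sum>A\<in>Pow E. \<Sum>A'\<in>Pow E. \<Prod>u\<in>E. t (u \<in> A) (u \<in> A'))"
      by (simp add: g_def t_def)
    also have "\<dots> = (\<Sum>A\<in>Pow E. \<Prod>u\<in>E. t (u \<in> A) False + t (u \<in> A) True)"
      by (intro sum.cong refl sum_Pow_prod_bool[OF finite_E, of "\<lambda>u b'. t (u \<in> A) b'" for A])
    also have "\<dots> = (\<Prod>u\<in>E. (t False False + t False True) + (t True False + t True True))"
      using sum_Pow_prod_bool[OF finite_E, of "\<lambda>u b. t b False + t b True"] by simp
    finally show ?thesis by (simp add: t_def algebra_simps)
  qed
  finally show ?thesis by (simp add: x_def y_def)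
qed

text \<open>The disjoint edge sets between \<open>A\<close> and \<open>B - B'\<close> and between
  \<open>A' - A\<close> and \<open>B'\<close> bound the union from below, and with them the sum over
  \<open>A'\<close> and \<open>B\<close> factorises. This nearly gives the product of the first
  moments; the edges between \<open>A\<close> and \<open>B'\<close> are lost twice, a factor of at
  most 4 each, whence the inner \<open>1 + 4 * x\<close>.\<close>

lemma second_moment_cross:
  fixes q :: real
  assumes q: "0 \<le> q" "q \<le> 1"
  shows "(\<Sum>(A, B')\<in>{A. A \<subseteq> E \<and> good A} \<times> {B. B \<subseteq> Od \<and> good B}. \<Sum>(A', B)\<in>Pow E \<times> Pow Od.
            q ^ card (pairs A B \<union> pairs A' B'))
     \<le> 4 ^ card E * (1 + ((1 + q) / 2) ^ d) ^ card E
          * (1 + ((1 + q) / 2) ^ d * (1 + 4 * ((1 + q) / 2) ^ d) ^ d) ^ card E"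
proof -
  interpret dual: cube_like d Od E N by (rule dual)
  define z where "z = (1 + q) / 2"
  define x where "x = z ^ d"
  have z: "1/2 \<le> z" "z \<le> 1" using q by (auto simp: z_def)
  have x: "x \<ge> 0" using z by (simp add: x_def)
  \<comment> \<open>A vertex of the fixed sets loses its factor \<open>z ^ a\<close>; since
    \<open>z\<close> is at least 1/2, the correction \<open>2 ^ a\<close> restores it.\<close>
  have one: "1 + (if b then 1 else q ^ a) \<le> 2 * z ^ a * (if b then 2 ^ a else 1)" if "a \<le> 1" for a :: nat and b
    using that z by (cases a) (auto simp: z_def)
  have inner: "(\<Sum>(A', B)\<in>Pow E \<times> Pow Od. q ^ card (pairs A B \<union> pairs A' B'))
      \<le> 4 ^ card E * x ^ card A * (\<Prod>v\<in>B'. x * 4 ^ card (N v \<inter> A))"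
    if A: "A \<subseteq> E" "good A" and B': "B' \<subseteq> Od" "good B'" for A B'
  proof -
    have finB': "finite B'" "finite A" using A B' finite_E finite_Od finite_subset by blast+
    have e2: "(\<Prod>v\<in>B'. 2 ^ card (N v \<inter> A)) = (\<Prod>u\<in>A. (2::real) ^ card (N u \<inter> B'))"
      using sum_degree_swap[OF A(1) B'(1)] by (simp add: power_sum[symmetric])
    have "(\<Sum>(A', B)\<in>Pow E \<times> Pow Od. q ^ card (pairs A B \<union> pairs A' B'))
       \<le> (\<Sum>(A', B)\<in>Pow E \<times> Pow Od. (\<Prod>u\<in>A'. if u \<in> A then 1 else q ^ card (N u \<inter> B')) * (\<Prod>v\<in>B. if v \<in> B' then 1 else q ^ card (N v \<inter> A)))"
    proof (intro sum_mono, clarify)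
      fix A' B assume A': "A' \<subseteq> E" and B: "B \<subseteq> Od"
      have fin: "finite A'" "finite B" using A' B finite_E finite_Od finite_subset by blast+
      have sub: "pairs A (B - B') \<union> pairs (A' - A) B' \<subseteq> pairs A B \<union> pairs A' B'"
        by (auto simp: pairs_def)
      have sE: "A' - A \<subseteq> E" "B - B' \<subseteq> Od" using A' B by auto
      have "edges_between A (B - B') + edges_between (A' - A) B' = card (pairs A (B - B')) + card (pairs (A' - A) B')"
        using A B' sE by (simp add: card_pairs)
      also have "\<dots> = card (pairs A (B - B') \<union> pairs (A' - A) B')"
        using A B' sE by (intro card_Un_disjoint[symmetric] finite_pairs) (auto simp: pairs_def)
      also have "\<dots> \<le> card (pairs A B \<union> pairs A' B')"
        using sub A A' B B' finite_pairs by (intro card_mono) auto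
      finally have "q ^ card (pairs A B \<union> pairs A' B') \<le> q ^ (edges_between A (B - B') + edges_between (A' - A) B')"
        using q by (intro power_decreasing) auto
      also have "\<dots> = q ^ (\<Sum>u\<in>A' - A. card (N u \<inter> B')) * q ^ (\<Sum>v\<in>B - B'. card (N v \<inter> A))"
        using sum_degree_swap[OF sE(1) B'(1)] by (simp add: edges_between_def power_add)
      also have "q ^ (\<Sum>u\<in>A' - A. card (N u \<inter> B')) = (\<Prod>u\<in>A'. if u \<in> A then 1 else q ^ card (N u \<inter> B'))"
        using fin by (simp add: power_sum prod.If_cases set_diff_eq Int_def)
      also have "q ^ (\<Sum>v\<in>B - B'. card (N v \<inter> A)) = (\<Prod>v\<in>B. if v \<in> B' then 1 else q ^ card (N v \<inter> A))"
        using fin by (simp add: power_sum prod.If_cases set_diff_eq Int_def)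
      finally show "q ^ card (pairs A B \<union> pairs A' B') \<le> (\<Prod>u\<in>A'. if u \<in> A then 1 else q ^ card (N u \<inter> B')) * (\<Prod>v\<in>B. if v \<in> B' then 1 else q ^ card (N v \<inter> A))" .
    qed
    also have "\<dots> = (\<Prod>u\<in>E. 1 + (if u \<in> A then 1 else q ^ card (N u \<inter> B'))) * (\<Prod>v\<in>Od. 1 + (if v \<in> B' then 1 else q ^ card (N v \<inter> A)))"
      using finite_E finite_Od by (simp add: sum.cartesian_product[symmetric] sum_product[symmetric] sum_Pow_prod)
    also have "\<dots> \<le> (\<Prod>u\<in>E. 2 * z ^ card (N u \<inter> B') * (if u \<in> A then 2 ^ card (N u \<inter> B') else 1))
        * (\<Prod>v\<in>Od. 2 * z ^ card (N v \<inter> A) * (if v \<in> B' then 2 ^ card (N v \<inter> A) else 1))"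
    proof (intro mult_mono prod_mono conjI one good_degree_le_one[OF A] dual.good_degree_le_one[OF B'(1)])
      show "dual.good B'" using B'(2) by (simp add: good_def dual.good_def)
    qed (use q z in \<open>auto intro!: prod_nonneg\<close>)
    also have "(\<Prod>v\<in>Od. 2 * z ^ card (N v \<inter> A) * (if v \<in> B' then 2 ^ card (N v \<inter> A) else 1))
        = 2 ^ card E * x ^ card A * (\<Prod>v\<in>B'. 2 ^ card (N v \<inter> A))"
      unfolding prod.distrib using finite_Od B' card_E card_Od
      by (simp add: prod.If_cases Int_absorb1 power_sum[symmetric] sum_degree[OF A(1)] x_def power_mult)
    also have "(\<Prod>u\<in>E. 2 * z ^ card (N u \<inter> B') * (if u \<in> A then 2 ^ card (N u \<inter> B') else 1))
        = 2 ^ card E * x ^ card B' * (\<Prod>u\<in>A. 2 ^ card (N u \<inter> B'))"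
      unfolding prod.distrib using finite_E A
      by (simp add: prod.If_cases Int_absorb1 power_sum[symmetric] dual.sum_degree[OF B'(1)] x_def power_mult)
    also have "2 ^ card E * x ^ card B' * (\<Prod>u\<in>A. 2 ^ card (N u \<inter> B')) * (2 ^ card E * x ^ card A * (\<Prod>v\<in>B'. 2 ^ card (N v \<inter> A)))
       = 2 ^ card E * 2 ^ card E * x ^ card A * (x ^ card B' * ((\<Prod>v\<in>B'. 2 ^ card (N v \<inter> A)) * (\<Prod>v\<in>B'. 2 ^ card (N v \<inter> A))))"
      unfolding e2[symmetric] by (simp only: mult_ac)
    also have "\<dots> = 4 ^ card E * x ^ card A * (\<Prod>v\<in>B'. x * 4 ^ card (N v \<inter> A))"
    proof -
      have "(2::real) ^ card E * 2 ^ card E = 4 ^ card E"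
        "(2::real) ^ k * 2 ^ k = 4 ^ k" for k
        by (simp_all flip: power_mult_distrib)
      then show ?thesis
        by (simp only: prod.distrib[symmetric]) (simp add: prod.distrib)
    qed
    finally show ?thesis .
  qed
  have outer: "(\<Sum>B'\<in>{B. B \<subseteq> Od \<and> good B}. \<Prod>v\<in>B'. x * 4 ^ card (N v \<inter> A)) \<le> (1 + x) ^ card E * ((1 + 4 * x) ^ d) ^ card A"
    if A: "A \<subseteq> E" "good A" for A
  proof -
    have "(\<Sum>B'\<in>{B. B \<subseteq> Od \<and> good B}. \<Prod>v\<in>B'. x * 4 ^ card (N v \<inter> A)) \<le> (\<Sum>B'\<in>Pow Od. \<Prod>v\<in>B'. x * 4 ^ card (N v \<inter> A))"
      using finite_Od x by (intro sum_mono2) (auto intro!: prod_nonneg)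
    also have "\<dots> = (\<Prod>v\<in>Od. 1 + x * 4 ^ card (N v \<inter> A))"
      by (rule sum_Pow_prod[OF finite_Od])
    also have "\<dots> \<le> (\<Prod>v\<in>Od. (1 + x) * (1 + 4 * x) ^ card (N v \<inter> A))"
    proof (intro prod_mono conjI)
      fix v assume "v \<in> Od"
      then have "card (N v \<inter> A) = 0 \<or> card (N v \<inter> A) = 1"
        using good_degree_le_one[OF A] by (metis One_nat_def le_Suc_eq le_zero_eq)
      then show "1 + x * 4 ^ card (N v \<inter> A) \<le> (1 + x) * (1 + 4 * x) ^ card (N v \<inter> A)"
        using x by (elim disjE) (simp_all add: algebra_simps)
    qed (use x in simp)
    also have "\<dots> = (1 + x) ^ card E * ((1 + 4 * x) ^ d) ^ card A"
      unfolding prod.distrib using card_E card_Od by (simp add: power_sum[symmetric] sum_degree[OF A(1)] power_mult)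
    finally show ?thesis .
  qed
  have "(\<Sum>(A, B')\<in>{A. A \<subseteq> E \<and> good A} \<times> {B. B \<subseteq> Od \<and> good B}. \<Sum>(A', B)\<in>Pow E \<times> Pow Od.
            q ^ card (pairs A B \<union> pairs A' B'))
     \<le> (\<Sum>(A, B')\<in>{A. A \<subseteq> E \<and> good A} \<times> {B. B \<subseteq> Od \<and> good B}. 4 ^ card E * x ^ card A * (\<Prod>v\<in>B'. x * 4 ^ card (N v \<inter> A)))"
    by (rule sum_mono) (use inner in auto)
  also have "\<dots> = (\<Sum>A\<in>{A. A \<subseteq> E \<and> good A}. 4 ^ card E * x ^ card A * (\<Sum>B'\<in>{B. B \<subseteq> Od \<and> good B}. \<Prod>v\<in>B'. x * 4 ^ card (N v \<inter> A)))"
    by (simp add: sum.cartesian_product[symmetric] sum_distrib_left)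
  also have "\<dots> \<le> (\<Sum>A\<in>{A. A \<subseteq> E \<and> good A}. 4 ^ card E * x ^ card A * ((1 + x) ^ card E * ((1 + 4 * x) ^ d) ^ card A))"
    using outer x by (intro sum_mono mult_left_mono) auto
  also have "\<dots> \<le> (\<Sum>A\<in>Pow E. 4 ^ card E * x ^ card A * ((1 + x) ^ card E * ((1 + 4 * x) ^ d) ^ card A))"
    using finite_E x by (intro sum_mono2) auto
  also have "\<dots> = 4 ^ card E * (1 + x) ^ card E * (\<Sum>A\<in>Pow E. (x * (1 + 4 * x) ^ d) ^ card A)"
    by (simp add: sum_distrib_left power_mult_distrib mult_ac)
  also have "\<dots> = 4 ^ card E * (1 + x) ^ card E * (1 + x * (1 + 4 * x) ^ d) ^ card E"
    by (simp add: sum_Pow_power_card[OF finite_E])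
  finally show ?thesis by (simp add: x_def z_def)
qed

end

section \<open>The hypercube\<close>

definition cube_nbrs :: "bool list \<Rightarrow> bool list set" where
  "cube_nbrs x = {y. hc_adj x y}"

definition parity_class :: "nat \<Rightarrow> bool \<Rightarrow> bool list set" where
  "parity_class d s = {x. length x = d \<and> even (length (filter id x)) = s}"

text \<open>The cube is two copies of a smaller cube joined by a matching; this makes all its
  properties accessible to list induction.\<close>

lemma hc_adj_Cons:
  "hc_adj (b # x) (c # y) \<longleftrightarrow> (b = c \<and> hc_adj x y) \<or> (b \<noteq> c \<and> x = y)"
proof (cases "length x = length y")
  case True
  define D where "D = {i. i < length x \<and> x ! i \<noteq> y ! i}"
  have finD: "finite D" by (simp add: D_def)
  have "{i. i < length (b # x) \<and> (b # x) ! i \<noteq> (c # y) ! i} = (if b = c then {} else {0}) \<union> Suc ` D"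
  proof (rule set_eqI)
    fix i
    show "i \<in> {i. i < length (b # x) \<and> (b # x) ! i \<noteq> (c # y) ! i} \<longleftrightarrow> i \<in> (if b = c then {} else {0}) \<union> Suc ` D"
      by (cases i) (auto simp: D_def image_iff)
  qed
  then have "card {i. i < length (b # x) \<and> (b # x) ! i \<noteq> (c # y) ! i} = (if b = c then 0 else 1) + card D"
    using finD by (simp add: card_image)
  moreover have "card D = 0 \<longleftrightarrow> x = y"
    using True finD by (auto simp: D_def list_eq_iff_nth_eq)
  ultimately show ?thesis
    using True by (auto simp: hc_adj_def D_def)
qed (auto simp: hc_adj_def)

lemma cube_nbrs_Nil: "cube_nbrs [] = {}"
  by (auto simp: cube_nbrs_def hc_adj_def)

lemma cube_nbrs_Cons: "cube_nbrs (b # x) = insert ((\<not> b) # x) (Cons b ` cube_nbrs x)"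
proof (intro set_eqI)
  fix z
  show "z \<in> cube_nbrs (b # x) \<longleftrightarrow> z \<in> insert ((\<not> b) # x) (Cons b ` cube_nbrs x)"
    by (cases z) (auto simp: cube_nbrs_def hc_adj_Cons, auto simp: hc_adj_def)
qed

lemma hc_adj_sym: "hc_adj x y \<longleftrightarrow> hc_adj y x"
proof (cases "length x = length y")
  case True
  have "{i. i < length x \<and> x ! i \<noteq> y ! i} = {i. i < length y \<and> y ! i \<noteq> x ! i}"
    using True by auto
  then show ?thesis
    using True unfolding hc_adj_def by metis
qed (simp add: hc_adj_def)

lemma finite_cube_nbrs: "finite (cube_nbrs x)"
  by (induction x) (auto simp: cube_nbrs_Nil cube_nbrs_Cons)

lemma card_cube_nbrs: "card (cube_nbrs x) = length x"
proof (induction x)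
  case (Cons b x)
  have "(\<not> b) # x \<notin> Cons b ` cube_nbrs x" by auto
  then show ?case
    using Cons finite_cube_nbrs by (simp add: cube_nbrs_Cons card_image)
qed (simp add: cube_nbrs_Nil)

lemma cube_nbrs_parity:
  "y \<in> cube_nbrs x \<Longrightarrow> length y = length x \<and> even (length (filter id y)) = odd (length (filter id x))"
  by (induction x arbitrary: y) (auto simp: cube_nbrs_Nil cube_nbrs_Cons)

lemma cube_nbrs_class: "x \<in> parity_class d s \<Longrightarrow> cube_nbrs x \<subseteq> parity_class d (\<not> s)"
  using cube_nbrs_parity by (fastforce simp: parity_class_def)

lemma codegree_cube_nbrs:
  "length x = length y \<Longrightarrow> x \<noteq> y \<Longrightarrow> card (cube_nbrs x \<inter> cube_nbrs y) \<le> 2"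
proof (induction x y rule: list_induct2)
  case (Cons b x c y)
  show ?case
  proof (cases "b = c")
    case True
    then have "cube_nbrs (b # x) \<inter> cube_nbrs (c # y) = Cons b ` (cube_nbrs x \<inter> cube_nbrs y)"
      using Cons.prems by (auto simp: cube_nbrs_Cons)
    then show ?thesis
      using Cons True by (simp add: card_image)
  next
    case False
    then have "cube_nbrs (b # x) \<inter> cube_nbrs (c # y) \<subseteq> {c # x, b # y}"
      by (auto simp: cube_nbrs_Cons)
    then have "card (cube_nbrs (b # x) \<inter> cube_nbrs (c # y)) \<le> card {c # x, b # y}"
      by (intro card_mono) auto
    also have "\<dots> \<le> 2" by (simp add: card_insert_if)
    finally show ?thesis .
  qed
qed simp

section \<open>Parity classes and vertex isoperimetry\<close>

lemma parity_class_Suc: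
  "parity_class (Suc d) s = Cons False ` parity_class d s \<union> Cons True ` parity_class d (\<not> s)"
proof (intro set_eqI)
  fix z
  show "z \<in> parity_class (Suc d) s \<longleftrightarrow> z \<in> Cons False ` parity_class d s \<union> Cons True ` parity_class d (\<not> s)"
    by (cases z) (auto simp: parity_class_def image_iff)
qed

lemma finite_parity_class: "finite (parity_class d s)"
  by (rule finite_subset[OF _ finite_lists_length_eq[of UNIV d]]) (auto simp: parity_class_def)

lemma card_parity_class: "d \<ge> 1 \<Longrightarrow> card (parity_class d s) = 2 ^ (d - 1)"
proof (induction d arbitrary: s rule: dec_induct)
  case base
  have "parity_class 0 True = {[]}" "parity_class 0 False = {}"
    by (auto simp: parity_class_def)
  then show ?case
    unfolding One_nat_def parity_class_Suc by (cases s) auto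
next
  case (step d)
  have "card (parity_class (Suc d) s) = card (parity_class d s) + card (parity_class d (\<not> s))"
    unfolding parity_class_Suc using finite_parity_class
    by (subst card_Un_disjoint) (auto simp: card_image)
  then show ?case
    using step by (cases d) auto
qed

text \<open>For densities \<open>a\<close> and \<open>b\<close> of two halves, passing to the mean
  density raises the quadratic term by \<open>c'\<close> times the square of
  \<open>\<delta>\<close>. If the halves are nearly balanced, the decrease from \<open>c\<close> to
  \<open>c'\<close> pays for this; otherwise the neighbours across the matching do, since
  \<open>n0 \<ge> b\<close> exceeds \<open>a\<close> by twice \<open>\<delta>\<close>.\<close>

lemma isoperimetric_step:
  fixes a b c c' n0 n1 :: real
  assumes ab: "0 \<le> a" "a \<le> b" "b \<le> 1" and c: "0 \<le> c'" "c' \<le> 1" "0 \<le> c" "c \<le> 1"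
    and cc: "c - c' \<ge> c' * c\<^sup>2 / 8"
    and n0: "n0 \<ge> a + c * (a * (1 - a))" "n0 \<ge> b" and n1: "n1 \<ge> b + c * (b * (1 - b))"
  shows "(n0 + n1) / 2 \<ge> (a + b) / 2 + c' * ((a + b) / 2 * (1 - (a + b) / 2))"
proof -
  define \<delta> where "\<delta> = (b - a) / 2"
  define J where "J = a * (1 - a)"
  define K where "K = b * (1 - b)"
  have \<delta>: "0 \<le> \<delta>" "\<delta> \<le> 1/2" using ab by (auto simp: \<delta>_def)
  have J: "0 \<le> J" "J \<le> 1/4"
  proof -
    show "0 \<le> J" using ab by (simp add: J_def)
    have "0 \<le> (a - 1/2)\<^sup>2" by simp
    then show "J \<le> 1/4" by (simp add: J_def power2_eq_square algebra_simps)
  qed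
  have K: "0 \<le> K" using ab by (simp add: K_def)
  have mid: "(a + b) / 2 * (1 - (a + b) / 2) = (J + K) / 2 + \<delta>\<^sup>2"
    by (simp add: J_def K_def \<delta>_def field_simps power2_eq_square)
  have c'c: "c' \<le> c"
  proof -
    have "0 \<le> c' * c\<^sup>2 / 8" using c by simp
    then show ?thesis using cc by linarith
  qed
  have gap: "(c - c') * J / 2 \<ge> c' * c\<^sup>2 * J / 16"
    using mult_right_mono[OF cc, of "J / 2"] J by simp
  show ?thesis
  proof (cases "2 * \<delta> \<le> c * J")
    case True
    have "\<delta>\<^sup>2 \<le> (c * J / 2)\<^sup>2"
      using True \<delta> by (intro power_mono) auto
    also have "\<dots> = c\<^sup>2 * J / 4 * J" by (simp add: power2_eq_square)
    also have "\<dots> \<le> c\<^sup>2 * J / 4 * (1/4)"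
      using J by (intro mult_left_mono) auto
    finally have "c' * \<delta>\<^sup>2 \<le> c' * (c\<^sup>2 * J / 4 * (1/4))"
      using c by (intro mult_left_mono) auto
    then have "c' * \<delta>\<^sup>2 \<le> (c - c') * J / 2" using gap by (simp add: algebra_simps)
    moreover have "0 \<le> (c - c') * K" using c'c K by simp
    ultimately have "c' * ((J + K) / 2 + \<delta>\<^sup>2) \<le> c * (J + K) / 2"
      by (simp add: algebra_simps add_divide_distrib)
    then show ?thesis
      using n0 n1 unfolding mid J_def[symmetric] K_def[symmetric] by (simp add: algebra_simps add_divide_distrib)
  next
    case False
    define e where "e = c * J / 2"
    have "c * J \<le> 1 * (1/4)" using c J by (intro mult_mono) auto
    then have e: "e \<le> \<delta>" "e \<le> 1/2" "0 \<le> e" using False c J by (auto simp: e_def)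
    \<comment> \<open>This makes t - c' t^2 no smaller at \<open>\<delta>\<close> than at
      \<open>e\<close>, the boundary between the two cases.\<close>
    have "c' * (\<delta> + e) \<le> 1 * 1" using c e \<delta> by (intro mult_mono) auto
    then have "0 \<le> (\<delta> - e) * (1 - c' * (\<delta> + e))" using e by simp
    also have "\<dots> = (\<delta> - c' * \<delta>\<^sup>2) - (e - c' * e\<^sup>2)" by (simp add: power2_eq_square algebra_simps)
    finally have 1: "\<delta> - c' * \<delta>\<^sup>2 \<ge> e - c' * e\<^sup>2" by simp
    have "c' * e\<^sup>2 = c' * (c\<^sup>2 * J / 4 * J)" by (simp add: e_def power2_eq_square)
    also have "\<dots> \<le> c' * (c\<^sup>2 * J / 4 * (1/4))"
      using J c by (intro mult_left_mono) auto
    finally have "e - c' * e\<^sup>2 \<ge> c' * J / 2"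
      using gap by (simp add: e_def algebra_simps)
    with 1 have "\<delta> - c' * \<delta>\<^sup>2 \<ge> c' * J / 2" by linarith
    moreover have "c' * K \<le> c * K" using c'c K by (rule mult_right_mono)
    ultimately have "c' * ((J + K) / 2 + \<delta>\<^sup>2) \<le> \<delta> + c * K / 2"
      by (simp add: algebra_simps add_divide_distrib)
    moreover have "(n0 + n1) / 2 \<ge> (a + b) / 2 + \<delta> + c * K / 2"
      using n0 n1 by (simp add: K_def \<delta>_def field_simps)
    ultimately show ?thesis
      unfolding mid by linarith
  qed
qed

text \<open>The induction step asks the constants to decrease by at least about c^3 / 8; 1 / sqrt d
  does so because (1 + 1 / (8 d))^2 is at most 1 + 1 / d.\<close>

lemma sqrt_gap:
  assumes "d \<ge> 1"
  shows "1 / sqrt d - 1 / sqrt (Suc d) \<ge> 1 / sqrt (Suc d) * (1 / sqrt d)\<^sup>2 / 8"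
proof -
  have d: "real d > 0" using assms by simp
  have "(1 + 1 / (8 * d))\<^sup>2 = 1 + 1 / (4 * d) + 1 / (64 * real d ^ 2)"
    using d by (simp add: power2_eq_square field_simps)
  also have "1 / (64 * real d ^ 2) \<le> 1 / (2 * d)"
    using assms by (intro divide_left_mono) (auto simp: power2_eq_square)
  also have "1 + 1 / (4 * d) + 1 / (2 * d) \<le> 1 + 1 / real d"
    using d by (simp add: field_simps)
  also have "\<dots> = Suc d / d" using d by (simp add: field_simps)
  finally have "1 + 1 / (8 * d) \<le> sqrt (Suc d / d)"
    by (intro real_le_rsqrt) simp
  then have "1 + 1 / (8 * d) \<le> sqrt (Suc d) / sqrt d"
    by (simp add: real_sqrt_divide)
  then have "1 / sqrt (Suc d) * (1 + 1 / (8 * d)) \<le> 1 / sqrt (Suc d) * (sqrt (Suc d) / sqrt d)"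
    by (intro mult_left_mono) auto
  then show ?thesis
    using d by (simp add: power_divide algebra_simps)
qed

text \<open>Induction over the first coordinate. In each layer the neighbourhood consists of the
  neighbourhood inside the layer and the copy of the set from the other layer, both in the same
  parity class; densities are taken relative to that class. For \<open>d = 1\<close> a parity class
  is a single vertex and the gain vanishes.\<close>

lemma cube_isoperimetry:
  assumes "d \<ge> 1" "A \<subseteq> parity_class d s"
  shows "real (card (\<Union>(cube_nbrs ` A))) \<ge> card A + card A * (1 - card A / 2 ^ (d - 1)) / sqrt d"
  using assms
proof (induction d arbitrary: A s rule: dec_induct)
  case base
  have "card A \<le> 1"
    using card_mono[OF finite_parity_class base] card_parity_class[of 1 s] by simp
  then consider "card A = 0" | a where "A = {a}"
    by (metis One_nat_def card_1_singletonE le_Suc_eq le_zero_eq)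
  then show ?case
  proof cases
    case 2
    then have "length a = 1" using base by (auto simp: parity_class_def)
    then show ?thesis using 2 by (simp add: card_cube_nbrs)
  qed simp
next
  case (step d)
  define NN where "NN = (\<lambda>X. \<Union>(cube_nbrs ` X))"
  define A0 where "A0 = {x. False # x \<in> A}"
  define A1 where "A1 = {x. True # x \<in> A}"
  define M where "M = (2::real) ^ (d - 1)"
  have M: "M > 0" "2 ^ (Suc d - 1) = 2 * M" using step(1) by (auto simp: M_def) (cases d; simp)
  have A: "A = Cons False ` A0 \<union> Cons True ` A1"
    using step.prems by (auto simp: A0_def A1_def parity_class_Suc)
  have A01: "A0 \<subseteq> parity_class d s" "A1 \<subseteq> parity_class d (\<not> s)"
    using step.prems by (auto simp: A0_def A1_def parity_class_def)
  have fin: "finite A0" "finite A1"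
    using A01 finite_parity_class finite_subset by blast+
  have finN: "finite (NN X)" if "finite X" for X
    using that finite_cube_nbrs by (auto simp: NN_def)
  have cA: "card A = card A0 + card A1"
    unfolding A using fin by (subst card_Un_disjoint) (auto simp: card_image)
  have N: "NN A = Cons False ` (NN A0 \<union> A1) \<union> Cons True ` (NN A1 \<union> A0)"
    unfolding A NN_def by (auto simp: cube_nbrs_Cons)
  have cN: "card (NN A) = card (NN A0 \<union> A1) + card (NN A1 \<union> A0)"
    unfolding N using fin finN by (subst card_Un_disjoint) (auto simp: card_image)
  define a where "a = card A0 / M"
  define b where "b = card A1 / M"
  define n0 where "n0 = card (NN A0 \<union> A1) / M"
  define n1 where "n1 = card (NN A1 \<union> A0) / M"
  define c where "c = 1 / sqrt d"
  define c' where "c' = 1 / sqrt (Suc d)"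
  have le: "card A0 \<le> card (NN A1 \<union> A0)" "card A1 \<le> card (NN A0 \<union> A1)"
    "card (NN A0) \<le> card (NN A0 \<union> A1)" "card (NN A1) \<le> card (NN A1 \<union> A0)"
    using fin finN by (auto intro!: card_mono)
  have IH: "card X / M + c * (card X / M * (1 - card X / M)) \<le> card (NN X) / M" if "X \<subseteq> parity_class d t" for X t
  proof -
    have "(card X + card X * (1 - card X / M) / sqrt d) / M \<le> card (NN X) / M"
      using step.IH[OF that] M(1) unfolding NN_def M_def by (intro divide_right_mono) auto
    then show ?thesis by (simp add: c_def add_divide_distrib)
  qed
  have bounds: "n0 \<ge> a + c * (a * (1 - a))" "n1 \<ge> b + c * (b * (1 - b))" "n0 \<ge> b" "n1 \<ge> a"
  proof -
    show "n0 \<ge> b" "n1 \<ge> a" using le M(1) by (auto simp: n0_def n1_def a_def b_def divide_right_mono)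
    have "card (NN A0) / M \<le> n0" "card (NN A1) / M \<le> n1"
      using le M(1) by (auto simp: n0_def n1_def divide_right_mono)
    then show "n0 \<ge> a + c * (a * (1 - a))" "n1 \<ge> b + c * (b * (1 - b))"
      using IH[OF A01(1)] IH[OF A01(2)] by (auto simp: a_def b_def)
  qed
  have ab: "0 \<le> a" "a \<le> 1" "0 \<le> b" "b \<le> 1"
  proof -
    have "card A0 \<le> 2 ^ (d - 1)" "card A1 \<le> 2 ^ (d - 1)"
      using card_mono[OF finite_parity_class A01(1)] card_mono[OF finite_parity_class A01(2)] card_parity_class[OF step(1)] by auto
    then have "real (card A0) \<le> M" "real (card A1) \<le> M"
      unfolding M_def by (metis of_nat_le_iff of_nat_numeral of_nat_power)+
    then show "0 \<le> a" "a \<le> 1" "0 \<le> b" "b \<le> 1"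
      using M(1) by (auto simp: a_def b_def divide_le_eq)
  qed
  have c: "0 \<le> c'" "c' \<le> 1" "0 \<le> c" "c \<le> 1" "c - c' \<ge> c' * c\<^sup>2 / 8"
    using step(1) sqrt_gap[OF step(1)] by (auto simp: c_def c'_def)
  have main: "(n0 + n1) / 2 \<ge> (a + b) / 2 + c' * ((a + b) / 2 * (1 - (a + b) / 2))"
  proof (cases "a \<le> b")
    case True
    then show ?thesis
      using isoperimetric_step[OF ab(1) True ab(4) c bounds(1,3,2)] by simp
  next
    case False
    then have "b \<le> a" by simp
    from isoperimetric_step[OF ab(3) this ab(2) c bounds(2,4,1)] show ?thesis
      by (simp add: add.commute)
  qed
  define m where "m = (a + b) / 2"
  have eqs: "card (NN A) = (n0 + n1) / 2 * (2 * M)" "card A / (2 * M) = m" "card A = m * (2 * M)"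
    using M(1) by (auto simp: m_def cN cA n0_def n1_def a_def b_def field_simps)
  have "card A + card A * (1 - card A / (2 * M)) * c' = (m + c' * (m * (1 - m))) * (2 * M)"
    unfolding eqs(2) unfolding eqs(3) by (simp add: algebra_simps)
  also have "\<dots> \<le> card (NN A)"
    unfolding eqs(1) m_def using main M(1) by (intro mult_right_mono) auto
  finally have "real (card (NN A)) \<ge> card A + card A * (1 - card A / (2 * M)) * c'" .
  then show ?case
    unfolding M(2) by (simp add: c'_def NN_def)
qed

lemma hypercube_cube_like:
  assumes d: "d \<ge> 1"
  shows "cube_like d (parity_class d True) (parity_class d False) cube_nbrs"
proof
  fix u v assume "u \<in> parity_class d True" "v \<in> parity_class d False"
  show "(v \<in> cube_nbrs u) = (u \<in> cube_nbrs v)"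
    by (simp add: cube_nbrs_def hc_adj_sym)
next
  fix u u' assume "u \<in> parity_class d True" "u' \<in> parity_class d True" "u \<noteq> u'"
  then show "card (cube_nbrs u \<inter> cube_nbrs u') \<le> 2"
    by (intro codegree_cube_nbrs) (auto simp: parity_class_def)
next
  fix u u' assume "u \<in> parity_class d False" "u' \<in> parity_class d False" "u \<noteq> u'"
  then show "card (cube_nbrs u \<inter> cube_nbrs u') \<le> 2"
    by (intro codegree_cube_nbrs) (auto simp: parity_class_def)
next
  show "cube_nbrs u \<subseteq> parity_class d False" if "u \<in> parity_class d True" for u
    using cube_nbrs_class[OF that] by simp
  show "cube_nbrs u \<subseteq> parity_class d True" if "u \<in> parity_class d False" for u
    using cube_nbrs_class[OF that] by simp
  show "card (cube_nbrs u) = d" if "u \<in> parity_class d True" for u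
    using that by (simp add: card_cube_nbrs parity_class_def)
  show "card (cube_nbrs u) = d" if "u \<in> parity_class d False" for u
    using that by (simp add: card_cube_nbrs parity_class_def)
qed (use d card_parity_class[OF d] in \<open>auto intro: finite_parity_class cube_isoperimetry[simplified]\<close>)

section \<open>Moments of the number of independent sets in the random subgraph\<close>

lemma sum_subset_binomial:
  fixes p :: real
  assumes "finite S"
  shows "(\<Sum>F\<in>Pow S. p ^ card F * (1 - p) ^ (card S - card F)) = 1"
proof -
  have "(\<Sum>F\<in>Pow S. p ^ card F * (1 - p) ^ (card S - card F))
      = (\<Sum>k\<le>card S. real (card S choose k) * (p ^ k * (1 - p) ^ (card S - k)))"
    using sum_Pow_card[OF assms, of "\<lambda>k. p ^ k * (1 - p) ^ (card S - k)"] .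
  also have "\<dots> = (p + (1 - p)) ^ card S"
    by (subst binomial_ring) (simp add: mult.assoc)
  finally show ?thesis by simp
qed

lemma sum_subset_avoid:
  fixes p :: real
  assumes M: "finite M" and T: "T \<subseteq> M"
  shows "(\<Sum>F\<in>Pow M. p ^ card F * (1 - p) ^ (card M - card F) * (if F \<inter> T = {} then 1 else 0)) = (1 - p) ^ card T"
proof -
  have finT: "finite T" using assms finite_subset by auto
  have "(\<Sum>F\<in>Pow M. p ^ card F * (1 - p) ^ (card M - card F) * (if F \<inter> T = {} then 1 else 0))
      = (\<Sum>F\<in>Pow (M - T). p ^ card F * (1 - p) ^ (card M - card F))"
    using M by (intro sum.mono_neutral_cong_right) auto
  also have "\<dots> = (\<Sum>F\<in>Pow (M - T). (1 - p) ^ card T * (p ^ card F * (1 - p) ^ (card (M - T) - card F)))"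
  proof (intro sum.cong refl)
    fix F assume F: "F \<in> Pow (M - T)"
    have "card M = card T + card (M - T)"
      using T M finT by (simp add: card_Diff_subset card_mono)
    moreover have "card F \<le> card (M - T)"
      using F M by (intro card_mono) auto
    ultimately have "card M - card F = card T + (card (M - T) - card F)" by simp
    then show "p ^ card F * (1 - p) ^ (card M - card F) = (1 - p) ^ card T * (p ^ card F * (1 - p) ^ (card (M - T) - card F))"
      by (simp add: power_add)
  qed
  also have "\<dots> = (1 - p) ^ card T"
    using M by (simp add: sum_distrib_left[symmetric] sum_subset_binomial)
  finally show ?thesis .
qed

definition cube_expect :: "nat \<Rightarrow> real \<Rightarrow> (bool list set set \<Rightarrow> real) \<Rightarrow> real" where
  "cube_expect d p X = (\<Sum>F\<in>Pow (hc_edges d). subgraph_prob d p F * X F)"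

definition spanned_edges :: "nat \<Rightarrow> bool list set \<Rightarrow> bool list set set" where
  "spanned_edges d I = {e \<in> hc_edges d. e \<subseteq> I}"

text \<open>With the family of configurations as a parameter, all, typical and doubly counted
  independent sets share the same moment formulas.\<close>

definition indep_count :: "nat \<Rightarrow> (bool list set \<times> bool list set) set \<Rightarrow> bool list set set \<Rightarrow> real" where
  "indep_count d \<P> F = (\<Sum>(A, B)\<in>\<P>. if F \<inter> spanned_edges d (A \<union> B) = {} then 1 else 0)"

lemma hc_verts_split:
  "hc_verts d = parity_class d True \<union> parity_class d False"
  "parity_class d True \<inter> parity_class d False = {}"
  by (auto simp: hc_verts_def parity_class_def)

lemma finite_hc_edges: "finite (hc_edges d)"
proof (rule finite_subset)
  show "hc_edges d \<subseteq> Pow (hc_verts d)" by (auto simp: hc_edges_def)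
  show "finite (Pow (hc_verts d))" by (simp add: hc_verts_split finite_parity_class)
qed

lemma subgraph_prob_nonneg: "0 \<le> p \<Longrightarrow> p \<le> 1 \<Longrightarrow> subgraph_prob d p F \<ge> 0"
  by (simp add: subgraph_prob_def)

lemma cube_expect_one: "cube_expect d p (\<lambda>_. 1) = 1"
  using sum_subset_binomial[OF finite_hc_edges] by (simp add: cube_expect_def subgraph_prob_def)

lemma cube_expect_avoid:
  "T \<subseteq> hc_edges d \<Longrightarrow> cube_expect d p (\<lambda>F. if F \<inter> T = {} then 1 else 0) = (1 - p) ^ card T"
  unfolding cube_expect_def subgraph_prob_def by (rule sum_subset_avoid[OF finite_hc_edges])

lemma cube_expect_add: "cube_expect d p (\<lambda>F. X F + Y F) = cube_expect d p X + cube_expect d p Y"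
  by (simp add: cube_expect_def distrib_left sum.distrib)

lemma cube_expect_cmult: "cube_expect d p (\<lambda>F. c * X F) = c * cube_expect d p X"
  by (simp add: cube_expect_def sum_distrib_left mult_ac)

lemma cube_expect_sum: "cube_expect d p (\<lambda>F. \<Sum>i\<in>S. X i F) = (\<Sum>i\<in>S. cube_expect d p (X i))"
  unfolding cube_expect_def by (simp add: sum_distrib_left) (rule sum.swap)

lemma cube_expect_mono:
  assumes "0 \<le> p" "p \<le> 1" "\<And>F. F \<subseteq> hc_edges d \<Longrightarrow> X F \<le> Y F"
  shows "cube_expect d p X \<le> cube_expect d p Y"
  unfolding cube_expect_def using assms subgraph_prob_nonneg by (intro sum_mono mult_left_mono) auto

section \<open>Moments in the random subgraph in terms of edge sets\<close>

context
  fixes d :: nat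
  assumes d: "d \<ge> 1"
begin

interpretation cube: cube_like d "parity_class d True" "parity_class d False" cube_nbrs
  by (rule hypercube_cube_like[OF d])

lemma spanned_edges_eq:
  assumes "A \<subseteq> parity_class d True" "B \<subseteq> parity_class d False"
  shows "spanned_edges d (A \<union> B) = (\<lambda>(u, v). {u, v}) ` cube.pairs A B"
proof (intro equalityI subsetI)
  fix e assume e: "e \<in> spanned_edges d (A \<union> B)"
  then obtain x y where xy: "e = {x, y}" "hc_adj x y" "x \<in> A \<union> B" "y \<in> A \<union> B"
    by (auto simp: spanned_edges_def hc_edges_def)
  have par: "even (length (filter id y)) = odd (length (filter id x))"
    using cube_nbrs_parity[of y x] xy(2) by (simp add: cube_nbrs_def)
  show "e \<in> (\<lambda>(u, v). {u, v}) ` cube.pairs A B"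
  proof (cases "x \<in> A")
    case True
    then have "y \<in> B" using par xy(4) assms by (auto simp: parity_class_def)
    then show ?thesis
      using True xy by (intro image_eqI[of _ _ "(x, y)"]) (auto simp: cube.pairs_def cube_nbrs_def)
  next
    case False
    then have "x \<in> B" "y \<in> A" using par xy assms by (auto simp: parity_class_def)
    then show ?thesis
      using xy hc_adj_sym by (intro image_eqI[of _ _ "(y, x)"]) (auto simp: cube.pairs_def cube_nbrs_def)
  qed
next
  fix e assume "e \<in> (\<lambda>(u, v). {u, v}) ` cube.pairs A B"
  then obtain u v where uv: "e = {u, v}" "u \<in> A" "v \<in> B" "hc_adj u v"
    by (auto simp: cube.pairs_def cube_nbrs_def)
  then have "u \<in> hc_verts d" "v \<in> hc_verts d"
    using assms hc_verts_split by auto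
  then show "e \<in> spanned_edges d (A \<union> B)"
    using uv by (auto simp: spanned_edges_def hc_edges_def)
qed

lemma card_spanned_edges_union:
  assumes "A \<subseteq> parity_class d True" "B \<subseteq> parity_class d False"
    "A' \<subseteq> parity_class d True" "B' \<subseteq> parity_class d False"
  shows "card (spanned_edges d (A \<union> B) \<union> spanned_edges d (A' \<union> B')) = card (cube.pairs A B \<union> cube.pairs A' B')"
proof -
  have "inj_on (\<lambda>(u, v). {u, v}) (parity_class d True \<times> parity_class d False)"
    using hc_verts_split(2)[of d] by (auto simp: inj_on_def doubleton_eq_iff)
  then have "inj_on (\<lambda>(u, v). {u, v}) (cube.pairs A B \<union> cube.pairs A' B')"
    by (rule inj_on_subset) (use assms in \<open>auto simp: cube.pairs_def\<close>)
  then show ?thesis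
    unfolding spanned_edges_eq[OF assms(1,2)] spanned_edges_eq[OF assms(3,4)] image_Un[symmetric] by (rule card_image)
qed

lemma expect_indep_count:
  assumes "\<P> \<subseteq> Pow (parity_class d True) \<times> Pow (parity_class d False)"
  shows "cube_expect d p (indep_count d \<P>) = (\<Sum>(A, B)\<in>\<P>. (1 - p) ^ card (cube.pairs A B))"
proof -
  have "cube_expect d p (indep_count d \<P>)
      = (\<Sum>x\<in>\<P>. cube_expect d p (\<lambda>F. case x of (A, B) \<Rightarrow> if F \<inter> spanned_edges d (A \<union> B) = {} then 1 else 0))"
    unfolding indep_count_def by (rule cube_expect_sum)
  also have "\<dots> = (\<Sum>(A, B)\<in>\<P>. (1 - p) ^ card (cube.pairs A B))"
  proof (intro sum.cong refl)
    fix x assume "x \<in> \<P>"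
    then obtain A B where x: "x = (A, B)" "A \<subseteq> parity_class d True" "B \<subseteq> parity_class d False"
      using assms by auto
    have "spanned_edges d (A \<union> B) \<subseteq> hc_edges d" by (auto simp: spanned_edges_def)
    then show "cube_expect d p (\<lambda>F. case x of (A, B) \<Rightarrow> if F \<inter> spanned_edges d (A \<union> B) = {} then 1 else 0)
        = (case x of (A, B) \<Rightarrow> (1 - p) ^ card (cube.pairs A B))"
      using card_spanned_edges_union[OF x(2,3) x(2,3)] x(1) by (simp add: cube_expect_avoid)
  qed
  finally show ?thesis .
qed

text \<open>The product of two avoidance indicators is the indicator of avoiding the union, so only
  the size of the union of the edge sets enters.\<close>

lemma expect_indep_count_mult:
  assumes "\<P> \<subseteq> Pow (parity_class d True) \<times> Pow (parity_class d False)"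
    "\<Q> \<subseteq> Pow (parity_class d True) \<times> Pow (parity_class d False)"
  shows "cube_expect d p (\<lambda>F. indep_count d \<P> F * indep_count d \<Q> F)
     = (\<Sum>(A, B)\<in>\<P>. \<Sum>(A', B')\<in>\<Q>. (1 - p) ^ card (cube.pairs A B \<union> cube.pairs A' B'))"
proof -
  define g where "g F = (\<lambda>(A, B). if F \<inter> spanned_edges d (A \<union> B) = {} then 1 else (0::real))" for F
  have "cube_expect d p (\<lambda>F. indep_count d \<P> F * indep_count d \<Q> F)
      = (\<Sum>x\<in>\<P>. \<Sum>y\<in>\<Q>. cube_expect d p (\<lambda>F. g F x * g F y))"
    by (simp add: indep_count_def g_def[symmetric] sum_product cube_expect_sum)
  also have "\<dots> = (\<Sum>(A, B)\<in>\<P>. \<Sum>(A', B')\<in>\<Q>. (1 - p) ^ card (cube.pairs A B \<union> cube.pairs A' B'))"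
  proof (rule sum.cong[OF refl])
    fix x assume "x \<in> \<P>"
    then obtain A B where x: "x = (A, B)" "A \<subseteq> parity_class d True" "B \<subseteq> parity_class d False"
      using assms by auto
    have "(\<Sum>y\<in>\<Q>. cube_expect d p (\<lambda>F. g F x * g F y)) = (\<Sum>(A', B')\<in>\<Q>. (1 - p) ^ card (cube.pairs A B \<union> cube.pairs A' B'))"
    proof (rule sum.cong[OF refl])
      fix y assume "y \<in> \<Q>"
      then obtain A' B' where y: "y = (A', B')" "A' \<subseteq> parity_class d True" "B' \<subseteq> parity_class d False"
        using assms by auto
      have "(\<lambda>F. g F x * g F y) = (\<lambda>F. if F \<inter> (spanned_edges d (A \<union> B) \<union> spanned_edges d (A' \<union> B')) = {} then 1 else 0)"
        by (auto simp: g_def x(1) y(1) fun_eq_iff Int_Un_distrib)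
      moreover have "spanned_edges d (A \<union> B) \<union> spanned_edges d (A' \<union> B') \<subseteq> hc_edges d" by (auto simp: spanned_edges_def)
      ultimately show "cube_expect d p (\<lambda>F. g F x * g F y) = (case y of (A', B') \<Rightarrow> (1 - p) ^ card (cube.pairs A B \<union> cube.pairs A' B'))"
        using card_spanned_edges_union[OF x(2,3) y(2,3)] y(1) by (simp add: cube_expect_avoid)
    qed
    then show "(\<Sum>y\<in>\<Q>. cube_expect d p (\<lambda>F. g F x * g F y))
        = (case x of (A, B) \<Rightarrow> \<Sum>(A', B')\<in>\<Q>. (1 - p) ^ card (cube.pairs A B \<union> cube.pairs A' B'))"
      by (simp add: x(1))
  qed
  finally show ?thesis .
qed

lemma num_indep_eq:
  assumes F: "F \<subseteq> hc_edges d"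
  shows "real (num_indep d F) = indep_count d (Pow (parity_class d True) \<times> Pow (parity_class d False)) F"
proof -
  let ?E = "parity_class d True" and ?O = "parity_class d False"
  have eq: "indep_sets d F = {I\<in>Pow (hc_verts d). F \<inter> spanned_edges d I = {}}"
    using F by (auto simp: indep_sets_def spanned_edges_def)
  have inj: "inj_on (\<lambda>(A, B). A \<union> B) (Pow ?E \<times> Pow ?O)"
    using hc_verts_split(2)[of d] by (intro inj_onI) (clarsimp, blast)
  have img: "(\<lambda>(A, B). A \<union> B) ` (Pow ?E \<times> Pow ?O) = Pow (hc_verts d)"
  proof (intro equalityI subsetI)
    fix I assume "I \<in> Pow (hc_verts d)"
    then have "I = (I \<inter> ?E) \<union> (I \<inter> ?O)" using hc_verts_split(1)[of d] by auto
    then show "I \<in> (\<lambda>(A, B). A \<union> B) ` (Pow ?E \<times> Pow ?O)"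
      by (intro image_eqI[of _ _ "(I \<inter> ?E, I \<inter> ?O)"]) auto
  qed (use hc_verts_split(1)[of d] in auto)
  have fin: "finite (Pow (hc_verts d))"
    by (simp add: hc_verts_split finite_parity_class)
  have "real (num_indep d F) = (\<Sum>I\<in>Pow (hc_verts d). if F \<inter> spanned_edges d I = {} then 1 else 0)"
    unfolding num_indep_def eq using fin by (simp add: sum.If_cases Int_def conj_commute)
  also have "\<dots> = (\<Sum>x\<in>Pow ?E \<times> Pow ?O. if F \<inter> spanned_edges d (case x of (A, B) \<Rightarrow> A \<union> B) = {} then 1 else 0)"
    unfolding img[symmetric] by (simp add: sum.reindex[OF inj])
  also have "\<dots> = indep_count d (Pow ?E \<times> Pow ?O) F"
    unfolding indep_count_def by (simp add: case_prod_unfold)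
  finally show ?thesis .
qed

abbreviation "good_even \<equiv> {A. A \<subseteq> parity_class d True \<and> cube.good A} \<times> Pow (parity_class d False)"
abbreviation "good_odd \<equiv> Pow (parity_class d True) \<times> {B. B \<subseteq> parity_class d False \<and> cube.good B}"

text \<open>Sets good on both sides are counted twice, which keeps each half an explicit sum;
  \<open>overlap_count\<close> is the correction in inclusion-exclusion.\<close>

definition typical_count :: "bool list set set \<Rightarrow> real" where
  "typical_count F = indep_count d good_even F + indep_count d good_odd F"

definition overlap_count :: "bool list set set \<Rightarrow> real" where
  "overlap_count F = indep_count d (good_even \<inter> good_odd) F"

lemma indep_count_nonneg: "indep_count d \<P> F \<ge> 0"
  unfolding indep_count_def by (intro sum_nonneg) auto

lemma overlap_count_nonneg: "overlap_count F \<ge> 0"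
  unfolding overlap_count_def by (rule indep_count_nonneg)

lemma typical_le_num_indep:
  assumes "F \<subseteq> hc_edges d"
  shows "typical_count F \<le> real (num_indep d F) + overlap_count F"
proof -
  let ?E = "parity_class d True" and ?O = "parity_class d False"
  have fin: "finite (Pow ?E \<times> Pow ?O)" by (simp add: finite_parity_class)
  have fin2: "finite good_even" "finite good_odd"
    by (rule finite_subset[OF _ fin], blast)+
  have "typical_count F = indep_count d (good_even \<union> good_odd) F + overlap_count F"
    unfolding typical_count_def overlap_count_def indep_count_def by (simp only: sum.union_inter[OF fin2])
  also have "indep_count d (good_even \<union> good_odd) F \<le> indep_count d (Pow ?E \<times> Pow ?O) F"
    unfolding indep_count_def using fin by (intro sum_mono2) (auto split: if_splits)
  finally show ?thesis using num_indep_eq[OF assms] by simp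
qed

lemma expected_indep_eq:
  "expected_indep d p = (\<Sum>(A, B)\<in>Pow (parity_class d True) \<times> Pow (parity_class d False). (1 - p) ^ card (cube.pairs A B))"
proof -
  have "expected_indep d p = cube_expect d p (indep_count d (Pow (parity_class d True) \<times> Pow (parity_class d False)))"
    unfolding expected_indep_def cube_expect_def using num_indep_eq by (intro sum.cong refl) auto
  then show ?thesis by (simp add: expect_indep_count)
qed

text \<open>Exchanging the sides reverses every pair, so the odd case of the second moment follows
  from the even one.\<close>

lemma card_dual_pairs_union:
  "card (cube_like.pairs cube_nbrs B A \<union> cube_like.pairs cube_nbrs B' A') = card (cube.pairs A B \<union> cube.pairs A' B')"
proof -
  have swap: "prod.swap ` cube.pairs X Y = cube.pairs Y X" for X Y
  proof (intro equalityI subsetI)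
    fix z assume "z \<in> cube.pairs Y X"
    then have "prod.swap z \<in> cube.pairs X Y"
      by (auto simp: cube.pairs_def cube_nbrs_def hc_adj_sym)
    then show "z \<in> prod.swap ` cube.pairs X Y"
      by (intro image_eqI[of _ _ "prod.swap z"]) auto
  qed (auto simp: cube.pairs_def cube_nbrs_def hc_adj_sym)
  have "prod.swap ` (cube.pairs A B \<union> cube.pairs A' B') = cube.pairs B A \<union> cube.pairs B' A'"
    by (simp add: image_Un swap)
  then show ?thesis
    by (metis card_image inj_swap inj_on_subset subset_UNIV)
qed

lemma card_parity: "card (parity_class d s) = 2 ^ (d - 1)"
  by (rule card_parity_class[OF d])

lemma expected_indep_le:
  assumes ld: "large_dim d" and p: "p \<le> 1" "p \<ge> 2/3"
    and c1: "real d ^ 4 * (2/3) powr (d / 3) \<le> 1"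
    and c2: "1 \<le> (1 + 1 / (2 * sqrt d)) * (1 - d powr (-6/10))"
    and c3: "d powr (-6/10) \<le> 1/2"
  shows "expected_indep d p \<le> 2 ^ (2 ^ (d - 1)) * (2 * exp (2 ^ (d - 1) * ((2 - p) / 2) ^ d + polymer_error d) + balanced_error d)"
  using cube.first_moment_le[OF ld, of "1 - p"] c1 c2 c3 p
  unfolding expected_indep_eq card_parity by simp

lemma expect_typical_ge:
  assumes p: "0 \<le> p" "p \<le> 1"
  shows "cube_expect d p typical_count \<ge>
     2 * 2 ^ (2 ^ (d - 1)) * ((1 + ((2 - p) / 2) ^ d) ^ 2 ^ (d - 1) * (1 - 2 ^ (d - 1) * real d ^ 2 * (((2 - p) / 2) ^ d)\<^sup>2))"
proof -
  interpret dual: cube_like d "parity_class d False" "parity_class d True" cube_nbrs by (rule cube.dual)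
  define x where "x = ((1 + (1 - p)) / 2) ^ d"
  have x: "x \<ge> 0" using p by (simp add: x_def)
  define L where "L = (1 + x) ^ 2 ^ (d - 1) * (1 - 2 ^ (d - 1) * real d ^ 2 * x\<^sup>2)"
  have 1: "cube_expect d p (indep_count d good_even) \<ge> 2 ^ (2 ^ (d - 1)) * L"
  proof -
    have "cube_expect d p (indep_count d good_even) = (\<Sum>(A, B)\<in>good_even. (1 - p) ^ card (cube.pairs A B))"
      by (rule expect_indep_count) auto
    also have "\<dots> = (\<Sum>A\<in>{A. A \<subseteq> parity_class d True \<and> cube.good A}. \<Sum>B\<in>Pow (parity_class d False). (1 - p) ^ cube.edges_between A B)"
      by (subst sum.cartesian_product[symmetric]) (auto intro!: sum.cong simp: cube.card_pairs)
    also have "\<dots> = (\<Sum>A\<in>{A. A \<subseteq> parity_class d True \<and> cube.good A}. 2 ^ (2 ^ (d - 1)) * x ^ card A)"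
      by (intro sum.cong refl) (auto simp: cube.sum_edges_between cube.w_good card_parity x_def)
    also have "\<dots> = 2 ^ (2 ^ (d - 1)) * (\<Sum>A\<in>{A. A \<subseteq> parity_class d True \<and> cube.good A}. x ^ card A)"
      by (simp add: sum_distrib_left)
    finally show ?thesis
      using cube.good_sum_ge[OF x] unfolding card_parity L_def by simp
  qed
  have 2: "cube_expect d p (indep_count d good_odd) \<ge> 2 ^ (2 ^ (d - 1)) * L"
  proof -
    have "cube_expect d p (indep_count d good_odd) = (\<Sum>(A, B)\<in>good_odd. (1 - p) ^ card (cube.pairs A B))"
      by (rule expect_indep_count) auto
    also have "\<dots> = (\<Sum>A\<in>Pow (parity_class d True). \<Sum>B\<in>{B. B \<subseteq> parity_class d False \<and> cube.good B}. (1 - p) ^ dual.edges_between B A)"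
    proof (subst sum.cartesian_product[symmetric], intro sum.cong refl)
      fix A B assume "A \<in> Pow (parity_class d True)" "B \<in> {B. B \<subseteq> parity_class d False \<and> cube.good B}"
      then show "(1 - p) ^ card (cube.pairs A B) = (1 - p) ^ dual.edges_between B A"
        using cube.sum_degree_swap[of A B] by (simp add: cube.card_pairs cube.edges_between_def)
    qed
    also have "\<dots> = (\<Sum>B\<in>{B. B \<subseteq> parity_class d False \<and> cube.good B}. \<Sum>A\<in>Pow (parity_class d True). (1 - p) ^ dual.edges_between B A)"
      by (rule sum.swap)
    also have "\<dots> = (\<Sum>B\<in>{B. B \<subseteq> parity_class d False \<and> cube.good B}. 2 ^ (2 ^ (d - 1)) * x ^ card B)"
      by (intro sum.cong refl) (auto simp: dual.sum_edges_between dual.w_good card_parity x_def)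
    also have "\<dots> = 2 ^ (2 ^ (d - 1)) * (\<Sum>B\<in>{B. B \<subseteq> parity_class d False \<and> cube.good B}. x ^ card B)"
      by (simp add: sum_distrib_left)
    finally show ?thesis
      using dual.good_sum_ge[OF x] unfolding card_parity L_def by simp
  qed
  have "cube_expect d p typical_count = cube_expect d p (indep_count d good_even) + cube_expect d p (indep_count d good_odd)"
    unfolding typical_count_def by (rule cube_expect_add)
  with 1 2 show ?thesis by (simp add: L_def x_def mult.assoc)
qed

text \<open>All probabilities are bounded by 1, since already the number of such pairs is negligible
  against 2^n.\<close>

lemma expect_overlap_le:
  assumes p: "0 \<le> p" "p \<le> 1"
  shows "cube_expect d p overlap_count \<le> (exp (2 ^ (d - 1) / d) * d powr (2 ^ (d - 1) / d))\<^sup>2"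
proof -
  interpret dual: cube_like d "parity_class d False" "parity_class d True" cube_nbrs by (rule cube.dual)
  define GE where "GE = {A. A \<subseteq> parity_class d True \<and> cube.good A}"
  define GO where "GO = {B. B \<subseteq> parity_class d False \<and> cube.good B}"
  have eq: "good_even \<inter> good_odd = GE \<times> GO" by (auto simp: GE_def GO_def)
  have "cube_expect d p overlap_count = (\<Sum>(A, B)\<in>GE \<times> GO. (1 - p) ^ card (cube.pairs A B))"
    unfolding overlap_count_def eq by (rule expect_indep_count) (auto simp: GE_def GO_def)
  also have "\<dots> \<le> (\<Sum>(A, B)\<in>GE \<times> GO. 1)"
    using p by (intro sum_mono) (auto simp: power_le_one)
  also have "\<dots> = real (card GE) * real (card GO)"
    by (simp add: case_prod_unfold card_cartesian_product)
  also have "\<dots> \<le> (exp (2 ^ (d - 1) / d) * d powr (2 ^ (d - 1) / d)) * (exp (2 ^ (d - 1) / d) * d powr (2 ^ (d - 1) / d))"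
    using cube.count_good dual.count_good unfolding card_parity GE_def GO_def
    by (intro mult_mono) auto
  finally show ?thesis by (simp add: power2_eq_square)
qed

text \<open>In each of the three products the sums are reordered so that the good parts stand
  outside and the free parts inside, as in the moment bounds; the mixed product occurs
  twice.\<close>

lemma expect_typical_square_le:
  assumes p: "0 \<le> p" "p \<le> 1"
  defines "x \<equiv> ((2 - p) / 2) ^ d" and "y \<equiv> ((4 - 3 * p) / 4) ^ d"
  shows "cube_expect d p (\<lambda>F. (typical_count F)\<^sup>2) \<le> 2 * 4 ^ (2 ^ (d - 1)) *
     ((1 + 2 * x + y) ^ 2 ^ (d - 1) + (1 + x) ^ 2 ^ (d - 1) * (1 + x * (1 + 4 * x) ^ d) ^ 2 ^ (d - 1))"
proof -
  interpret dual: cube_like d "parity_class d False" "parity_class d True" cube_nbrs by (rule cube.dual)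
  let ?E = "parity_class d True" and ?O = "parity_class d False"
  define GE where "GE = {A. A \<subseteq> ?E \<and> cube.good A}"
  define GO where "GO = {B. B \<subseteq> ?O \<and> cube.good B}"
  have xq: "x = ((1 + (1 - p)) / 2) ^ d" "y = ((1 + 3 * (1 - p)) / 4) ^ d"
    by (simp_all add: x_def y_def)
  define q where "q = 1 - p"
  have q: "0 \<le> q" "q \<le> 1" using p by (auto simp: q_def)
  have ee: "cube_expect d p (\<lambda>F. indep_count d good_even F * indep_count d good_even F) \<le> 4 ^ (2 ^ (d - 1)) * (1 + 2 * x + y) ^ 2 ^ (d - 1)"
  proof -
    have "cube_expect d p (\<lambda>F. indep_count d good_even F * indep_count d good_even F)
      = (\<Sum>(A, B)\<in>good_even. \<Sum>(A', B')\<in>good_even. q ^ card (cube.pairs A B \<union> cube.pairs A' B'))"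
      unfolding q_def by (rule expect_indep_count_mult) auto
    also have "\<dots> = (\<Sum>A\<in>GE. \<Sum>B\<in>Pow ?O. \<Sum>A'\<in>GE. \<Sum>B'\<in>Pow ?O. q ^ card (cube.pairs A B \<union> cube.pairs A' B'))"
      by (simp add: sum.cartesian_product[symmetric] GE_def)
    also have "\<dots> = (\<Sum>A\<in>GE. \<Sum>A'\<in>GE. \<Sum>B\<in>Pow ?O. \<Sum>B'\<in>Pow ?O. q ^ card (cube.pairs A B \<union> cube.pairs A' B'))"
      by (rule sum.cong[OF refl], rule sum.swap)
    also have "\<dots> = (\<Sum>(A, A')\<in>GE \<times> GE. \<Sum>(B, B')\<in>Pow ?O \<times> Pow ?O. q ^ card (cube.pairs A B \<union> cube.pairs A' B'))"
      by (simp add: sum.cartesian_product[symmetric])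
    also have "\<dots> \<le> 4 ^ (2 ^ (d - 1)) * (1 + 2 * x + y) ^ 2 ^ (d - 1)"
      using cube.second_moment_same_side[OF q(1)] unfolding card_parity GE_def xq q_def by simp
    finally show ?thesis .
  qed
  have oo: "cube_expect d p (\<lambda>F. indep_count d good_odd F * indep_count d good_odd F) \<le> 4 ^ (2 ^ (d - 1)) * (1 + 2 * x + y) ^ 2 ^ (d - 1)"
  proof -
    have "cube_expect d p (\<lambda>F. indep_count d good_odd F * indep_count d good_odd F)
      = (\<Sum>(A, B)\<in>good_odd. \<Sum>(A', B')\<in>good_odd. q ^ card (cube.pairs A B \<union> cube.pairs A' B'))"
      unfolding q_def by (rule expect_indep_count_mult) auto
    also have "\<dots> = (\<Sum>A\<in>Pow ?E. \<Sum>B\<in>GO. \<Sum>A'\<in>Pow ?E. \<Sum>B'\<in>GO. q ^ card (cube.pairs A B \<union> cube.pairs A' B'))"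
      by (simp add: sum.cartesian_product[symmetric] GO_def)
    also have "\<dots> = (\<Sum>A\<in>Pow ?E. \<Sum>B\<in>GO. \<Sum>A'\<in>Pow ?E. \<Sum>B'\<in>GO. q ^ card (dual.pairs B A \<union> dual.pairs B' A'))"
    proof (intro sum.cong refl)
      fix A B A' B' assume "A \<in> Pow ?E" "B \<in> GO" "A' \<in> Pow ?E" "B' \<in> GO"
      then show "q ^ card (cube.pairs A B \<union> cube.pairs A' B') = q ^ card (dual.pairs B A \<union> dual.pairs B' A')"
        by (simp only: card_dual_pairs_union)
    qed
    also have "\<dots> = (\<Sum>B\<in>GO. \<Sum>A\<in>Pow ?E. \<Sum>A'\<in>Pow ?E. \<Sum>B'\<in>GO. q ^ card (dual.pairs B A \<union> dual.pairs B' A'))"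
      by (rule sum.swap)
    also have "\<dots> = (\<Sum>B\<in>GO. \<Sum>A\<in>Pow ?E. \<Sum>B'\<in>GO. \<Sum>A'\<in>Pow ?E. q ^ card (dual.pairs B A \<union> dual.pairs B' A'))"
      by (rule sum.cong[OF refl], rule sum.cong[OF refl], rule sum.swap)
    also have "\<dots> = (\<Sum>B\<in>GO. \<Sum>B'\<in>GO. \<Sum>A\<in>Pow ?E. \<Sum>A'\<in>Pow ?E. q ^ card (dual.pairs B A \<union> dual.pairs B' A'))"
      by (rule sum.cong[OF refl], rule sum.swap)
    also have "\<dots> = (\<Sum>(B, B')\<in>GO \<times> GO. \<Sum>(A, A')\<in>Pow ?E \<times> Pow ?E. q ^ card (dual.pairs B A \<union> dual.pairs B' A'))"
      by (simp add: sum.cartesian_product[symmetric])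
    also have "\<dots> \<le> 4 ^ (2 ^ (d - 1)) * (1 + 2 * x + y) ^ 2 ^ (d - 1)"
      using dual.second_moment_same_side[OF q(1)] unfolding card_parity GO_def xq q_def by simp
    finally show ?thesis .
  qed
  have eo: "cube_expect d p (\<lambda>F. indep_count d good_even F * indep_count d good_odd F)
      \<le> 4 ^ (2 ^ (d - 1)) * ((1 + x) ^ 2 ^ (d - 1) * (1 + x * (1 + 4 * x) ^ d) ^ 2 ^ (d - 1))"
  proof -
    have "cube_expect d p (\<lambda>F. indep_count d good_even F * indep_count d good_odd F)
      = (\<Sum>(A, B)\<in>good_even. \<Sum>(A', B')\<in>good_odd. q ^ card (cube.pairs A B \<union> cube.pairs A' B'))"
      unfolding q_def by (rule expect_indep_count_mult) auto
    also have "\<dots> = (\<Sum>A\<in>GE. \<Sum>B\<in>Pow ?O. \<Sum>A'\<in>Pow ?E. \<Sum>B'\<in>GO. q ^ card (cube.pairs A B \<union> cube.pairs A' B'))"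
      by (simp add: sum.cartesian_product[symmetric] GO_def GE_def)
    also have "\<dots> = (\<Sum>A\<in>GE. \<Sum>A'\<in>Pow ?E. \<Sum>B\<in>Pow ?O. \<Sum>B'\<in>GO. q ^ card (cube.pairs A B \<union> cube.pairs A' B'))"
      by (rule sum.cong[OF refl], rule sum.swap)
    also have "\<dots> = (\<Sum>A\<in>GE. \<Sum>A'\<in>Pow ?E. \<Sum>B'\<in>GO. \<Sum>B\<in>Pow ?O. q ^ card (cube.pairs A B \<union> cube.pairs A' B'))"
      by (rule sum.cong[OF refl], rule sum.cong[OF refl], rule sum.swap)
    also have "\<dots> = (\<Sum>A\<in>GE. \<Sum>B'\<in>GO. \<Sum>A'\<in>Pow ?E. \<Sum>B\<in>Pow ?O. q ^ card (cube.pairs A B \<union> cube.pairs A' B'))"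
      by (rule sum.cong[OF refl], rule sum.swap)
    also have "\<dots> = (\<Sum>(A, B')\<in>GE \<times> GO. \<Sum>(A', B)\<in>Pow ?E \<times> Pow ?O. q ^ card (cube.pairs A B \<union> cube.pairs A' B'))"
      by (simp add: sum.cartesian_product[symmetric])
    also have "\<dots> \<le> 4 ^ (2 ^ (d - 1)) * ((1 + x) ^ 2 ^ (d - 1) * (1 + x * (1 + 4 * x) ^ d) ^ 2 ^ (d - 1))"
      using cube.second_moment_cross[OF q] unfolding card_parity GE_def GO_def xq q_def by (simp add: mult.assoc)
    finally show ?thesis .
  qed
  have "cube_expect d p (\<lambda>F. (typical_count F)\<^sup>2)
      = cube_expect d p (\<lambda>F. (indep_count d good_even F * indep_count d good_even F + indep_count d good_odd F * indep_count d good_odd F)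
          + 2 * (indep_count d good_even F * indep_count d good_odd F))"
    by (intro arg_cong[where f = "cube_expect d p"] ext) (simp add: typical_count_def power2_eq_square algebra_simps)
  also have "\<dots> = cube_expect d p (\<lambda>F. indep_count d good_even F * indep_count d good_even F)
      + cube_expect d p (\<lambda>F. indep_count d good_odd F * indep_count d good_odd F)
      + 2 * cube_expect d p (\<lambda>F. indep_count d good_even F * indep_count d good_odd F)"
    by (simp only: cube_expect_add cube_expect_cmult)
  finally show ?thesis
    using ee oo eo by (simp add: algebra_simps)
qed

end

section \<open>Asymptotics\<close>

lemma polymer_error_tendsto: "polymer_error \<longlonglongrightarrow> 0"
proof (rule tendsto_sandwich[where f = "\<lambda>_. 0"])
  define g where "g D = 81/16 * real D ^ 21 * (8/9) ^ D + real D ^ 29 * (8/9) ^ D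
      + 2 * 16 ^ D * 2 powr (- (D powr (13/10) / 300))" for D :: nat
  show "g \<longlonglongrightarrow> 0"
    unfolding g_def by real_asymp
  show "\<forall>\<^sub>F D in sequentially. polymer_error D \<le> g D"
    using eventually_ge_at_top[of 2]
  proof eventually_elim
    case (elim D)
    define t where "t = (2/3::real) powr (D / 3)"
    have t: "0 \<le> t" "t \<le> 1" by (auto simp: t_def powr_le1)
    \<comment> \<open>The sixth power is exactly (4/9)^D, and twice 4/9 is 8/9 < 1; the seventh
      factor is merely bounded by 1.\<close>
    have "t ^ 6 = (2/3) powr (2 * D)"
      by (simp add: t_def powr_power)
    also have "\<dots> = (4/9) ^ D"
      using powr_realpow[of "2/3::real" "2 * D"] by (simp add: power_mult power_divide)
    finally have t6: "t ^ 6 = (4/9) ^ D" .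
    have "t ^ 7 = t ^ 6 * t" by (simp add: power_Suc2[symmetric])
    also have "\<dots> \<le> t ^ 6 * 1" using t by (intro mult_left_mono) auto
    finally have t7: "t ^ 7 \<le> (4/9) ^ D" by (simp add: t6)
    have "(2/3::real) ^ (2 * D - 4) * (2/3) ^ 4 = (2/3) ^ (2 * D)"
      using elim by (simp add: power_add[symmetric])
    then have e: "(2/3::real) ^ (2 * D - 4) = 81/16 * (4/9) ^ D"
      by (simp add: power_mult power_divide)
    have "(2::real) ^ D * (4/9) ^ D = (8/9) ^ D"
      by (simp flip: power_mult_distrib)
    moreover have "real D * (2 ^ D * ((real D ^ 4 * t) ^ 7)) \<le> real D ^ 29 * (2 ^ D * (4/9) ^ D)"
    proof -
      have "real D * (2 ^ D * ((real D ^ 4 * t) ^ 7)) = real D ^ 29 * 2 ^ D * t ^ 7"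
        by (simp add: power_mult_distrib power_mult[symmetric] mult_ac flip: power_Suc)
      also have "\<dots> \<le> real D ^ 29 * 2 ^ D * (4/9) ^ D"
        using t7 by (intro mult_left_mono) auto
      finally show ?thesis by (simp add: mult_ac)
    qed
    moreover have "real D * (2 ^ D * (real D ^ 20 * (81/16 * (4/9) ^ D))) = 81/16 * real D ^ 21 * (2 ^ D * (4/9) ^ D)"
      by (simp add: mult_ac flip: power_Suc)
    ultimately show ?case
      unfolding polymer_error_def g_def t_def[symmetric] e distrib_left by simp
  qed
qed (auto simp: polymer_error_def intro!: always_eventually add_nonneg_nonneg mult_nonneg_nonneg)

lemma balanced_error_tendsto: "balanced_error \<longlonglongrightarrow> 0"
proof (rule tendsto_sandwich[where f = "\<lambda>_. 0"])
  define g where "g D = 2 * 8 ^ D * exp ((2 ^ D / 2) / D ^ 12) * 2 powr (- ((2 ^ D / 2) * D powr (-7/10) / 200))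
     + 2 powr (2 * (2 ^ D / 2) / D) * 3 powr (- (D powr (3/4) / 2 * ((2 ^ D / 2) / D))) * exp ((2 ^ D / 2) * 3 powr (- (D powr (3/4) / 2)))
     + exp (- ((2 ^ D / 2) / 15)) * 10 powr ((1 / D + D powr (-7/10) + 4 * D powr (-1/10)) * (2 ^ D / 2))" for D :: nat
  show "g \<longlonglongrightarrow> 0"
    unfolding g_def by real_asymp
  \<comment> \<open>The bound ln (2/3) \<le> -1/3 suffices, since -1/6 + 1/10 = -1/15.\<close>
  have "(2/3) powr (z / 2) * exp (z * (1/10)) \<le> exp (- (z / 15))" if "z \<ge> 0" for z :: real
  proof -
    have "ln (2/3::real) \<le> - 1/3"
      using ln_le_minus_one[of "2/3::real"] by simp
    then have "z / 2 * ln (2/3) \<le> z / 2 * (- 1/3)"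
      using that by (intro mult_left_mono) auto
    then have "z / 2 * ln (2/3) + z * (1/10) \<le> - (z / 15)"
      by simp
    then show ?thesis
      by (simp add: powr_def exp_add[symmetric])
  qed
  from this[of "2 ^ D / 2" for D :: nat] show "\<forall>\<^sub>F D in sequentially. balanced_error D \<le> g D"
    by (intro always_eventually allI) (simp add: balanced_error_def g_def Let_def mult_right_mono)
qed (auto simp: balanced_error_def Let_def intro!: always_eventually add_nonneg_nonneg mult_nonneg_nonneg)

definition overlap_error :: "nat \<Rightarrow> real" where
  "overlap_error d = (exp (2 ^ (d - 1) / d) * d powr (2 ^ (d - 1) / d))\<^sup>2 / 2 ^ (2 ^ (d - 1))"

lemma overlap_error_tendsto: "overlap_error \<longlonglongrightarrow> 0"
proof -
  have "(\<lambda>D::nat. (exp ((2 ^ D / 2) / D) * D powr ((2 ^ D / 2) / D))\<^sup>2 / 2 powr (2 ^ D / 2) :: real) \<longlonglongrightarrow> 0"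
    by real_asymp
  moreover have "\<forall>\<^sub>F D in sequentially. (exp ((2 ^ D / 2) / D) * D powr ((2 ^ D / 2) / D))\<^sup>2 / 2 powr (2 ^ D / 2) = overlap_error D"
    using eventually_ge_at_top[of 1]
  proof eventually_elim
    case (elim D)
    then have half: "(2::real) ^ D / 2 = 2 ^ (D - 1)" by (cases D) auto
    have "(2::real) ^ (2 ^ (D - 1)) = 2 powr (2 ^ (D - 1))"
      using powr_realpow[of "2::real" "2 ^ (D - 1)"] by simp
    then show ?case
      unfolding overlap_error_def half by simp
  qed
  ultimately show ?thesis
    by (rule Lim_transform_eventually)
qed

theorem theorem2p1:
  fixes p :: "nat \<Rightarrow> real"
  assumes prob: "\<And>d. 0 \<le> p d \<and> p d \<le> 1"
    and growth: "filterlim (\<lambda>d. real d * (p d - 2/3)) at_top sequentially"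
  defines "f \<equiv> (\<lambda>d. 2 * exp ((2 - p d) ^ d / 2) * 2 ^ (2 ^ (d - 1)))"
  shows "((\<lambda>d. expected_indep d (p d) / f d) \<longlonglongrightarrow> 1) \<and>
         (\<forall>\<epsilon>>0. (\<lambda>d. qdp_prob d (p d) (\<lambda>F. \<bar>real (num_indep d F) / f d - 1\<bar> > \<epsilon>)) \<longlonglongrightarrow> 0)"
proof -
  \<comment> \<open>The product of \<open>n d\<close> and \<open>x d\<close> is the exponent (2 -
    p)^d / 2 of the claim. The excess of the second moment is governed by \<open>n d * y d\<close>
    for two copies on the same side and by \<open>s d\<close> for copies on opposite sides.\<close>
  define n where "n d = (2::real) ^ (d - 1)" for d :: nat
  define x where "x d = ((2 - p d) / 2) ^ d" for d
  define y where "y d = ((4 - 3 * p d) / 4) ^ d" for d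
  define X where "X d = typical_count d" for d
  define mu where "mu d = cube_expect d (p d) (X d) / f d" for d
  define ov where "ov d = cube_expect d (p d) (overlap_count d) / f d" for d
  define sq where "sq d = cube_expect d (p d) (\<lambda>F. (X d F)\<^sup>2) / (f d)\<^sup>2" for d
  define ei where "ei d = expected_indep d (p d) / f d" for d
  define s where "s d = n d * x d * ((1 + 4 * x d) ^ d - 1)" for d
  have fpos: "f d > 0" for d by (simp add: f_def)
  have x0: "x d \<ge> 0" and y0: "y d \<ge> 0" and n0: "n d > 0" for d
    using prob[of d] by (auto simp: x_def y_def n_def)
  have e1: "1 \<le> exp (n d * x d)" for d
    using n0[of d] x0[of d] by simp
  have f_eq: "f d = 2 * exp (n d * x d) * 2 ^ (2 ^ (d - 1))" if "d \<ge> 1" for d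
  proof -
    have "(2 - p d) ^ d / 2 = n d * x d"
      using that by (cases d) (auto simp: n_def x_def power_divide)
    then show ?thesis by (simp add: f_def)
  qed
  have ev_d: "\<forall>\<^sub>F d in sequentially. d \<ge> 1"
    by (rule eventually_ge_at_top)
  have ev_p: "\<forall>\<^sub>F d in sequentially. 2/3 \<le> p d"
    using filterlim_at_top_dense[THEN iffD1, OF growth, rule_format, of 0]
    by eventually_elim (simp add: zero_less_mult_iff)
  have x_le: "\<forall>\<^sub>F d in sequentially. x d \<le> (2/3) ^ d"
    using ev_p
  proof eventually_elim
    case (elim d)
    then show ?case
      unfolding x_def using prob[of d] by (intro power_mono) auto
  qed
  \<comment> \<open>All second-order terms are controlled by 2 (2/3)^2 = 8/9.\<close>
  have nx2: "\<forall>\<^sub>F d in sequentially. n d * (x d)\<^sup>2 \<le> (8/9) ^ d"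
    using x_le ev_d
  proof eventually_elim
    case (elim d)
    have "n d * (x d)\<^sup>2 \<le> 2 ^ d * ((2/3) ^ d)\<^sup>2"
      using elim x0[of d] by (intro mult_mono power_mono) (auto simp: n_def)
    also have "\<dots> = (8/9) ^ d"
      by (simp add: power2_eq_square flip: power_mult_distrib)
    finally show ?case .
  qed
  have nx2_lim: "(\<lambda>d. real d ^ k * (n d * (x d)\<^sup>2)) \<longlonglongrightarrow> 0" if k: "k \<le> 2" for k
  proof (rule tendsto_sandwich[where f = "\<lambda>_. 0"])
    show "\<forall>\<^sub>F d in sequentially. real d ^ k * (n d * (x d)\<^sup>2) \<le> real d ^ k * (8/9) ^ d"
      using nx2 by eventually_elim (intro mult_left_mono, auto)
    show "(\<lambda>d. real d ^ k * (8/9) ^ d) \<longlonglongrightarrow> 0"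
    proof -
      have "k = 0 \<or> k = 1 \<or> k = 2" using k by linarith
      then show ?thesis
        by (elim disjE; hypsubst; real_asymp)
    qed
    show "\<forall>\<^sub>F d in sequentially. 0 \<le> real d ^ k * (n d * (x d)\<^sup>2)"
      using n0 by (intro always_eventually allI mult_nonneg_nonneg) (auto intro: less_imp_le)
  qed simp
  have s_lim: "s \<longlonglongrightarrow> 0"
  proof (rule tendsto_sandwich[where f = "\<lambda>_. 0"])
    have "(\<lambda>d::nat. 4 * d * (2/3) ^ d :: real) \<longlonglongrightarrow> 0"
      by real_asymp
    then have "\<forall>\<^sub>F d::nat in sequentially. 4 * d * (2/3) ^ d < (1::real)"
      by (rule order_tendstoD) simp
    then show "\<forall>\<^sub>F d in sequentially. s d \<le> 8 * (real d ^ 1 * (n d * (x d)\<^sup>2))"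
      using x_le
    proof eventually_elim
      case (elim d)
      have "4 * d * x d \<le> 4 * d * (2/3) ^ d"
        using elim(2) by (intro mult_left_mono) auto
      then have z: "0 \<le> 4 * d * x d" "4 * d * x d \<le> 1"
        using elim(1) x0[of d] by auto
      have "(1 + 4 * x d) ^ d \<le> exp (4 * x d) ^ d"
        using x0[of d] by (intro power_mono) auto
      also have "\<dots> = exp (4 * d * x d)"
        by (simp add: exp_of_nat_mult[symmetric] mult_ac)
      also have "\<dots> \<le> 1 + 4 * d * x d + (4 * d * x d)\<^sup>2"
        by (rule exp_bound[OF z])
      also have "(4 * d * x d)\<^sup>2 \<le> 4 * d * x d"
        using mult_left_mono[OF z(2,1)] by (simp only: power2_eq_square mult_1_right)
      finally have "(1 + 4 * x d) ^ d - 1 \<le> 8 * d * x d" by simp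
      then have "s d \<le> n d * x d * (8 * d * x d)"
        unfolding s_def using n0[of d] x0[of d] by (intro mult_left_mono) auto
      then show ?case by (simp add: power2_eq_square mult_ac)
    qed
    show "(\<lambda>d. 8 * (real d ^ 1 * (n d * (x d)\<^sup>2))) \<longlonglongrightarrow> 0"
      using tendsto_mult_left[OF nx2_lim[of 1], of 8] by simp
    show "\<forall>\<^sub>F d in sequentially. 0 \<le> s d"
      using n0 x0 by (intro always_eventually allI) (auto simp: s_def intro!: mult_nonneg_nonneg intro: less_imp_le)
  qed simp
  \<comment> \<open>Here the growth hypothesis enters in full: 2 (4 - 3 p) / 4 equals 1 - 3/2 (p -
    2/3), whose d-th power is at most the exponential of -3/2 d (p - 2/3).\<close>
  have ny_lim: "(\<lambda>d. n d * y d) \<longlonglongrightarrow> 0"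
  proof (rule tendsto_sandwich[where f = "\<lambda>_. 0"])
    show "\<forall>\<^sub>F d in sequentially. n d * y d \<le> exp (- (3/2 * (real d * (p d - 2/3))))"
      using ev_d
    proof eventually_elim
      case (elim d)
      have "n d * y d \<le> 2 ^ d * y d"
        using y0[of d] by (intro mult_right_mono) (auto simp: n_def)
      also have "\<dots> = (1 + (- (3/2 * (p d - 2/3)))) ^ d"
      proof -
        have "2 * ((4 - 3 * p d) / 4) = 1 + (- (3/2 * (p d - 2/3)))"
          by (simp add: field_simps)
        then show ?thesis
          by (simp only: y_def power_mult_distrib[symmetric])
      qed
      also have "\<dots> \<le> exp (- (3/2 * (p d - 2/3))) ^ d"
        using prob[of d] exp_ge_add_one_self[of "- (3/2 * (p d - 2/3))"] by (intro power_mono) auto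
      also have "\<dots> = exp (- (3/2 * (real d * (p d - 2/3))))"
        by (simp add: exp_of_nat_mult[symmetric] mult_ac)
      finally show ?case .
    qed
    have "filterlim (\<lambda>d. - (3/2 * (real d * (p d - 2/3)))) at_bot sequentially"
      unfolding filterlim_uminus_at_top[symmetric]
      by (intro filterlim_tendsto_pos_mult_at_top[OF tendsto_const _ growth]) simp
    then show "(\<lambda>d. exp (- (3/2 * (real d * (p d - 2/3))))) \<longlonglongrightarrow> 0"
      by (rule filterlim_compose[OF exp_at_bot])
    show "\<forall>\<^sub>F d in sequentially. 0 \<le> n d * y d"
      using n0 y0 by (intro always_eventually allI mult_nonneg_nonneg) (auto intro: less_imp_le)
  qed simp
  have ei_le: "\<forall>\<^sub>F d in sequentially. ei d \<le> exp (polymer_error d) + balanced_error d"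
  proof -
    have "\<forall>\<^sub>F d::nat in sequentially. real d ^ 4 * (2/3) powr (d / 3) \<le> 1" by real_asymp
    moreover have "\<forall>\<^sub>F d::nat in sequentially. 1 \<le> (1 + 1 / (2 * sqrt d)) * (1 - d powr (-6/10))" by real_asymp
    moreover have "\<forall>\<^sub>F d::nat in sequentially. d powr (-6/10) \<le> 1/2" by real_asymp
    ultimately show ?thesis
      using eventually_large_dim ev_d ev_p
    proof eventually_elim
      case (elim d)
      have b0: "balanced_error d \<ge> 0"
        by (auto simp: balanced_error_def Let_def intro!: add_nonneg_nonneg mult_nonneg_nonneg)
      have "expected_indep d (p d) \<le> 2 ^ (2 ^ (d - 1)) * (2 * exp (n d * x d + polymer_error d) + balanced_error d)"
        using expected_indep_le[OF elim(5,4) _ elim(6,1,2,3)] prob[of d] by (simp add: n_def x_def)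
      \<comment> \<open>The additive error becomes a relative one because the main exponential is at
        least 1.\<close>
      also have "\<dots> \<le> 2 ^ (2 ^ (d - 1)) * (2 * exp (n d * x d + polymer_error d) + 2 * exp (n d * x d) * balanced_error d)"
      proof (intro mult_left_mono add_left_mono)
        have "1 * balanced_error d \<le> (2 * exp (n d * x d)) * balanced_error d"
          using b0 e1[of d] by (intro mult_right_mono) linarith+
        then show "balanced_error d \<le> 2 * exp (n d * x d) * balanced_error d" by simp
      qed auto
      also have "\<dots> = f d * (exp (polymer_error d) + balanced_error d)"
        unfolding f_eq[OF elim(5)] by (simp add: exp_add algebra_simps)
      finally show ?case
        using fpos[of d] by (simp add: ei_def divide_le_eq mult.commute)
    qed
  qed
  have ei_ge: "\<forall>\<^sub>F d in sequentially. mu d - ov d \<le> ei d"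
    using ev_d
  proof eventually_elim
    case (elim d)
    have "cube_expect d (p d) (X d) \<le> cube_expect d (p d) (\<lambda>F. real (num_indep d F) + overlap_count d F)"
      unfolding X_def using prob[of d] by (intro cube_expect_mono typical_le_num_indep elim) auto
    also have "\<dots> = expected_indep d (p d) + cube_expect d (p d) (overlap_count d)"
      unfolding cube_expect_add by (simp add: cube_expect_def expected_indep_def)
    finally have "cube_expect d (p d) (X d) / f d \<le> (expected_indep d (p d) + cube_expect d (p d) (overlap_count d)) / f d"
      using fpos[of d] by (intro divide_right_mono) auto
    then show ?case
      by (simp add: mu_def ov_def ei_def add_divide_distrib)
  qed
  have mu_ge: "\<forall>\<^sub>F d in sequentially. exp (- (n d * (x d)\<^sup>2)) * (1 - real d ^ 2 * (n d * (x d)\<^sup>2)) \<le> mu d"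
  proof -
    have "\<forall>\<^sub>F d in sequentially. real d ^ 2 * (n d * (x d)\<^sup>2) < 1"
      by (rule order_tendstoD[OF nx2_lim]) simp_all
    then show ?thesis
      using ev_d x_le
    proof eventually_elim
      case (elim d)
      have "(2/3::real) ^ d \<le> 1" by (rule power_le_one) auto
      then have "x d \<le> 1" using elim(3) by linarith
      then have "x d - (x d)\<^sup>2 \<le> ln (1 + x d)"
        using x0[of d] by (intro ln_one_plus_pos_lower_bound)
      then have "exp (x d - (x d)\<^sup>2) \<le> 1 + x d"
        using x0[of d] by (subst ln_ge_iff[symmetric]) auto
      then have "exp (x d - (x d)\<^sup>2) ^ 2 ^ (d - 1) \<le> (1 + x d) ^ 2 ^ (d - 1)"
        by (intro power_mono) auto
      also have "exp (x d - (x d)\<^sup>2) ^ 2 ^ (d - 1) = exp (n d * x d) * exp (- (n d * (x d)\<^sup>2))"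
        by (simp add: exp_of_nat_mult[symmetric] exp_add[symmetric] n_def algebra_simps)
      finally have "exp (n d * x d) * exp (- (n d * (x d)\<^sup>2)) \<le> (1 + x d) ^ 2 ^ (d - 1)" .
      then have "2 * 2 ^ (2 ^ (d - 1)) * ((exp (n d * x d) * exp (- (n d * (x d)\<^sup>2))) * (1 - real d ^ 2 * (n d * (x d)\<^sup>2)))
          \<le> 2 * 2 ^ (2 ^ (d - 1)) * ((1 + x d) ^ 2 ^ (d - 1) * (1 - real d ^ 2 * (n d * (x d)\<^sup>2)))"
        using elim(1) by (intro mult_left_mono mult_right_mono) auto
      also have "\<dots> \<le> cube_expect d (p d) (X d)"
        using expect_typical_ge[OF elim(2), of "p d"] prob[of d] by (simp add: X_def x_def n_def mult_ac)
      finally have "f d * (exp (- (n d * (x d)\<^sup>2)) * (1 - real d ^ 2 * (n d * (x d)\<^sup>2))) \<le> cube_expect d (p d) (X d)"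
        unfolding f_eq[OF elim(2)] by (simp add: mult_ac)
      then show ?case
        using fpos[of d] by (simp add: mu_def le_divide_eq mult.commute)
    qed
  qed
  have ov_le: "\<forall>\<^sub>F d in sequentially. ov d \<le> overlap_error d"
    using ev_d
  proof eventually_elim
    case (elim d)
    have "2 ^ (2 ^ (d - 1)) \<le> f d"
    proof -
      have "1 * 2 ^ (2 ^ (d - 1)) \<le> 2 * exp (n d * x d) * 2 ^ (2 ^ (d - 1))"
        using e1[of d] by (intro mult_right_mono) (linarith, simp)
      then show ?thesis unfolding f_eq[OF elim] by simp
    qed
    then show ?case
      unfolding ov_def overlap_error_def using expect_overlap_le[OF elim, of "p d"] prob[of d]
      by (intro frac_le) auto
  qed
  have ov0: "ov d \<ge> 0" if "d \<ge> 1" for d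
    using prob[of d] fpos[of d] subgraph_prob_nonneg overlap_count_nonneg[OF that]
    by (auto simp: ov_def cube_expect_def intro!: divide_nonneg_pos sum_nonneg mult_nonneg_nonneg)
  \<comment> \<open>Each one-sided count is about half of \<open>f d\<close>, so each of its four
    products has weight 1/4: two on the same side and two mixed.\<close>
  have sq_le: "\<forall>\<^sub>F d in sequentially. sq d \<le> (exp (n d * y d) + exp (s d)) / 2"
    using ev_d
  proof eventually_elim
    case (elim d)
    have pw: "(1 + t) ^ 2 ^ (d - 1) \<le> exp (n d * t)" if "t \<ge> 0" for t :: real
    proof -
      have "(1 + t) ^ 2 ^ (d - 1) \<le> exp t ^ 2 ^ (d - 1)"
        using that by (intro power_mono) auto
      then show ?thesis by (simp add: exp_of_nat_mult[symmetric] n_def)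
    qed
    have "(1 + 2 * x d + y d) ^ 2 ^ (d - 1) \<le> exp (n d * (2 * x d + y d))"
      using pw[of "2 * x d + y d"] x0[of d] y0[of d] by (simp add: add.assoc)
    also have "\<dots> = (exp (n d * x d))\<^sup>2 * exp (n d * y d)"
      by (simp add: exp_add[symmetric] power2_eq_square algebra_simps)
    finally have 1: "(1 + 2 * x d + y d) ^ 2 ^ (d - 1) \<le> (exp (n d * x d))\<^sup>2 * exp (n d * y d)" .
    have "(1 + x d) ^ 2 ^ (d - 1) * (1 + x d * (1 + 4 * x d) ^ d) ^ 2 ^ (d - 1)
        \<le> exp (n d * x d) * exp (n d * (x d * (1 + 4 * x d) ^ d))"
      using x0[of d] by (intro mult_mono pw) auto
    also have "\<dots> = (exp (n d * x d))\<^sup>2 * exp (s d)"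
      by (simp add: exp_add[symmetric] power2_eq_square s_def algebra_simps)
    finally have 2: "(1 + x d) ^ 2 ^ (d - 1) * (1 + x d * (1 + 4 * x d) ^ d) ^ 2 ^ (d - 1)
        \<le> (exp (n d * x d))\<^sup>2 * exp (s d)" .
    have "cube_expect d (p d) (\<lambda>F. (X d F)\<^sup>2)
       \<le> 2 * 4 ^ (2 ^ (d - 1)) * ((1 + 2 * x d + y d) ^ 2 ^ (d - 1) + (1 + x d) ^ 2 ^ (d - 1) * (1 + x d * (1 + 4 * x d) ^ d) ^ 2 ^ (d - 1))"
      using expect_typical_square_le[OF elim, of "p d"] prob[of d] by (simp add: X_def x_def y_def)
    also have "\<dots> \<le> 2 * 4 ^ (2 ^ (d - 1)) * ((exp (n d * x d))\<^sup>2 * exp (n d * y d) + (exp (n d * x d))\<^sup>2 * exp (s d))"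
      using 1 2 by (intro mult_left_mono add_mono) auto
    also have "\<dots> = (f d)\<^sup>2 * ((exp (n d * y d) + exp (s d)) / 2)"
    proof -
      have "(4::real) ^ k = (2 ^ k)\<^sup>2" for k by (simp add: power2_eq_square flip: power_mult_distrib)
      then show ?thesis
        unfolding f_eq[OF elim] by (simp add: power_mult_distrib algebra_simps)
    qed
    finally show ?case
      using fpos[of d] by (simp add: sq_def divide_le_eq mult.commute)
  qed
  have up_lim: "(\<lambda>d. exp (polymer_error d) + balanced_error d) \<longlonglongrightarrow> 1"
    using tendsto_add[OF tendsto_exp[OF polymer_error_tendsto] balanced_error_tendsto] by simp
  have low_lim: "(\<lambda>d. exp (- (n d * (x d)\<^sup>2)) * (1 - real d ^ 2 * (n d * (x d)\<^sup>2))) \<longlonglongrightarrow> 1"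
  proof -
    have "(\<lambda>d. exp (- (n d * (x d)\<^sup>2)) * (1 - real d ^ 2 * (n d * (x d)\<^sup>2))) \<longlonglongrightarrow> exp (- 0) * (1 - 0)"
      using nx2_lim[of 0] nx2_lim[of 2] by (intro tendsto_intros) auto
    then show ?thesis by simp
  qed
  have ov_lim: "ov \<longlonglongrightarrow> 0"
    by (rule tendsto_sandwich[OF eventually_mono[OF ev_d ov0] ov_le tendsto_const overlap_error_tendsto])
  \<comment> \<open>The upper bound for the typical mean is inherited from the full mean, up to the
    overlap.\<close>
  have mu_lim: "mu \<longlonglongrightarrow> 1"
  proof (rule tendsto_sandwich[OF mu_ge _ low_lim])
    show "\<forall>\<^sub>F d in sequentially. mu d \<le> (exp (polymer_error d) + balanced_error d) + ov d"
      using ei_le ei_ge by eventually_elim linarith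
    show "(\<lambda>d. (exp (polymer_error d) + balanced_error d) + ov d) \<longlonglongrightarrow> 1"
      using tendsto_add[OF up_lim ov_lim] by simp
  qed
  have ei_lim: "ei \<longlonglongrightarrow> 1"
  proof (rule tendsto_sandwich[OF ei_ge ei_le _ up_lim])
    show "(\<lambda>d. mu d - ov d) \<longlonglongrightarrow> 1"
      using tendsto_diff[OF mu_lim ov_lim] by simp
  qed
  have "(\<lambda>d. qdp_prob d (p d) (\<lambda>F. \<bar>real (num_indep d F) / f d - 1\<bar> > \<epsilon>)) \<longlonglongrightarrow> 0"
    if eps: "\<epsilon> > 0" for \<epsilon>
  proof (rule tendsto_sandwich[where f = "\<lambda>_. 0"])
    \<comment> \<open>Markov at level \<epsilon> / 2 for the gap between full and typical count, and
      Chebyshev at level \<epsilon> / 2 for the typical count.\<close>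
    define B where "B d = 2 / \<epsilon> * (ei d - mu d + 2 * ov d) + 4 / \<epsilon>\<^sup>2 * ((exp (n d * y d) + exp (s d)) / 2 - 2 * mu d + 1)" for d
    show "B \<longlonglongrightarrow> 0"
    proof -
      have "B \<longlonglongrightarrow> 2 / \<epsilon> * (1 - 1 + 2 * 0) + 4 / \<epsilon>\<^sup>2 * ((exp 0 + exp 0) / 2 - 2 * 1 + 1)"
        unfolding B_def by (intro tendsto_intros ei_lim mu_lim ov_lim ny_lim s_lim) auto
      then show ?thesis by simp
    qed
    show "\<forall>\<^sub>F d in sequentially. 0 \<le> qdp_prob d (p d) (\<lambda>F. \<bar>real (num_indep d F) / f d - 1\<bar> > \<epsilon>)"
      using prob subgraph_prob_nonneg by (intro always_eventually allI) (auto simp: qdp_prob_def intro!: sum_nonneg)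
    show "\<forall>\<^sub>F d in sequentially. qdp_prob d (p d) (\<lambda>F. \<bar>real (num_indep d F) / f d - 1\<bar> > \<epsilon>) \<le> B d"
      using ev_d sq_le
    proof eventually_elim
      case (elim d)
      define i where "i F = real (num_indep d F) / f d" for F
      define u where "u F = X d F / f d" for F
      define v where "v F = overlap_count d F / f d" for F
      have "qdp_prob d (p d) (\<lambda>F. \<bar>i F - 1\<bar> > \<epsilon>) = cube_expect d (p d) (\<lambda>F. if \<bar>i F - 1\<bar> > \<epsilon> then 1 else 0)"
        unfolding qdp_prob_def cube_expect_def using finite_hc_edges[of d]
        by (intro sum.mono_neutral_cong_left) auto
      \<comment> \<open>Differences are written as sums and scalar multiples so that linearity of
        \<open>cube_expect\<close> rewrites them directly.\<close>
      also have "\<dots> \<le> cube_expect d (p d) (\<lambda>F. 2 / \<epsilon> * ((i F + (- 1) * u F) + 2 * v F) + 4 / \<epsilon>\<^sup>2 * (((u F)\<^sup>2 + (- 2) * u F) + 1))"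
      proof (intro cube_expect_mono)
        fix F assume F: "F \<subseteq> hc_edges d"
        have v0: "v F \<ge> 0"
          unfolding v_def by (rule divide_nonneg_pos[OF overlap_count_nonneg[OF elim(1)] fpos])
        have "X d F / f d \<le> (real (num_indep d F) + overlap_count d F) / f d"
          unfolding X_def using typical_le_num_indep[OF elim(1) F] fpos[of d] by (intro divide_right_mono) auto
        then have uv: "u F \<le> i F + v F" by (simp add: u_def i_def v_def add_divide_distrib)
        have sq: "(u F)\<^sup>2 + (- 2) * u F + 1 = (u F - 1)\<^sup>2"
          by (simp add: power2_eq_square algebra_simps)
        have t1: "0 \<le> 2 / \<epsilon> * ((i F + (- 1) * u F) + 2 * v F)" using eps uv v0 by (intro mult_nonneg_nonneg) auto
        have t2: "0 \<le> 4 / \<epsilon>\<^sup>2 * ((u F - 1)\<^sup>2)" using eps by simp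
        \<comment> \<open>If \<open>i\<close> is off by \<epsilon>, then \<open>u\<close> is off by
          \<epsilon> / 2 or differs from \<open>i\<close> by that much. Since
          \<open>u \<le> i + v\<close>, the absolute difference is at most i - u + 2 v, an
          expression linear in the counts, whose mean is known.\<close>
        have "1 \<le> 2 / \<epsilon> * ((i F + (- 1) * u F) + 2 * v F) + 4 / \<epsilon>\<^sup>2 * (u F - 1)\<^sup>2" if "\<bar>i F - 1\<bar> > \<epsilon>"
        proof (cases "\<bar>u F - 1\<bar> \<ge> \<epsilon> / 2")
          case True
          then have "(\<epsilon> / 2)\<^sup>2 \<le> \<bar>u F - 1\<bar>\<^sup>2" using eps by (intro power_mono) auto
          then have "1 \<le> 4 / \<epsilon>\<^sup>2 * (u F - 1)\<^sup>2"
            using eps by (simp add: power_divide field_simps)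
          then show ?thesis using t1 by linarith
        next
          case False
          then have "\<epsilon> / 2 \<le> \<bar>i F - u F\<bar>" using that by linarith
          then have "\<epsilon> / 2 \<le> (i F + (- 1) * u F) + 2 * v F" using uv v0 by linarith
          then have "2 / \<epsilon> * (\<epsilon> / 2) \<le> 2 / \<epsilon> * ((i F + (- 1) * u F) + 2 * v F)"
            using eps by (intro mult_left_mono) auto
          moreover have "2 / \<epsilon> * (\<epsilon> / 2) = 1" using eps by simp
          ultimately show ?thesis using t2 by linarith
        qed
        then show "(if \<bar>i F - 1\<bar> > \<epsilon> then 1 else 0) \<le> 2 / \<epsilon> * ((i F + (- 1) * u F) + 2 * v F) + 4 / \<epsilon>\<^sup>2 * (((u F)\<^sup>2 + (- 2) * u F) + 1)"
          unfolding sq using t1 t2 by auto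
      qed (use prob[of d] in auto)
      also have "\<dots> = 2 / \<epsilon> * ((cube_expect d (p d) i + (- 1) * cube_expect d (p d) u) + 2 * cube_expect d (p d) v)
          + 4 / \<epsilon>\<^sup>2 * ((cube_expect d (p d) (\<lambda>F. (u F)\<^sup>2) + (- 2) * cube_expect d (p d) u) + 1)"
        by (simp only: cube_expect_add cube_expect_cmult cube_expect_one)
      also have "cube_expect d (p d) i = ei d"
        by (simp add: i_def ei_def cube_expect_def expected_indep_def sum_divide_distrib)
      also have "cube_expect d (p d) u = mu d"
        by (simp add: u_def mu_def cube_expect_def sum_divide_distrib)
      also have "cube_expect d (p d) v = ov d"
        by (simp add: v_def ov_def cube_expect_def sum_divide_distrib)
      also have "cube_expect d (p d) (\<lambda>F. (u F)\<^sup>2) = sq d"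
        by (simp add: u_def sq_def cube_expect_def sum_divide_distrib power_divide)
      also have "2 / \<epsilon> * ((ei d + (- 1) * mu d) + 2 * ov d) + 4 / \<epsilon>\<^sup>2 * ((sq d + (- 2) * mu d) + 1) \<le> B d"
      proof -
        have "4 / \<epsilon>\<^sup>2 * ((sq d + (- 2) * mu d) + 1) \<le> 4 / \<epsilon>\<^sup>2 * ((exp (n d * y d) + exp (s d)) / 2 - 2 * mu d + 1)"
          using elim(2) by (intro mult_left_mono) auto
        then show ?thesis by (simp add: B_def)
      qed
      finally show ?case by (simp add: i_def)
    qed
  qed simp
  then show ?thesis
    using ei_lim by (simp add: ei_def[abs_def])
qed

end
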